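(* Let $m\ge 1$ and let $k$ be a splitting field of characteristic $p\ge 0$ for the monoid $M$, where either 1. $p=0$ and $M=T_m$, or 2. $p\nmid m!$ and $M=I_m$. Let $V$ be a finite-dimensional $kM$-module on which no element of $M$ other than $1$ acts as the identity. Let $b(n)$ be the number of indecomposable summands (counted with multiplicity) and $l(n)$ the length (number of composition factors) of the $kM$-module $V^{\otimes n}$. Then $$b(n)\ \sim\ \sum_{z=0}^{\lfloor m/2\rfloor}\frac{1}{(m-2z)!\,z!\,2^z}\cdot(\dim V)^n\ \sim\ l(n).$$
   Context: $T_m$ is the full transformation monoid on $m$ elements (all self-maps of an $m$-element set under composition). $I_m$ is the symmetric inverse monoid on $m$ elements (all partial injective self-maps of an $m$-element set under composition). $M$ acts diagonally on tensor products of $kM$-modules. For functions $f,g$ of $n$, $f(n)\sim g(n)$ means $f(n)/g(n)\to 1$ as $n\to\infty$. *)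

theory Defs
  imports
    "HOL-Algebra.Group"
    "HOL-Library.FuncSet"
    "HOL-Library.Function_Algebras"
    "HOL-Library.Landau_Symbols"
begin

section \<open>The monoids\<close>

text \<open>
  Both monoids are realised on \<open>{..<m}\<close> inside \<open>nat \<rightharpoonup> nat\<close>, with \<open>f \<circ>\<^sub>m g\<close> meaning
  ``first \<open>g\<close>, then \<open>f\<close>''. A self-map is a partial map whose domain is all of \<open>{..<m}\<close>.
\<close>

definition full_transformation_monoid :: "nat \<Rightarrow> (nat \<rightharpoonup> nat) monoid" where
  "full_transformation_monoid m =
     \<lparr> carrier = {f. dom f = {..<m} \<and> ran f \<subseteq> {..<m}},
       monoid.mult = (\<circ>\<^sub>m),
       one = Some |` {..<m} \<rparr>"

definition symmetric_inverse_monoid :: "nat \<Rightarrow> (nat \<rightharpoonup> nat) monoid" where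
  "symmetric_inverse_monoid m =
     \<lparr> carrier = {f. dom f \<subseteq> {..<m} \<and> ran f \<subseteq> {..<m} \<and> inj_on f (dom f)},
       monoid.mult = (\<circ>\<^sub>m),
       one = Some |` {..<m} \<rparr>"

lemma monoid_full_transformation_monoid: "monoid (full_transformation_monoid m)"
proof (rule monoidI; simp only: full_transformation_monoid_def partial_object.simps monoid.simps mem_Collect_eq)
  fix x y :: "nat \<rightharpoonup> nat"
  assume x: "dom x = {..<m} \<and> ran x \<subseteq> {..<m}" and y: "dom y = {..<m} \<and> ran y \<subseteq> {..<m}"
  have xy: "x j \<noteq> None" if "y i = Some j" for i j
  proof -
    have "j \<in> dom x" using that x y ranI[of y i j] by blast
    then show ?thesis by auto
  qed
  have "dom (x \<circ>\<^sub>m y) = dom y"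
  proof (rule Set.set_eqI)
    fix i show "i \<in> dom (x \<circ>\<^sub>m y) \<longleftrightarrow> i \<in> dom y"
      using xy[of i] by (cases "y i") (auto simp: domIff)
  qed
  moreover have "ran (x \<circ>\<^sub>m y) \<subseteq> ran x"
    by (auto simp: map_comp_def ran_def split: option.splits)
  ultimately show "dom (x \<circ>\<^sub>m y) = {..<m} \<and> ran (x \<circ>\<^sub>m y) \<subseteq> {..<m}" using x y by blast
next
  show "dom (Some |` {..<m}) = {..<m} \<and> ran (Some |` {..<m}) \<subseteq> {..<m}"
    by (auto simp: restrict_map_def dom_def ran_def split: if_splits)
next
  fix x y z :: "nat \<rightharpoonup> nat"
  show "(x \<circ>\<^sub>m y) \<circ>\<^sub>m z = x \<circ>\<^sub>m (y \<circ>\<^sub>m z)"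
    by (simp add: map_comp_def fun_eq_iff split: option.split)
next
  fix x :: "nat \<rightharpoonup> nat"
  assume x: "dom x = {..<m} \<and> ran x \<subseteq> {..<m}"
  have "j < m" if "x i = Some j" for i j using x that by (auto simp: ran_def)
  then show "Some |` {..<m} \<circ>\<^sub>m x = x"
    by (auto simp: map_comp_def restrict_map_def fun_eq_iff split: option.split)
  have "x i = None" if "\<not> i < m" for i using x that by (auto simp: dom_def)
  then show "x \<circ>\<^sub>m Some |` {..<m} = x"
    by (auto simp: map_comp_def restrict_map_def fun_eq_iff split: option.split)
qed

lemma monoid_symmetric_inverse_monoid: "monoid (symmetric_inverse_monoid m)"
proof (rule monoidI; simp only: symmetric_inverse_monoid_def partial_object.simps monoid.simps mem_Collect_eq)
  fix x y :: "nat \<rightharpoonup> nat"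
  assume x: "dom x \<subseteq> {..<m} \<and> ran x \<subseteq> {..<m} \<and> inj_on x (dom x)"
    and y: "dom y \<subseteq> {..<m} \<and> ran y \<subseteq> {..<m} \<and> inj_on y (dom y)"
  have "dom (x \<circ>\<^sub>m y) \<subseteq> dom y"
    by (auto simp: map_comp_def dom_def split: option.splits)
  moreover have "ran (x \<circ>\<^sub>m y) \<subseteq> ran x"
    by (auto simp: map_comp_def ran_def split: option.splits)
  moreover have "inj_on (x \<circ>\<^sub>m y) (dom (x \<circ>\<^sub>m y))"
  proof (rule inj_onI)
    fix i j assume a: "i \<in> dom (x \<circ>\<^sub>m y)" "j \<in> dom (x \<circ>\<^sub>m y)" and e: "(x \<circ>\<^sub>m y) i = (x \<circ>\<^sub>m y) j"
    obtain i' i'' where i: "y i = Some i'" "x i' = Some i''"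
      using a(1) by (auto simp: map_comp_def dom_def split: option.splits)
    obtain j' j'' where j: "y j = Some j'" "x j' = Some j''"
      using a(2) by (auto simp: map_comp_def dom_def split: option.splits)
    have "x i' = x j'" using e i j by (simp add: map_comp_def)
    then have "i' = j'" using i j x by (metis domI inj_onD)
    then have "y i = y j" using i j by simp
    then show "i = j" using i j y by (metis domI inj_onD)
  qed
  ultimately show "dom (x \<circ>\<^sub>m y) \<subseteq> {..<m} \<and> ran (x \<circ>\<^sub>m y) \<subseteq> {..<m} \<and> inj_on (x \<circ>\<^sub>m y) (dom (x \<circ>\<^sub>m y))"
    using x y by blast
next
  show "dom (Some |` {..<m}) \<subseteq> {..<m} \<and> ran (Some |` {..<m}) \<subseteq> {..<m} \<and>
      inj_on (Some |` {..<m}) (dom (Some |` {..<m}))"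
    by (auto simp: restrict_map_def dom_def ran_def inj_on_def split: if_splits)
next
  fix x y z :: "nat \<rightharpoonup> nat"
  show "(x \<circ>\<^sub>m y) \<circ>\<^sub>m z = x \<circ>\<^sub>m (y \<circ>\<^sub>m z)"
    by (simp add: map_comp_def fun_eq_iff split: option.split)
next
  fix x :: "nat \<rightharpoonup> nat"
  assume x: "dom x \<subseteq> {..<m} \<and> ran x \<subseteq> {..<m} \<and> inj_on x (dom x)"
  have "j < m" if "x i = Some j" for i j using x that by (auto simp: ran_def)
  then show "Some |` {..<m} \<circ>\<^sub>m x = x"
    by (auto simp: map_comp_def restrict_map_def fun_eq_iff split: option.split)
  have "x i = None" if "\<not> i < m" for i using x that by (auto simp: dom_def)
  then show "x \<circ>\<^sub>m Some |` {..<m} = x"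
    by (auto simp: map_comp_def restrict_map_def fun_eq_iff split: option.split)
qed


section \<open>Modules over a monoid algebra\<close>

text \<open>
  A \<open>kM\<close>-module is a \<open>k\<close>-vector space with a linear (left, unital) action of \<open>M\<close>.
  The space is carried by a subspace \<open>vecs V\<close> of the ambient type, so that submodules and
  tensor powers are again objects of this kind.
\<close>

record ('a, 'k, 'v) monoid_module =
  vecs :: "'v set"
  smul :: "'k \<Rightarrow> 'v \<Rightarrow> 'v"
  action :: "'a \<Rightarrow> 'v \<Rightarrow> 'v"

definition is_module ::
  "('a, 'z) monoid_scheme \<Rightarrow> ('a, 'k::field, 'v::ab_group_add) monoid_module \<Rightarrow> bool" where
  "is_module M V \<longleftrightarrow>
     vector_space (smul V) \<and> module.subspace (smul V) (vecs V) \<and>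
     (\<forall>g\<in>carrier M. \<forall>v\<in>vecs V. action V g v \<in> vecs V) \<and>
     (\<forall>g\<in>carrier M. \<forall>v\<in>vecs V. \<forall>w\<in>vecs V. action V g (v + w) = action V g v + action V g w) \<and>
     (\<forall>g\<in>carrier M. \<forall>c. \<forall>v\<in>vecs V. action V g (smul V c v) = smul V c (action V g v)) \<and>
     (\<forall>v\<in>vecs V. action V \<one>\<^bsub>M\<^esub> v = v) \<and>
     (\<forall>g\<in>carrier M. \<forall>h\<in>carrier M. \<forall>v\<in>vecs V.
        action V (g \<otimes>\<^bsub>M\<^esub> h) v = action V g (action V h v))"

definition finite_dim :: "('a, 'k::field, 'v::ab_group_add) monoid_module \<Rightarrow> bool" where
  "finite_dim V \<longleftrightarrow> (\<exists>B. finite B \<and> module.span (smul V) B = vecs V)"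

definition module_dim :: "('a, 'k::field, 'v::ab_group_add) monoid_module \<Rightarrow> nat" where
  "module_dim V = vector_space.dim (smul V) (vecs V)"

definition submodule ::
  "('a, 'z) monoid_scheme \<Rightarrow> ('a, 'k::field, 'v::ab_group_add) monoid_module \<Rightarrow> 'v set \<Rightarrow> bool" where
  "submodule M V W \<longleftrightarrow>
     W \<subseteq> vecs V \<and> module.subspace (smul V) W \<and> (\<forall>g\<in>carrier M. \<forall>w\<in>W. action V g w \<in> W)"

definition simple_module ::
  "('a, 'z) monoid_scheme \<Rightarrow> ('a, 'k::field, 'v::ab_group_add) monoid_module \<Rightarrow> bool" where
  "simple_module M V \<longleftrightarrow>
     is_module M V \<and> vecs V \<noteq> {0} \<and> (\<forall>W. submodule M V W \<longrightarrow> W = {0} \<or> W = vecs V)"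

definition indecomposable_module ::
  "('a, 'z) monoid_scheme \<Rightarrow> ('a, 'k::field, 'v::ab_group_add) monoid_module \<Rightarrow> bool" where
  "indecomposable_module M V \<longleftrightarrow>
     is_module M V \<and> vecs V \<noteq> {0} \<and>
     \<not> (\<exists>A B. submodule M V A \<and> submodule M V B \<and> A \<noteq> {0} \<and> B \<noteq> {0} \<and>
          A \<inter> B = {0} \<and> vecs V = {a + b | a b. a \<in> A \<and> b \<in> B})"

definition endomorphism ::
  "('a, 'z) monoid_scheme \<Rightarrow> ('a, 'k::field, 'v::ab_group_add) monoid_module \<Rightarrow> ('v \<Rightarrow> 'v) \<Rightarrow> bool" where
  "endomorphism M V \<phi> \<longleftrightarrow>
     (\<forall>v\<in>vecs V. \<phi> v \<in> vecs V) \<and>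
     (\<forall>v\<in>vecs V. \<forall>w\<in>vecs V. \<phi> (v + w) = \<phi> v + \<phi> w) \<and>
     (\<forall>c. \<forall>v\<in>vecs V. \<phi> (smul V c v) = smul V c (\<phi> v)) \<and>
     (\<forall>g\<in>carrier M. \<forall>v\<in>vecs V. \<phi> (action V g v) = action V g (\<phi> v))"

text \<open>
  \<open>k\<close> is a splitting field for \<open>M\<close> if \<open>End\<^bsub>kM\<^esub>(S) = k\<close> for every simple \<open>kM\<close>-module \<open>S\<close>.
  Simple modules are quotients of \<open>kM\<close>, so each of them is isomorphic to one carried by a
  subspace of the functions from \<open>M\<close> to \<open>k\<close>; the quantification over that type
  therefore covers all of them.
\<close>

definition splitting_field :: "'k::field itself \<Rightarrow> ('a, 'z) monoid_scheme \<Rightarrow> bool" where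
  "splitting_field TYPE('k) M \<longleftrightarrow>
     (\<forall>S :: ('a, 'k, 'a \<Rightarrow> 'k) monoid_module. simple_module M S \<longrightarrow>
        (\<forall>\<phi>. endomorphism M S \<phi> \<longrightarrow> (\<exists>c. \<forall>s\<in>vecs S. \<phi> s = smul S c s)))"


section \<open>Number of indecomposable summands and length\<close>

text \<open>
  \<open>vecs V\<close> is the internal direct sum of \<open>U 0, \<dots>, U (r - 1)\<close>: every vector is \<open>\<Sum>i<r. w i\<close> for
  exactly one family with \<open>w i \<in> U i\<close>.
  The number \<open>r\<close> of indecomposable summands is unique by Krull--Schmidt, and the length \<open>l\<close> is
  unique by Jordan--Hoelder; existence for finite-dimensional modules is shown below.
\<close>

definition num_indecomposable_summands ::
  "('a, 'z) monoid_scheme \<Rightarrow> ('a, 'k::field, 'v::ab_group_add) monoid_module \<Rightarrow> nat \<Rightarrow> bool" where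
  "num_indecomposable_summands M V r \<longleftrightarrow>
     (\<exists>U. (\<forall>i<r. submodule M V (U i) \<and> indecomposable_module M (V\<lparr>vecs := U i\<rparr>)) \<and>
          bij_betw (\<lambda>w. \<Sum>i<r. w i) (\<Pi>\<^sub>E i\<in>{..<r}. U i) (vecs V))"

definition module_length ::
  "('a, 'z) monoid_scheme \<Rightarrow> ('a, 'k::field, 'v::ab_group_add) monoid_module \<Rightarrow> nat \<Rightarrow> bool" where
  "module_length M V l \<longleftrightarrow>
     (\<exists>U. U 0 = {0} \<and> U l = vecs V \<and> (\<forall>i\<le>l. submodule M V (U i)) \<and>
          (\<forall>i<l. U i \<subset> U (Suc i) \<and> \<not> (\<exists>W. submodule M V W \<and> U i \<subset> W \<and> W \<subset> U (Suc i))))"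


section \<open>Tensor powers\<close>

definition multilinear ::
  "('k::field \<Rightarrow> 'v::ab_group_add \<Rightarrow> 'v) \<Rightarrow> 'v set \<Rightarrow> nat
    \<Rightarrow> ('k \<Rightarrow> 'x::ab_group_add \<Rightarrow> 'x) \<Rightarrow> ('v list \<Rightarrow> 'x) \<Rightarrow> bool" where
  "multilinear s X n t F \<longleftrightarrow>
     (\<forall>vs i. length vs = n \<and> set vs \<subseteq> X \<and> i < n \<longrightarrow>
        (\<forall>u\<in>X. \<forall>w\<in>X. F (vs[i := u + w]) = F (vs[i := u]) + F (vs[i := w])) \<and>
        (\<forall>c. \<forall>u\<in>X. F (vs[i := s c u]) = t c (F (vs[i := u]))))"

abbreviation multilinear_form ::
  "('a, 'k::field, 'v::ab_group_add) monoid_module \<Rightarrow> nat \<Rightarrow> ('v list \<Rightarrow> 'k) \<Rightarrow> bool" where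
  "multilinear_form V n \<equiv> multilinear (smul V) (vecs V) n (*)"

text \<open>
  Over a field, \<open>V\<^sup>\<otimes>\<^sup>n\<close> embeds into the dual of the space of \<open>n\<close>-linear forms on \<open>V\<close>: the pure
  tensor \<open>v\<^sub>1 \<otimes> \<dots> \<otimes> v\<^sub>n\<close> becomes evaluation at \<open>(v\<^sub>1, \<dots>, v\<^sub>n)\<close> (cut off to \<open>0\<close> outside the
  multilinear forms). The tensor power is the span of the pure tensors. The functional
  \<open>g \<sqdot> x\<close> sends \<open>f\<close> to \<open>x (f \<circ> (g \<times> \<dots> \<times> g))\<close>, i.e.\ \<open>g\<close> acts diagonally on pure tensors.
  The universal property is established below.
\<close>

definition pure_tensor ::
  "('a, 'k::field, 'v::ab_group_add) monoid_module \<Rightarrow> 'v list \<Rightarrow> ('v list \<Rightarrow> 'k) \<Rightarrow> 'k" where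
  "pure_tensor V vs = (\<lambda>f. if multilinear_form V (length vs) f then f vs else 0)"

definition fun_smul :: "'k::field \<Rightarrow> ('x \<Rightarrow> 'k) \<Rightarrow> 'x \<Rightarrow> 'k" where
  "fun_smul c f = (\<lambda>x. c * f x)"

definition tensor_power ::
  "('a, 'k::field, 'v::ab_group_add) monoid_module \<Rightarrow> nat
    \<Rightarrow> ('a, 'k, ('v list \<Rightarrow> 'k) \<Rightarrow> 'k) monoid_module" where
  "tensor_power V n =
     \<lparr> vecs = module.span fun_smul (pure_tensor V ` {vs. length vs = n \<and> set vs \<subseteq> vecs V}),
       smul = fun_smul,
       action = (\<lambda>g x f. if multilinear_form V n f then x (f \<circ> map (action V g)) else 0) \<rparr>"

subsection \<open>The tensor power is a module with the universal property\<close>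

lemma vector_space_fun_smul: "vector_space fun_smul"
  by unfold_locales (auto simp: fun_smul_def fun_eq_iff algebra_simps)

lemma multilinear_pure_tensor:
  "multilinear (smul V) (vecs V) n fun_smul (pure_tensor V)"
  unfolding multilinear_def
  by (auto simp: pure_tensor_def multilinear_def fun_eq_iff fun_smul_def)

lemma multilinear_form_comp_action:
  assumes V: "is_module M V" and g: "g \<in> carrier M" and f: "multilinear_form V n f"
  shows "multilinear_form V n (f \<circ> map (action V g))"
  unfolding multilinear_def
proof (intro allI impI)
  fix vs i assume a: "length vs = n \<and> set vs \<subseteq> vecs V \<and> i < n"
  have a': "length (map (action V g) vs) = n \<and> set (map (action V g) vs) \<subseteq> vecs V \<and> i < n"
    using a g V by (auto simp: is_module_def)
  have cl: "action V g u \<in> vecs V" if "u \<in> vecs V" for u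
    using that g V by (auto simp: is_module_def)
  show "(\<forall>u\<in>vecs V. \<forall>w\<in>vecs V. (f \<circ> map (action V g)) (vs[i := u + w]) =
          (f \<circ> map (action V g)) (vs[i := u]) + (f \<circ> map (action V g)) (vs[i := w])) \<and>
        (\<forall>c. \<forall>u\<in>vecs V. (f \<circ> map (action V g)) (vs[i := smul V c u]) =
          c * (f \<circ> map (action V g)) (vs[i := u]))"
    using f[unfolded multilinear_def, rule_format, OF a'] V g cl
    by (simp add: map_update is_module_def)
qed

lemma action_pure_tensor:
  assumes "is_module M V" "g \<in> carrier M" "length vs = n"
  shows "action (tensor_power V n) g (pure_tensor V vs) = pure_tensor V (map (action V g) vs)"
  using assms multilinear_form_comp_action[OF assms(1,2)]
  by (auto simp: tensor_power_def pure_tensor_def fun_eq_iff)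

lemma linear_action_tensor_power: "Vector_Spaces.linear fun_smul fun_smul (action (tensor_power V n) g)"
  using vector_space_fun_smul
  by (auto simp: Vector_Spaces.linear_iff tensor_power_def fun_smul_def fun_eq_iff)

lemma is_module_tensor_power:
  fixes M :: "('a, 'z) monoid_scheme" (structure)
    and V :: "('a, 'k::field, 'v::ab_group_add) monoid_module"
  assumes M: "monoid M" and V: "is_module M V"
  shows "is_module M (tensor_power V n)"
proof -
  interpret monoid M by fact
  interpret F: vector_space "fun_smul :: 'k \<Rightarrow> (('v list \<Rightarrow> 'k) \<Rightarrow> 'k) \<Rightarrow> _"
    by (rule vector_space_fun_smul)
  let ?P = "pure_tensor V ` {vs. length vs = n \<and> set vs \<subseteq> vecs V}"
  let ?A = "action (tensor_power V n)"
  have vecs: "vecs (tensor_power V n) = F.span ?P" and smul: "smul (tensor_power V n) = fun_smul"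
    by (auto simp: tensor_power_def)
  have lin: "Vector_Spaces.linear fun_smul fun_smul (?A g)" for g
    by (rule linear_action_tensor_power)
  have lid: "Vector_Spaces.linear fun_smul fun_smul (\<lambda>x::('v list \<Rightarrow> 'k) \<Rightarrow> 'k. x)"
    by (rule F.linear_ident)
  interpret FF: vector_space_pair
    "fun_smul :: 'k \<Rightarrow> (('v list \<Rightarrow> 'k) \<Rightarrow> 'k) \<Rightarrow> _" "fun_smul :: 'k \<Rightarrow> (('v list \<Rightarrow> 'k) \<Rightarrow> 'k) \<Rightarrow> _" ..
  have cl: "action V g v \<in> vecs V" if "g \<in> carrier M" "v \<in> vecs V" for g v
    using that V by (auto simp: is_module_def)
  have A_P: "?A g ` ?P \<subseteq> ?P" if "g \<in> carrier M" for g
  proof (clarify)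
    fix vs assume vs: "n = length vs" "set vs \<subseteq> vecs V"
    have "?A g (pure_tensor V vs) = pure_tensor V (map (action V g) vs)"
      using action_pure_tensor[OF V that] vs by simp
    moreover have "set (map (action V g) vs) \<subseteq> vecs V"
      using vs cl[OF that] by auto
    ultimately show "action (tensor_power V (length vs)) g (pure_tensor V vs)
        \<in> pure_tensor V ` {ws. length ws = length vs \<and> set ws \<subseteq> vecs V}"
      using vs(1) by (simp del: set_map)
  qed
  have 1: "?A g x \<in> F.span ?P" if "g \<in> carrier M" "x \<in> F.span ?P" for g x
  proof -
    have "?A g x \<in> ?A g ` F.span ?P" using that by blast
    also have "\<dots> = F.span (?A g ` ?P)"
      using FF.linear_span_image[OF lin] by simp
    also have "\<dots> \<subseteq> F.span ?P" by (intro F.span_mono A_P that)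
    finally show ?thesis .
  qed
  have 2: "?A \<one> x = x" if "x \<in> F.span ?P" for x
  proof (rule FF.linear_eq_on[OF lin lid that])
    fix y assume "y \<in> ?P"
    then obtain vs where vs: "y = pure_tensor V vs" "length vs = n" "set vs \<subseteq> vecs V" by blast
    then have "map (action V \<one>) vs = vs"
      using V by (auto simp: is_module_def intro!: map_idI)
    then show "?A \<one> y = y" using action_pure_tensor[OF V one_closed vs(2)] vs(1) by simp
  qed
  have 3: "?A (g \<otimes> h) x = ?A g (?A h x)"
    if g: "g \<in> carrier M" and h: "h \<in> carrier M" and x: "x \<in> F.span ?P" for g h x
  proof -
    have lc: "Vector_Spaces.linear fun_smul fun_smul (\<lambda>x. ?A g (?A h x))"
      using Vector_Spaces.linear_compose[OF lin lin] by (simp add: comp_def)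
    show ?thesis
    proof (rule FF.linear_eq_on[OF lin lc x])
      fix y assume "y \<in> ?P"
      then obtain vs where vs: "y = pure_tensor V vs" "length vs = n" "set vs \<subseteq> vecs V" by blast
      then have "map (action V (g \<otimes> h)) vs = map (action V g) (map (action V h) vs)"
        using V g h by (auto simp: is_module_def)
      then show "?A (g \<otimes> h) y = ?A g (?A h y)"
        using vs g h by (simp add: action_pure_tensor[OF V] del: map_map map_eq_conv)
    qed
  qed
  show ?thesis
    unfolding is_module_def vecs smul
    by (intro conjI ballI allI F.vector_space_axioms F.subspace_span 1 2 3
        FF.linear_add[OF lin] FF.linear_scale[OF lin])
qed

lemma tensor_power_universal:
  fixes V :: "('a, 'k::field, 'v::ab_group_add) monoid_module"
    and t :: "'k \<Rightarrow> 'x::ab_group_add \<Rightarrow> 'x"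
  assumes X: "vector_space t" and F: "multilinear (smul V) (vecs V) n t F"
  shows "\<exists>L. Vector_Spaces.linear fun_smul t L \<and>
           (\<forall>vs. length vs = n \<and> set vs \<subseteq> vecs V \<longrightarrow> L (pure_tensor V vs) = F vs)"
proof -
  interpret X: vector_space t by fact
  interpret T: vector_space "fun_smul :: 'k \<Rightarrow> (('v list \<Rightarrow> 'k) \<Rightarrow> 'k) \<Rightarrow> _"
    by (rule vector_space_fun_smul)
  interpret TX: vector_space_pair "fun_smul :: 'k \<Rightarrow> (('v list \<Rightarrow> 'k) \<Rightarrow> 'k) \<Rightarrow> _" t ..
  interpret K: vector_space "(*) :: 'k \<Rightarrow> 'k \<Rightarrow> 'k"
    by unfold_locales (auto simp: algebra_simps)
  interpret XK: vector_space_pair t "(*) :: 'k \<Rightarrow> 'k \<Rightarrow> 'k" ..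
  interpret TK: vector_space_pair "fun_smul :: 'k \<Rightarrow> (('v list \<Rightarrow> 'k) \<Rightarrow> 'k) \<Rightarrow> _"
    "(*) :: 'k \<Rightarrow> 'k \<Rightarrow> 'k" ..
  let ?D = "{vs. length vs = n \<and> set vs \<subseteq> vecs V}"
  let ?P = "pure_tensor V ` ?D"
  obtain C where C: "C \<subseteq> ?P" "T.independent C" "?P \<subseteq> T.span C"
    using T.maximal_independent_subset by blast
  define c where "c = (\<lambda>x. SOME vs. vs \<in> ?D \<and> pure_tensor V vs = x)"
  have c: "c x \<in> ?D \<and> pure_tensor V (c x) = x" if "x \<in> C" for x
    unfolding c_def by (rule someI_ex) (use C(1) that in blast)
  obtain L where L: "\<forall>x\<in>C. L x = F (c x)" and lin: "Vector_Spaces.linear fun_smul t L"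
    using TX.linear_independent_extend[OF C(2), of "\<lambda>x. F (c x)"] by blast
  have "L (pure_tensor V vs) = F vs" if vs: "vs \<in> ?D" for vs
  proof (rule ccontr)
    assume "L (pure_tensor V vs) \<noteq> F vs"
    then have "F vs - L (pure_tensor V vs) \<noteq> 0" by simp
    then have "X.independent {F vs - L (pure_tensor V vs)}" by simp
    from XK.linear_independent_extend[OF this, of "\<lambda>_. 1"] obtain h where
      h: "h (F vs - L (pure_tensor V vs)) = 1" and linh: "Vector_Spaces.linear t (*) h"
      by auto
    have ml: "multilinear_form V n (h \<circ> F)"
      using F by (auto simp: multilinear_def XK.linear_add[OF linh] XK.linear_scale[OF linh])
    have ev: "pure_tensor V ws (h \<circ> F) = h (F ws)" if "ws \<in> ?D" for ws
      using that ml by (auto simp: pure_tensor_def)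
    have lev: "Vector_Spaces.linear fun_smul (*) (\<lambda>x :: ('v list \<Rightarrow> 'k) \<Rightarrow> 'k. x (h \<circ> F))"
      using T.vector_space_axioms K.vector_space_axioms
      by (auto simp: Vector_Spaces.linear_iff fun_smul_def)
    have lhL: "Vector_Spaces.linear fun_smul (*) (\<lambda>x. h (L x))"
      using Vector_Spaces.linear_compose[OF lin linh] by (simp add: comp_def)
    have "pure_tensor V vs (h \<circ> F) = h (L (pure_tensor V vs))"
    proof (rule TK.linear_eq_on[OF lev lhL])
      show "pure_tensor V vs \<in> T.span C" using C(3) vs by blast
    next
      fix x assume x: "x \<in> C"
      show "x (h \<circ> F) = h (L x)" using ev[of "c x"] c[OF x] L x by auto
    qed
    then show False using h ev[OF vs] by (simp add: XK.linear_diff[OF linh])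
  qed
  then show "\<exists>L. Vector_Spaces.linear fun_smul t L \<and>
       (\<forall>vs. length vs = n \<and> set vs \<subseteq> vecs V \<longrightarrow> L (pure_tensor V vs) = F vs)"
    using lin by blast
qed

lemma tensor_power_universal_unique:
  fixes V :: "('a, 'k::field, 'v::ab_group_add) monoid_module"
    and t :: "'k \<Rightarrow> 'x::ab_group_add \<Rightarrow> 'x"
  assumes L: "Vector_Spaces.linear fun_smul t L" and L': "Vector_Spaces.linear fun_smul t L'"
    and eq: "\<And>vs. length vs = n \<Longrightarrow> set vs \<subseteq> vecs V \<Longrightarrow> L (pure_tensor V vs) = L' (pure_tensor V vs)"
    and x: "x \<in> vecs (tensor_power V n)"
  shows "L x = L' x"
proof -
  interpret X: vector_space t using L by (simp add: Vector_Spaces.linear_iff)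
  interpret T: vector_space "fun_smul :: 'k \<Rightarrow> (('v list \<Rightarrow> 'k) \<Rightarrow> 'k) \<Rightarrow> _"
    by (rule vector_space_fun_smul)
  interpret TX: vector_space_pair "fun_smul :: 'k \<Rightarrow> (('v list \<Rightarrow> 'k) \<Rightarrow> 'k) \<Rightarrow> _" t ..
  show ?thesis
    by (rule TX.linear_eq_on[OF L L' x[unfolded tensor_power_def, simplified]]) (use eq in auto)
qed

lemma finite_dim_tensor_power:
  fixes V :: "('a, 'k::field, 'v::ab_group_add) monoid_module"
  assumes V: "vector_space (smul V)" and fin: "finite_dim V"
  shows "finite_dim (tensor_power V n)"
proof -
  interpret V: vector_space "smul V" by fact
  interpret T: vector_space "fun_smul :: 'k \<Rightarrow> (('v list \<Rightarrow> 'k) \<Rightarrow> 'k) \<Rightarrow> _"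
    by (rule vector_space_fun_smul)
  obtain B where B: "finite B" "V.span B = vecs V"
    using fin by (auto simp: finite_dim_def)
  have BV: "B \<subseteq> vecs V" using V.span_superset B(2) by blast
  let ?Q = "pure_tensor V ` {vs. length vs = n \<and> set vs \<subseteq> B}"
  let ?P = "pure_tensor V ` {vs. length vs = n \<and> set vs \<subseteq> vecs V}"
  have step: "pure_tensor V vs \<in> T.span ?Q"
    if "k \<le> n" "length vs = n" "set vs \<subseteq> vecs V" "\<forall>i. k \<le> i \<and> i < n \<longrightarrow> vs ! i \<in> B" for k vs
    using that
  proof (induction k arbitrary: vs)
    case 0
    then have "set vs \<subseteq> B" by (auto simp: set_conv_nth)
    then show ?case using 0 by (intro T.span_base) blast
  next
    case (Suc k)
    have k: "length vs = n \<and> set vs \<subseteq> vecs V \<and> k < n" using Suc.prems by auto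
    note ml = multilinear_pure_tensor[of V n, unfolded multilinear_def, rule_format, OF k]
    have ml_add: "pure_tensor V (vs[k := u + w]) = pure_tensor V (vs[k := u]) + pure_tensor V (vs[k := w])"
      if "u \<in> vecs V" "w \<in> vecs V" for u w using ml that by blast
    have ml_scale: "pure_tensor V (vs[k := smul V c u]) = fun_smul c (pure_tensor V (vs[k := u]))"
      if "u \<in> vecs V" for c u using ml that by blast
    have "vs ! k \<in> V.span B" using Suc.prems B(2) nth_mem[of k vs] by auto
    then have "vs ! k \<in> vecs V \<and> pure_tensor V (vs[k := vs ! k]) \<in> T.span ?Q"
    proof (induction rule: V.span_induct_alt)
      case base
      have z: "0 \<in> vecs V" using B(2) V.span_zero by metis
      have "pure_tensor V (vs[k := 0]) = pure_tensor V (vs[k := smul V 0 0])" by simp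
      also have "\<dots> = fun_smul 0 (pure_tensor V (vs[k := 0]))"
        using ml_scale z by blast
      also have "\<dots> = 0" by (rule T.scale_zero_left)
      finally have eq: "pure_tensor V (vs[k := 0]) = 0" .
      show ?case unfolding eq using z T.span_zero by blast
    next
      case (step c x y)
      have x: "x \<in> vecs V" using step BV by blast
      have cx: "smul V c x \<in> vecs V" using x B(2) V.span_scale by metis
      have cxy: "smul V c x + y \<in> vecs V" using cx step B(2) V.span_add by metis
      have "pure_tensor V (vs[k := smul V c x + y]) =
          pure_tensor V (vs[k := smul V c x]) + pure_tensor V (vs[k := y])"
        using ml_add cx step by blast
      also have "pure_tensor V (vs[k := smul V c x]) = fun_smul c (pure_tensor V (vs[k := x]))"
        using ml_scale x by blast
      finally have eq: "pure_tensor V (vs[k := smul V c x + y]) =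
          fun_smul c (pure_tensor V (vs[k := x])) + pure_tensor V (vs[k := y])" .
      have "pure_tensor V (vs[k := x]) \<in> T.span ?Q"
      proof (rule Suc.IH)
        show "set (vs[k := x]) \<subseteq> vecs V"
          using Suc.prems x set_update_subset_insert[of vs k x] by blast
        show "\<forall>i. k \<le> i \<and> i < n \<longrightarrow> vs[k := x] ! i \<in> B"
          using Suc.prems step by (auto simp: nth_list_update)
      qed (use Suc.prems in auto)
      then show ?case using step cxy unfolding eq
        by (blast intro: T.span_add T.span_scale)
    qed
    then show ?case by simp
  qed
  have "?P \<subseteq> T.span ?Q" by (intro image_subsetI step[of n]) auto
  then have "T.span ?P \<subseteq> T.span ?Q" by (intro T.span_minimal T.subspace_span)
  moreover have "T.span ?Q \<subseteq> T.span ?P" by (intro T.span_mono) (use BV in auto)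
  moreover have "finite ?Q"
    using finite_lists_length_eq[OF B(1), of n] by (simp add: conj_commute)
  ultimately show ?thesis
    unfolding finite_dim_def tensor_power_def by (intro exI[of _ ?Q]) auto
qed

subsection \<open>Existence of decompositions and composition series\<close>

lemma submodule_dim_less:
  fixes V :: "('a, 'k::field, 'v::ab_group_add) monoid_module"
  assumes V: "is_module M V" and fin: "finite_dim V"
    and A: "submodule M V A" and B: "submodule M V B" and AB: "A \<subset> B"
  shows "vector_space.dim (smul V) A < vector_space.dim (smul V) B"
proof -
  interpret V: vector_space "smul V" using V by (simp add: is_module_def)
  obtain E where E: "finite E" "V.span E = vecs V" using fin by (auto simp: finite_dim_def)
  have sub: "V.subspace A" "V.subspace B" "B \<subseteq> vecs V" using A B by (auto simp: submodule_def)
  obtain a where a: "a \<subseteq> A" "V.independent a" "A \<subseteq> V.span a" "card a = V.dim A"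
    by (rule V.basis_exists)
  obtain x where x: "x \<in> B" "x \<notin> A" using AB by blast
  have "V.span a \<subseteq> A" using a(1) sub(1) by (rule V.span_minimal)
  then have nx: "x \<notin> V.span a" using x(2) by blast
  have ind: "V.independent (insert x a)" using nx a(2) by (rule V.independent_insertI)
  have xa: "x \<notin> a" using nx V.span_base[of x a] by blast
  have ins: "insert x a \<subseteq> B" using x(1) a(1) AB by auto
  obtain b where b: "insert x a \<subseteq> b" "b \<subseteq> B" "V.independent b" "B \<subseteq> V.span b"
    by (rule V.maximal_independent_subset_extend[OF ins ind])
  have "b \<subseteq> V.span E" using b(2) sub(3) E(2) by simp
  then have fb: "finite b" using V.independent_span_bound[OF E(1) b(3)] by simp
  have "V.dim B = card b" using V.basis_card_eq_dim[OF b(2,4,3)] by simp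
  moreover have "card (insert x a) \<le> card b" using card_mono[OF fb b(1)] .
  moreover have "finite a" using finite_subset[OF b(1) fb] by simp
  ultimately show ?thesis using xa a(4) by simp
qed

lemma submodule_zero: "is_module M V \<Longrightarrow> submodule M V {0}"
proof -
  assume V: "is_module M V"
  interpret V: vector_space "smul V" using V by (simp add: is_module_def)
  have z: "0 \<in> vecs V" using V V.subspace_0 by (auto simp: is_module_def)
  have "action V g 0 = 0" if "g \<in> carrier M" for g
  proof -
    have "action V g (smul V 0 0) = smul V 0 (action V g 0)"
      using V that z unfolding is_module_def by blast
    then show ?thesis by simp
  qed
  then show ?thesis using z by (auto simp: submodule_def V.subspace_def)
qed

lemma submodule_self: "is_module M V \<Longrightarrow> submodule M V (vecs V)"
  unfolding submodule_def is_module_def by blast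

lemma is_module_submodule: "is_module M V \<Longrightarrow> submodule M V W \<Longrightarrow> is_module M (V\<lparr>vecs := W\<rparr>)"
  by (simp add: submodule_def is_module_def, elim conjE, intro conjI ballI allI; (assumption | meson subsetD))

lemma module_length_exists:
  assumes V: "is_module M V" and fin: "finite_dim V"
  shows "\<exists>l. module_length M V l"
proof -
  interpret V: vector_space "smul V" using V by (simp add: is_module_def)
  let ?dim = "V.dim"
  have "\<exists>l U. U 0 = {0} \<and> U l = W \<and> (\<forall>i\<le>l. submodule M V (U i)) \<and>
          (\<forall>i<l. U i \<subset> U (Suc i) \<and> \<not> (\<exists>W. submodule M V W \<and> U i \<subset> W \<and> W \<subset> U (Suc i)))"
    if "submodule M V W" for W
    using that
  proof (induction "?dim W" arbitrary: W rule: less_induct)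
    case less
    show ?case
    proof (cases "W = {0}")
      case True
      then show ?thesis using less.prems by (intro exI[of _ 0] exI[of _ "\<lambda>_. {0}"]) auto
    next
      case False
      let ?Q = "\<lambda>W'. submodule M V W' \<and> W' \<subset> W"
      have "0 \<in> W"
        using less.prems V.subspace_0 by (auto simp: submodule_def)
      then have "?Q {0}" using submodule_zero[OF V] False by blast
      moreover have "\<forall>W'. ?Q W' \<longrightarrow> ?dim W' < ?dim W"
        using submodule_dim_less[OF V fin] less.prems by blast
      ultimately obtain W' where W': "?Q W'" and max: "\<forall>X. ?Q X \<longrightarrow> ?dim X \<le> ?dim W'"
        using ex_has_greatest_nat[of ?Q "{0}" ?dim "?dim W"] by (meson less_imp_le)
      obtain l U where U: "U 0 = {0}" "U l = W'" "\<forall>i\<le>l. submodule M V (U i)"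
        "\<forall>i<l. U i \<subset> U (Suc i) \<and> \<not> (\<exists>W. submodule M V W \<and> U i \<subset> W \<and> W \<subset> U (Suc i))"
        using less.hyps[of W'] W' submodule_dim_less[OF V fin] less.prems by blast
      have btw: "\<not> (\<exists>X. submodule M V X \<and> W' \<subset> X \<and> X \<subset> W)"
        using max W' submodule_dim_less[OF V fin] by (meson not_less)
      show ?thesis
        by (rule exI[of _ "Suc l"], rule exI[of _ "U(Suc l := W)"])
          (use U W' btw less.prems in \<open>auto simp: le_Suc_eq less_Suc_eq\<close>)
    qed
  qed
  from this[OF submodule_self[OF V]] show ?thesis by (simp add: module_length_def)
qed

lemma num_indecomposable_summands_exists:
  fixes V :: "('a, 'k::field, 'v::ab_group_add) monoid_module"
  assumes V: "is_module M V" and fin: "finite_dim V"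
  shows "\<exists>r. num_indecomposable_summands M V r"
proof -
  interpret V: vector_space "smul V" using V by (simp add: is_module_def)
  let ?ind = "\<lambda>W. submodule M V W \<and> indecomposable_module M (V\<lparr>vecs := W\<rparr>)"
  let ?ds = "\<lambda>(r::nat) U W. bij_betw (\<lambda>w. \<Sum>i<r. w i) (\<Pi>\<^sub>E i\<in>{..<r}. U i) W"
  have "\<exists>r (U :: nat \<Rightarrow> 'v set). (\<forall>i<r. ?ind (U i)) \<and> ?ds r U W" if "submodule M V W" for W
    using that
  proof (induction "V.dim W" arbitrary: W rule: less_induct)
    case less
    note W = less.prems
    consider "W = {0}" | "?ind W" |
      A B where "submodule M (V\<lparr>vecs := W\<rparr>) A" "submodule M (V\<lparr>vecs := W\<rparr>) B" "A \<noteq> {0}" "B \<noteq> {0}"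
        "A \<inter> B = {0}" "W = {a + b | a b. a \<in> A \<and> b \<in> B}"
      using W is_module_submodule[OF V W] unfolding indecomposable_module_def by auto
    then show ?case
    proof cases
      case 1
      then show ?thesis by (intro exI[of _ 0]) (auto simp: bij_betw_def)
    next
      case 2
      have "?ds 1 (\<lambda>_. W) W"
        by (rule bij_betwI[where g = "\<lambda>v. \<lambda>i\<in>{..<1}. v"])
          (auto simp: PiE_def Pi_def extensional_def fun_eq_iff lessThan_Suc)
      then show ?thesis using 2 by (intro exI[of _ 1] exI[of _ "\<lambda>_. W"]) auto
    next
      case 3
      have AW: "A \<subseteq> W" and BW: "B \<subseteq> W"
        using 3(1,2) by (simp_all add: submodule_def)
      have WV: "W \<subseteq> vecs V" using W by (simp add: submodule_def)
      have A: "submodule M V A" using 3(1) AW WV by (simp add: submodule_def)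
      have B: "submodule M V B" using 3(2) BW WV by (simp add: submodule_def)
      have sA: "V.subspace A" and sB: "V.subspace B" using A B by (auto simp: submodule_def)
      have "A \<subset> W" using 3(4,5) AW BW by auto
      then obtain r U where U: "\<forall>i<r. ?ind (U i)" and dU: "?ds r U A"
        using less.hyps[OF submodule_dim_less[OF V fin A W] A] by blast
      have "B \<subset> W" using 3(3,5) AW BW by auto
      then obtain q T where T: "\<forall>i<q. ?ind (T i)" and dT: "?ds q T B"
        using less.hyps[OF submodule_dim_less[OF V fin B W] B] by blast
      define S where "S = (\<lambda>i. if i < r then U i else T (i - r))"
      have split: "(\<Sum>i<r+q. w i) = (\<Sum>i<r. w i) + (\<Sum>i<q. w (r + i))" for w :: "nat \<Rightarrow> 'v"
        by (induction q) (auto simp: algebra_simps)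
      have fst: "restrict w {..<r} \<in> (\<Pi>\<^sub>E i\<in>{..<r}. U i)"
        and snd: "(\<lambda>i\<in>{..<q}. w (r + i)) \<in> (\<Pi>\<^sub>E i\<in>{..<q}. T i)"
        if "w \<in> (\<Pi>\<^sub>E i\<in>{..<r+q}. S i)" for w
      proof -
        have wi: "w i \<in> S i" if "i < r + q" for i using that \<open>w \<in> _\<close> by (auto simp: PiE_def)
        show "restrict w {..<r} \<in> (\<Pi>\<^sub>E i\<in>{..<r}. U i)"
          using wi by (fastforce simp: S_def split: if_splits)
        show "(\<lambda>i\<in>{..<q}. w (r + i)) \<in> (\<Pi>\<^sub>E i\<in>{..<q}. T i)"
          using wi[of "r + _"] by (auto simp: S_def)
      qed
      have inA: "(\<Sum>i<r. w i) \<in> A" and inB: "(\<Sum>i<q. w (r + i)) \<in> B"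
        if "w \<in> (\<Pi>\<^sub>E i\<in>{..<r+q}. S i)" for w
        using bij_betwE[OF dU] fst[OF that] bij_betwE[OF dT] snd[OF that] by fastforce+
      have "?ds (r + q) S W"
        unfolding bij_betw_def
      proof
        show "inj_on (\<lambda>w. \<Sum>i<r+q. w i) (\<Pi>\<^sub>E i\<in>{..<r+q}. S i)"
        proof (rule inj_onI)
          fix w w' assume w: "w \<in> (\<Pi>\<^sub>E i\<in>{..<r+q}. S i)" and w': "w' \<in> (\<Pi>\<^sub>E i\<in>{..<r+q}. S i)"
            and eq: "(\<Sum>i<r+q. w i) = (\<Sum>i<r+q. w' i)"
          have "(\<Sum>i<r. w i) - (\<Sum>i<r. w' i) = (\<Sum>i<q. w' (r + i)) - (\<Sum>i<q. w (r + i))"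
            using eq unfolding split by (simp add: algebra_simps)
          moreover have "(\<Sum>i<r. w i) - (\<Sum>i<r. w' i) \<in> A"
            using inA[OF w] inA[OF w'] sA V.subspace_diff by blast
          moreover have "(\<Sum>i<q. w' (r + i)) - (\<Sum>i<q. w (r + i)) \<in> B"
            using inB[OF w] inB[OF w'] sB V.subspace_diff by blast
          ultimately have "(\<Sum>i<r. w i) - (\<Sum>i<r. w' i) \<in> A \<inter> B" by simp
          then have z1: "(\<Sum>i<r. w i) = (\<Sum>i<r. w' i)" using 3(5) by simp
          then have z2: "(\<Sum>i<q. w (r + i)) = (\<Sum>i<q. w' (r + i))"
            using eq unfolding split by simp
          have "restrict w {..<r} = restrict w' {..<r}"
            by (rule inj_onD[OF bij_betw_imp_inj_on[OF dU] _ fst[OF w] fst[OF w']]) (use z1 in simp)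
          moreover have "(\<lambda>i\<in>{..<q}. w (r + i)) = (\<lambda>i\<in>{..<q}. w' (r + i))"
            by (rule inj_onD[OF bij_betw_imp_inj_on[OF dT] _ snd[OF w] snd[OF w']]) (use z2 in simp)
          ultimately have "w i = w' i" if "i < r + q" for i
          proof (cases "i < r")
            case True
            then show ?thesis using fun_cong[OF \<open>restrict w {..<r} = _\<close>, of i] by simp
          next
            case False
            then have "i - r < q" "r + (i - r) = i" using that by auto
            then show ?thesis
              using fun_cong[OF \<open>(\<lambda>i\<in>{..<q}. w (r + i)) = _\<close>, of "i - r"] by simp
          qed
          then show "w = w'" by (intro PiE_ext[OF w w']) simp
        qed
        show "(\<lambda>w. \<Sum>i<r+q. w i) ` (\<Pi>\<^sub>E i\<in>{..<r+q}. S i) = W"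
        proof
          show "(\<lambda>w. \<Sum>i<r+q. w i) ` (\<Pi>\<^sub>E i\<in>{..<r+q}. S i) \<subseteq> W"
            unfolding split 3(6) using inA inB by blast
          show "W \<subseteq> (\<lambda>w. \<Sum>i<r+q. w i) ` (\<Pi>\<^sub>E i\<in>{..<r+q}. S i)"
          proof
            fix x assume "x \<in> W"
            then obtain a b where ab: "a \<in> A" "b \<in> B" "x = a + b" using 3(6) by blast
            obtain u where u: "u \<in> (\<Pi>\<^sub>E i\<in>{..<r}. U i)" "a = (\<Sum>i<r. u i)"
              using dU ab(1) unfolding bij_betw_def by blast
            obtain t where t: "t \<in> (\<Pi>\<^sub>E i\<in>{..<q}. T i)" "b = (\<Sum>i<q. t i)"
              using dT ab(2) unfolding bij_betw_def by blast
            define w where "w = (\<lambda>i\<in>{..<r+q}. if i < r then u i else t (i - r))"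
            have "w \<in> (\<Pi>\<^sub>E i\<in>{..<r+q}. S i)"
              using u(1) t(1) by (auto simp: w_def S_def PiE_def Pi_def)
            moreover have "x = (\<Sum>i<r+q. w i)"
              unfolding split by (simp add: ab u(2) t(2) w_def)
            ultimately show "x \<in> (\<lambda>w. \<Sum>i<r+q. w i) ` (\<Pi>\<^sub>E i\<in>{..<r+q}. S i)" by blast
          qed
        qed
      qed
      moreover have "\<forall>i<r+q. ?ind (S i)" using U T by (auto simp: S_def)
      ultimately show ?thesis by blast
    qed
  qed
  from this[OF submodule_self[OF V]] show ?thesis
    by (simp add: num_indecomposable_summands_def)
qed

end

theory Submission
  imports "HOL-Algebra.Algebraic_Closure_Type" "HOL-Combinatorics.Cycles" Defs
begin

no_notation Polynomials.var (\<open>X\<index>\<close>)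

text \<open>
  Let \<open>G\<close> be the group of units of \<open>M\<close>, a copy of the symmetric group, and let \<open>h(n)\<close> be the
  length of \<open>V\<^sup>\<otimes>\<^sup>n\<close> as a \<open>kG\<close>-module. Clearly \<open>b(n) \<le> l(n) \<le> h(n)\<close>. An indecomposable \<open>kM\<close>-module \<open>W\<close> is
  either annihilated by all nonunits, and then \<open>kG\<close>-simple by Maschke's theorem, or its dimension is at
  most \<open>2 \<Sum> dim xW\<close>, summed over the nonunits \<open>x\<close>. A nonunit has rank less than \<open>dim V\<close> on \<open>V\<close>, so
  \<open>h(n) \<le> b(n) + O((dim V - 1)\<^sup>n)\<close>. This replaces the representation theory of \<open>M\<close> by that of \<open>G\<close>.

  If no element of \<open>G\<close> other than \<open>1\<close> is a scalar (\<open>m \<ge> 3\<close>), then some tensor power of \<open>V\<close> contains a free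
  \<open>kG\<close>-module, and \<open>V\<^sup>\<otimes>\<^sup>n\<close> is free up to a part of dimension \<open>o((dim V)\<^sup>n)\<close>. Hence \<open>h(n)\<close> is asymptotic to
  \<open>(dim V)\<^sup>n r / m!\<close>, where \<open>r\<close> is the length of \<open>kG\<close>.

  To see that \<open>r\<close> is the number of \<open>g \<in> G\<close> with \<open>g\<^sup>2 = 1\<close>, pass to the algebraic closure. Every element of
  the symmetric group on \<open>i + 1\<close> letters is conjugate to its inverse under the group on \<open>i\<close> letters.
  Following the chain of these groups, one decomposes \<open>1\<close> into \<open>r\<close> orthogonal
  primitive idempotents fixed by the anti-involution \<open>g \<mapsto> g\<^sup>-\<^sup>1\<close>. The dimension of the space of
  self-adjoint elements of \<open>kG\<close> can be computed from this decomposition and from the basis \<open>G\<close>;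
  comparing the two results gives the claim.
\<close>

section \<open>Chains of submodules\<close>

text \<open>Lengths are measured by \<open>height\<close>, the maximal length of a chain of
  submodules. The bounds hold for every decomposition into indecomposables, whatever its summands
  are.

  The obstacle is a unit other than 1 that acts as a scalar: it acts as a scalar on all tensor
  powers and so rules out free kG-submodules. By faithfulness it is central in G, which leaves only
  m = 2. For m \<le> 2 there are at most two units, each tensor power is spanned by common
  eigenvectors of them, and h(n) = (dim V)^n; the constant is 1 as well.

  For m \<ge> 3 the nonfree part of the K-th tensor power, for a suitable K, makes up a share \<rho>
  < 1. Since tensoring with a free module gives a free module, the nonfree share of higher powers
  decays like a power of \<rho>, and convergence is geometric. The constant r / m! becomes the
  stated sum because m! / ((m - 2z)! z! 2^z) permutations are products of z disjoint
  transpositions.\<close>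

locale linear_module =
  fixes M :: "('a, 'z) monoid_scheme" and V :: "('a, 'k::field, 'v::ab_group_add) monoid_module"
  assumes is_module: "is_module M V" and finite_dim: "finite_dim V"
    \<comment> \<open>Stronger than \<open>is_module\<close>, which asks for linearity on
      \<open>vecs V\<close> only: the action is linear on the whole ambient space, so that the
      library facts on linear maps apply. Tensor powers have this property because their action is
      given by one formula on all functionals.\<close>
    and linear_action: "\<And>g. g \<in> carrier M \<Longrightarrow> Vector_Spaces.linear (smul V) (smul V) (action V g)"
begin

sublocale vector_space "smul V"
  using is_module by (simp add: is_module_def)

sublocale vector_space_pair "smul V" "smul V" ..

lemma subspace_vecs: "subspace (vecs V)"
  and action_closed: "g \<in> carrier M \<Longrightarrow> v \<in> vecs V \<Longrightarrow> action V g v \<in> vecs V"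
  and action_one: "v \<in> vecs V \<Longrightarrow> action V \<one>\<^bsub>M\<^esub> v = v"
  and action_mult: "g \<in> carrier M \<Longrightarrow> h \<in> carrier M \<Longrightarrow> v \<in> vecs V \<Longrightarrow>
    action V (g \<otimes>\<^bsub>M\<^esub> h) v = action V g (action V h v)"
  using is_module by (auto simp: is_module_def)

lemmas action_add = linear_add[OF linear_action]
  and action_diff = linear_diff[OF linear_action]
  and action_scale = linear_scale[OF linear_action]
  and action_sum = linear_sum[OF linear_action]
  and action_zero = linear_0[OF linear_action]

lemma submoduleD:
  assumes "submodule M V X"
  shows "X \<subseteq> vecs V" "subspace X" "\<And>g w. g \<in> carrier M \<Longrightarrow> w \<in> X \<Longrightarrow> action V g w \<in> X"
  using assms by (auto simp: submodule_def)

lemma obtain_finite_basis: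
  assumes "X \<subseteq> vecs V"
  obtains B where "finite B" "B \<subseteq> X" "independent B" "X \<subseteq> span B" "card B = dim X"
proof -
  obtain E where E: "finite E" "span E = vecs V" using finite_dim by (auto simp: finite_dim_def)
  obtain B where B: "B \<subseteq> X" "independent B" "X \<subseteq> span B" "card B = dim X" by (rule basis_exists)
  have "finite B" using independent_span_bound[OF E(1) B(2)] B(1) assms E(2) by auto
  then show ?thesis using B that by blast
qed

lemma dim_mono:
  assumes "X \<subseteq> span Y" "Y \<subseteq> vecs V"
  shows "dim X \<le> dim Y"
proof -
  obtain B where B: "finite B" "Y \<subseteq> span B" "card B = dim Y"
    by (rule obtain_finite_basis[OF assms(2)])
  have "span Y \<subseteq> span B" using B(2) by (rule span_minimal) simp
  then have "X \<subseteq> span B" using assms(1) by blast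
  then show ?thesis using dim_le_card[of X B] B(1,3) by simp
qed

lemma dim_subset: "X \<subseteq> Y \<Longrightarrow> Y \<subseteq> vecs V \<Longrightarrow> dim X \<le> dim Y"
  using dim_mono span_superset by blast

lemma dim_Un_le:
  assumes "X \<subseteq> vecs V" "Y \<subseteq> vecs V"
  shows "dim (X \<union> Y) \<le> dim X + dim Y"
proof -
  obtain B where B: "finite B" "X \<subseteq> span B" "card B = dim X"
    by (rule obtain_finite_basis[OF assms(1)])
  obtain C where C: "finite C" "Y \<subseteq> span C" "card C = dim Y"
    by (rule obtain_finite_basis[OF assms(2)])
  have "X \<union> Y \<subseteq> span (B \<union> C)"
    using B(2) C(2) span_mono[of B "B \<union> C"] span_mono[of C "B \<union> C"] by auto
  then have "dim (X \<union> Y) \<le> card (B \<union> C)" using B(1) C(1) by (intro dim_le_card) auto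
  also have "\<dots> \<le> card B + card C" by (rule card_Un_le)
  finally show ?thesis using B(3) C(3) by simp
qed

lemma dim_UN_le:
  assumes "finite I" "\<And>i. i \<in> I \<Longrightarrow> X i \<subseteq> vecs V"
  shows "dim (\<Union>i\<in>I. X i) \<le> (\<Sum>i\<in>I. dim (X i))"
  using assms
proof (induction I rule: finite_induct)
  case empty
  then show ?case using dim_le_card[of "{}" "{}"] by simp
next
  case (insert i I)
  then have "dim (X i \<union> (\<Union>i\<in>I. X i)) \<le> dim (X i) + dim (\<Union>i\<in>I. X i)"
    by (intro dim_Un_le) auto
  also have "dim (\<Union>i\<in>I. X i) \<le> (\<Sum>i\<in>I. dim (X i))" using insert by blast
  finally show ?case using insert by simp
qed

text \<open>One half of rank-nullity: a basis of the kernel together with preimages of a basis of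
  the image spans \<open>X\<close>.\<close>

lemma dim_le_kernel_image:
  assumes f: "Vector_Spaces.linear (smul V) (smul V) f" and X: "X \<subseteq> vecs V" "subspace X" and fX: "f ` X \<subseteq> vecs V"
  shows "dim X \<le> dim {x \<in> X. f x = 0} + dim (f ` X)"
proof -
  obtain K where K: "finite K" "K \<subseteq> {x \<in> X. f x = 0}" "{x \<in> X. f x = 0} \<subseteq> span K"
      "card K = dim {x \<in> X. f x = 0}"
  proof (rule obtain_finite_basis[of "{x \<in> X. f x = 0}"])
    show "{x \<in> X. f x = 0} \<subseteq> vecs V" using X by blast
  qed
  obtain C where C: "finite C" "C \<subseteq> f ` X" "f ` X \<subseteq> span C" "card C = dim (f ` X)"
    by (rule obtain_finite_basis[OF fX])
  obtain D where D: "D \<subseteq> X" "finite D" "C = f ` D" "card D = card C"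
  proof -
    obtain D where D: "D \<subseteq> X" "inj_on f D" "C = f ` D"
      using C(2) unfolding subset_image_inj by blast
    then have "finite D" "card D = card C" using C(1) by (auto simp: card_image finite_image_iff)
    then show ?thesis using D that by blast
  qed
  have "X \<subseteq> span (K \<union> D)"
  proof
    fix x assume x: "x \<in> X"
    then have "f x \<in> span (f ` D)" using C(3) D(3) by blast
    then have "f x \<in> f ` span D" unfolding linear_span_image[OF f] .
    then obtain y where y: "y \<in> span D" "f x = f y" by blast
    have "span D \<subseteq> X" using D(1) X(2) by (rule span_minimal)
    then have "y \<in> X" using y(1) by blast
    then have "x - y \<in> {x \<in> X. f x = 0}"
      using x y X(2) by (simp add: subspace_diff linear_diff[OF f])
    then have "x - y \<in> span (K \<union> D)" using K(3) span_mono[of K "K \<union> D"] by auto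
    moreover have "y \<in> span (K \<union> D)" using y(1) span_mono[of D "K \<union> D"] by auto
    ultimately have "(x - y) + y \<in> span (K \<union> D)" by (rule span_add)
    then show "x \<in> span (K \<union> D)" by simp
  qed
  then have "dim X \<le> card (K \<union> D)" using K(1) D(2) by (intro dim_le_card) auto
  also have "\<dots> \<le> card K + card D" by (rule card_Un_le)
  finally show ?thesis using K C D by simp
qed

lemma submodule_span:
  assumes "S \<subseteq> vecs V" "\<And>g s. g \<in> carrier M \<Longrightarrow> s \<in> S \<Longrightarrow> action V g s \<in> span S"
  shows "submodule M V (span S)"
  unfolding submodule_def
proof (intro conjI ballI)
  show "span S \<subseteq> vecs V" using assms(1) subspace_vecs by (rule span_minimal)
  fix g w assume g: "g \<in> carrier M" and w: "w \<in> span S"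
  have "action V g w \<in> span (action V g ` S)" using w linear_span_image[OF linear_action[OF g]] by blast
  also have "\<dots> \<subseteq> span S" using assms(2)[OF g] by (intro span_minimal) auto
  finally show "action V g w \<in> span S" .
qed simp

lemma submodule_span_Union:
  assumes "\<And>X. X \<in> \<X> \<Longrightarrow> submodule M V X"
  shows "submodule M V (span (\<Union>\<X>))"
proof (rule submodule_span)
  show "\<Union>\<X> \<subseteq> vecs V" using assms submoduleD(1) by blast
  fix g s assume g: "g \<in> carrier M" and "s \<in> \<Union>\<X>"
  then have "action V g s \<in> \<Union>\<X>" using submoduleD(3)[OF assms g] by blast
  then show "action V g s \<in> span (\<Union>\<X>)" by (rule span_base)
qed

lemma submodule_span_Un:
  "submodule M V X \<Longrightarrow> submodule M V Y \<Longrightarrow> submodule M V (span (X \<union> Y))"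
  using submodule_span_Union[of "{X, Y}"] by auto

lemma submodule_Int:
  "submodule M V X \<Longrightarrow> submodule M V Y \<Longrightarrow> submodule M V (X \<inter> Y)"
  by (auto simp: submodule_def subspace_inter)

lemma span_Un_subspaces:
  "subspace X \<Longrightarrow> subspace Y \<Longrightarrow> span (X \<union> Y) = {x + y | x y. x \<in> X \<and> y \<in> Y}"
  by (subst span_Un) (simp only: span_eq_iff[THEN iffD2])

section \<open>Heights of submodules\<close>

definition chain :: "(nat \<Rightarrow> 'v set) \<Rightarrow> nat \<Rightarrow> bool" where
  "chain C r \<longleftrightarrow> (\<forall>i\<le>r. submodule M V (C i)) \<and> (\<forall>i<r. C i \<subset> C (Suc i))"

text \<open>For a submodule this is its composition length. The chain may start above
  \<open>{0}\<close> and end below \<open>X\<close>; a chain can always be extended to both ends, so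
  the maximum is the same and the ends require no bookkeeping.\<close>

definition height :: "'v set \<Rightarrow> nat" where
  "height X = Max {r. \<exists>C. chain C r \<and> C r \<subseteq> X}"

lemma chain_measure:
  assumes C: "chain C r" "C r \<subseteq> X"
    and f: "\<And>A B. submodule M V A \<Longrightarrow> submodule M V B \<Longrightarrow> B \<subseteq> X \<Longrightarrow> A \<subset> B \<Longrightarrow> (f A :: nat) < f B"
  shows "r + f (C 0) \<le> f (C r)"
proof -
  have sub: "C i \<subseteq> X" if "i \<le> r" for i
    using that C(2)
  proof (induction i rule: inc_induct)
    case (step n)
    then have "C n \<subset> C (Suc n)" using C(1) by (simp add: chain_def)
    then show ?case using step by blast
  qed
  have "i + f (C 0) \<le> f (C i)" if "i \<le> r" for i
    using that
  proof (induction i)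
    case (Suc i)
    then have "f (C i) < f (C (Suc i))" using C(1) sub[of "Suc i"] by (intro f) (auto simp: chain_def)
    then show ?case using Suc by simp
  qed simp
  then show ?thesis by simp
qed

lemma chain_le_dim:
  assumes "chain C r"
  shows "r \<le> dim (vecs V)"
proof -
  have "C r \<subseteq> vecs V" using assms submoduleD(1) by (auto simp: chain_def)
  moreover from this have "dim (C r) \<le> dim (vecs V)" by (rule dim_subset) simp
  ultimately show ?thesis
    using chain_measure[OF assms, of "vecs V" dim] submodule_dim_less[OF is_module finite_dim] by simp
qed

lemma finite_heights: "finite {r. \<exists>C. chain C r \<and> C r \<subseteq> X}"
  by (rule finite_subset[of _ "{..dim (vecs V)}"]) (use chain_le_dim in auto)

lemma chain_le_height: "chain C r \<Longrightarrow> C r \<subseteq> X \<Longrightarrow> r \<le> height X"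
  unfolding height_def using finite_heights by (intro Max_ge) auto

lemma height_attained:
  assumes "submodule M V X"
  obtains C where "chain C (height X)" "C (height X) \<subseteq> X"
proof -
  have "chain (\<lambda>_. X) 0" using assms by (simp add: chain_def)
  then have "0 \<in> {r. \<exists>C. chain C r \<and> C r \<subseteq> X}" by auto
  then have "height X \<in> {r. \<exists>C. chain C r \<and> C r \<subseteq> X}"
    unfolding height_def using finite_heights by (intro Max_in) auto
  then show ?thesis using that by blast
qed

lemma height_strict_mono:
  assumes "submodule M V A" "submodule M V B" "A \<subset> B"
  shows "height A < height B"
proof -
  obtain C where C: "chain C (height A)" "C (height A) \<subseteq> A" using assms(1) by (rule height_attained)
  have "chain (C(Suc (height A) := B)) (Suc (height A))"
    using C assms by (auto simp: chain_def less_Suc_eq le_Suc_eq)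
  then have "Suc (height A) \<le> height B" by (rule chain_le_height) simp
  then show ?thesis by simp
qed

lemma height_mono:
  "submodule M V A \<Longrightarrow> submodule M V B \<Longrightarrow> A \<subseteq> B \<Longrightarrow> height A \<le> height B"
  using height_strict_mono by (cases "A = B") (auto simp: less_imp_le)

lemma zero_submodule: "submodule M V {0}"
  using is_module by (rule submodule_zero)

lemma zero_le_submodule: "submodule M V A \<Longrightarrow> {0} \<subseteq> A"
  using submoduleD(2) subspace_0 by blast

text \<open>The source of the upper bounds on heights: along a chain \<open>f\<close> grows by at
  least 1 at each step. In the main applications \<open>f\<close> adds a measure of the intersection
  with a fixed submodule to a measure of the sum with it, and \<open>modular_strict\<close>
  guarantees that one of the two grows.\<close>

lemma height_le_measure:
  assumes X: "submodule M V X"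
    and f: "\<And>A B. submodule M V A \<Longrightarrow> submodule M V B \<Longrightarrow> B \<subseteq> X \<Longrightarrow> A \<subset> B \<Longrightarrow> (f A :: nat) < f B"
  shows "height X + f {0} \<le> f X"
proof -
  obtain C where C: "chain C (height X)" "C (height X) \<subseteq> X" using X by (rule height_attained)
  have sub: "submodule M V (C i)" if "i \<le> height X" for i using C(1) that by (auto simp: chain_def)
  have f': "f A \<le> f B" if "submodule M V A" "submodule M V B" "A \<subseteq> B" "B \<subseteq> X" for A B
    using f[of A B] that by (cases "A = B") (auto simp: less_imp_le)
  have "height X + f (C 0) \<le> f (C (height X))" using C f by (rule chain_measure)
  moreover have "f (C (height X)) \<le> f X" using f' sub X C(2) by blast
  moreover have "C i \<subseteq> X" if "i \<le> height X" for i
    using that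
  proof (induction i rule: inc_induct)
    case (step n)
    then have "C n \<subset> C (Suc n)" using C(1) by (simp add: chain_def)
    then show ?case using step by blast
  qed (use C in auto)
  from this[of 0] have "C 0 \<subseteq> X" by simp
  moreover from this have "f {0} \<le> f (C 0)"
    using f'[OF zero_submodule sub[of 0]] zero_le_submodule[OF sub[of 0]] by simp
  ultimately show ?thesis by simp
qed


lemma height_le_dim: "submodule M V X \<Longrightarrow> height X \<le> dim X"
  using height_le_measure[of X dim] submodule_dim_less[OF is_module finite_dim]
  by (metis add_leD1)

lemma height_zero: "height {0} = 0"
  using height_le_dim[OF zero_submodule] dim_le_card[of "{0}" "{}"] by simp

text \<open>The modular law: if intersections and sums with \<open>F\<close> agreed, an element x +
  y of \<open>B\<close> with x in \<open>A\<close> and y in \<open>F\<close> would have y in B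
  \<inter> F = A \<inter> F, so \<open>B\<close> would lie in \<open>A\<close>.\<close>

lemma modular_strict:
  assumes "subspace A" "subspace B" "subspace F" "A \<subset> B"
  shows "A \<inter> F \<subset> B \<inter> F \<or> span (A \<union> F) \<subset> span (B \<union> F)"
proof (rule ccontr)
  assume "\<not> ?thesis"
  then have i: "A \<inter> F = B \<inter> F" and "span (A \<union> F) = span (B \<union> F)"
    using assms(4) span_mono[of "A \<union> F" "B \<union> F"] by blast+
  then have s: "B \<subseteq> {x + y | x y. x \<in> A \<and> y \<in> F}"
    using span_Un_subspaces[OF assms(1,3)] span_superset[of "B \<union> F"] by simp
  have "B \<subseteq> A"
  proof
    fix b assume b: "b \<in> B"
    then obtain x y where xy: "x \<in> A" "y \<in> F" "b = x + y" using s by blast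
    have "b - x \<in> B" using b xy(1) assms(2,4) by (auto intro: subspace_diff)
    then have "y \<in> A" using xy i by auto
    then show "b \<in> A" using xy assms(1) by (simp add: subspace_add)
  qed
  then show False using assms(4) by blast
qed

text \<open>A submodule A of X + Y is measured by A \<inter> X and by (A + X) \<inter> Y. The second
  term detects any growth of A + X, because A + X is the sum of X and (A + X) \<inter> Y.\<close>

lemma height_Un_le:
  assumes X: "submodule M V X" and Y: "submodule M V Y"
  shows "height (span (X \<union> Y)) \<le> height X + height Y"
proof -
  let ?f = "\<lambda>A. height (A \<inter> X) + height (span (A \<union> X) \<inter> Y)"
  have "height (span (X \<union> Y)) + ?f {0} \<le> ?f (span (X \<union> Y))"
  proof (rule height_le_measure[OF submodule_span_Un[OF X Y]])
    fix A B assume A: "submodule M V A" and B: "submodule M V B"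
      and BX: "B \<subseteq> span (X \<union> Y)" and AB: "A \<subset> B"
    note sub = submoduleD(2)[OF A] submoduleD(2)[OF B] submoduleD(2)[OF X] submoduleD(2)[OF Y]
    have le: "A \<inter> X \<subseteq> B \<inter> X" "span (A \<union> X) \<subseteq> span (B \<union> X)"
      using AB span_mono[of "A \<union> X" "B \<union> X"] by auto
    have "A \<inter> X \<subset> B \<inter> X \<or> span (A \<union> X) \<inter> Y \<subset> span (B \<union> X) \<inter> Y"
      using modular_strict[OF sub(1-3) AB]
    proof
      assume "span (A \<union> X) \<subset> span (B \<union> X)"
      then obtain b where b: "b \<in> span (B \<union> X)" "b \<notin> span (A \<union> X)" by blast
      have "span (B \<union> X) \<subseteq> span (X \<union> Y)"
        using BX span_superset[of "X \<union> Y"] by (intro span_minimal) auto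
      then obtain x y where xy: "x \<in> X" "y \<in> Y" "b = x + y"
        using b(1) span_Un_subspaces[OF sub(3,4)] by blast
      have x: "x \<in> span (A \<union> X)" "x \<in> span (B \<union> X)" using xy(1) span_base by auto
      have "y \<notin> span (A \<union> X)" using b(2) xy(3) x(1) span_add by blast
      moreover have "y \<in> span (B \<union> X)" using span_diff[OF b(1) x(2)] xy(3) by simp
      ultimately show ?thesis using le xy(2) by blast
    qed blast
    moreover have s: "submodule M V (A \<inter> X)" "submodule M V (B \<inter> X)"
        "submodule M V (span (A \<union> X) \<inter> Y)" "submodule M V (span (B \<union> X) \<inter> Y)"
      using A B X Y by (auto intro: submodule_Int submodule_span_Un)
    moreover have "height (A \<inter> X) \<le> height (B \<inter> X)"
      using s le by (intro height_mono)
    moreover have "height (span (A \<union> X) \<inter> Y) \<le> height (span (B \<union> X) \<inter> Y)"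
      using s le by (intro height_mono) auto
    ultimately show "?f A < ?f B"
      using height_strict_mono[OF s(1,2)] height_strict_mono[OF s(3,4)] by linarith
  qed
  moreover have "span (X \<union> Y) \<inter> X = X" "span (span (X \<union> Y) \<union> X) \<inter> Y = Y"
    using span_superset[of "X \<union> Y"] span_superset[of "span (X \<union> Y) \<union> X"] by blast+
  ultimately show ?thesis by simp
qed

lemma height_UN_le:
  assumes "finite I" "\<And>i. i \<in> I \<Longrightarrow> submodule M V (U i)"
  shows "height (span (\<Union>i\<in>I. U i)) \<le> (\<Sum>i\<in>I. height (U i))"
  using assms
proof (induction I rule: finite_induct)
  case empty
  then show ?case by (simp add: height_zero)
next
  case (insert i I)
  have s: "submodule M V (span (\<Union>i\<in>I. U i))" using insert by (intro submodule_span_Union) auto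
  have "span (\<Union>i\<in>insert i I. U i) \<subseteq> span (U i \<union> span (\<Union>i\<in>I. U i))"
    using span_superset[of "\<Union>i\<in>I. U i"] by (intro span_mono) auto
  then have "height (span (\<Union>i\<in>insert i I. U i)) \<le> height (span (U i \<union> span (\<Union>i\<in>I. U i)))"
    using insert s by (intro height_mono submodule_span_Union submodule_span_Un) auto
  also have "\<dots> \<le> height (U i) + height (span (\<Union>i\<in>I. U i))"
    using insert s by (intro height_Un_le) auto
  finally show ?case using insert by fastforce
qed

text \<open>The length of X/F is at most its dimension. The quotient is not formed: the image of A
  in X/F is represented by A + F, whose dimension enters the measure.\<close>

lemma height_quotient_le:
  assumes X: "submodule M V X" and F: "submodule M V F" and FX: "F \<subseteq> X"
  shows "height X + dim F \<le> height F + dim X"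
proof -
  let ?f = "\<lambda>A. height (A \<inter> F) + dim (span (A \<union> F))"
  have "height X + ?f {0} \<le> ?f X"
  proof (rule height_le_measure[OF X])
    fix A B assume A: "submodule M V A" and B: "submodule M V B" and AB: "A \<subset> B"
    have le: "A \<inter> F \<subseteq> B \<inter> F" "span (A \<union> F) \<subseteq> span (B \<union> F)"
      using AB span_mono[of "A \<union> F" "B \<union> F"] by auto
    have s: "submodule M V (A \<inter> F)" "submodule M V (B \<inter> F)"
        "submodule M V (span (A \<union> F))" "submodule M V (span (B \<union> F))"
      using A B F by (auto intro: submodule_Int submodule_span_Un)
    have "height (A \<inter> F) \<le> height (B \<inter> F)" using s le by (intro height_mono)
    moreover have "dim (span (A \<union> F)) \<le> dim (span (B \<union> F))"
      using le(2) submoduleD(1)[OF s(4)] by (rule dim_subset)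
    moreover have "height (A \<inter> F) < height (B \<inter> F) \<or> dim (span (A \<union> F)) < dim (span (B \<union> F))"
      using modular_strict[OF submoduleD(2)[OF A] submoduleD(2)[OF B] submoduleD(2)[OF F] AB]
        height_strict_mono[OF s(1,2)] submodule_dim_less[OF is_module finite_dim s(3,4)] by blast
    ultimately show "?f A < ?f B" by linarith
  qed
  moreover have "{0} \<inter> F = {0}" "span ({0} \<union> F) = F" "X \<inter> F = F" "span (X \<union> F) = X"
    using zero_le_submodule[OF F] FX submoduleD(2)[OF F] submoduleD(2)[OF X]
    by (auto simp: Un_absorb1 Un_absorb2 span_eq_iff insert_absorb)
  ultimately show ?thesis by (simp add: height_zero)
qed

lemma height_le_one:
  assumes X: "submodule M V X" and "\<And>A. submodule M V A \<Longrightarrow> A \<subseteq> X \<Longrightarrow> A = {0} \<or> A = X"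
  shows "height X \<le> 1"
proof -
  let ?f = "\<lambda>A :: 'v set. if A = {0} then 0 else 1 :: nat"
  have "height X + ?f {0} \<le> ?f X"
  proof (rule height_le_measure[OF X])
    fix A B assume A: "submodule M V A" and B: "submodule M V B" and *: "B \<subseteq> X" "A \<subset> B"
    have "A = {0}" "B \<noteq> {0}" using assms(2)[OF A] * zero_le_submodule[OF A] by auto
    then show "?f A < ?f B" by simp
  qed
  then show ?thesis by (auto split: if_splits)
qed

text \<open>A simple factor B/A contributes at most 1: a submodule C of \<open>B\<close> that is not
  inside \<open>A\<close> satisfies C + A = B, so besides C \<inter> A it suffices to record whether
  C lies in \<open>A\<close>.\<close>

lemma height_cover_le:
  assumes A: "submodule M V A" and B: "submodule M V B" and AB: "A \<subset> B"
    and no: "\<not> (\<exists>W. submodule M V W \<and> A \<subset> W \<and> W \<subset> B)"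
  shows "height B \<le> height A + 1"
proof -
  let ?f = "\<lambda>C. height (C \<inter> A) + (if C \<subseteq> A then 0 else 1 :: nat)"
  have "height B + ?f {0} \<le> ?f B"
  proof (rule height_le_measure[OF B])
    fix C D assume C: "submodule M V C" and D: "submodule M V D" and *: "D \<subseteq> B" "C \<subset> D"
    have s: "submodule M V (C \<inter> A)" "submodule M V (D \<inter> A)" using C D A by (auto intro: submodule_Int)
    have le: "height (C \<inter> A) \<le> height (D \<inter> A)" using s * by (intro height_mono) auto
    show "?f C < ?f D"
    proof (cases "C \<inter> A = D \<inter> A")
      case True
      have "C \<subseteq> A"
      proof (rule ccontr)
        assume nC: "\<not> C \<subseteq> A"
        have full: "span (E \<union> A) = B" if E: "submodule M V E" "\<not> E \<subseteq> A" "E \<subseteq> B" for E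
        proof -
          have "A \<subset> span (E \<union> A)" using E(2) span_superset[of "E \<union> A"] by blast
          moreover have "span (E \<union> A) \<subseteq> B"
            using E(3) AB submoduleD(2)[OF B] by (intro span_minimal) auto
          ultimately show ?thesis using no submodule_span_Un[OF E(1) A] by blast
        qed
        have "span (C \<union> A) = B" "span (D \<union> A) = B"
          using full[OF C] full[OF D] nC * by blast+
        then show False
          using modular_strict[OF submoduleD(2)[OF C] submoduleD(2)[OF D] submoduleD(2)[OF A] *(2)] True
          by simp
      qed
      then show ?thesis using True * le by auto
    next
      case False
      then have "C \<inter> A \<subset> D \<inter> A" using * by blast
      then have "height (C \<inter> A) < height (D \<inter> A)" using s by (intro height_strict_mono)
      then show ?thesis using * by auto
    qed
  qed
  moreover have "B \<inter> A = A" using AB by blast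
  ultimately show ?thesis by (auto split: if_splits)
qed

text \<open>A composition series is itself a chain, and by \<open>height_cover_le\<close> no chain
  below \<open>U i\<close> is longer than \<open>i\<close>. In particular all composition series
  have the same length.\<close>

lemma module_length_eq_height:
  assumes "module_length M V l"
  shows "l = height (vecs V)"
proof -
  obtain U where U: "U 0 = {0}" "U l = vecs V" "\<And>i. i \<le> l \<Longrightarrow> submodule M V (U i)"
      "\<And>i. i < l \<Longrightarrow> U i \<subset> U (Suc i) \<and> \<not> (\<exists>W. submodule M V W \<and> U i \<subset> W \<and> W \<subset> U (Suc i))"
    using assms unfolding module_length_def by blast
  have "chain U l" using U by (simp add: chain_def)
  then have "l \<le> height (vecs V)" by (rule chain_le_height) (simp add: U)
  moreover have "height (U i) \<le> i" if "i \<le> l" for i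
    using that
  proof (induction i)
    case 0
    then show ?case by (simp add: U height_zero)
  next
    case (Suc i)
    have "height (U (Suc i)) \<le> height (U i) + 1"
      using U(3)[of i] U(3)[of "Suc i"] U(4)[of i] Suc.prems by (intro height_cover_le) auto
    then show ?case using Suc by simp
  qed
  ultimately show ?thesis using U(2) by (metis le_antisym order_refl)
qed

text \<open>The partial sums of the \<open>X i\<close> form a strictly increasing chain. This yields
  the lower bounds, with the summands of a direct decomposition in the role of the
  \<open>X i\<close>.\<close>

lemma height_ge_filtration:
  assumes "\<And>i. i < N \<Longrightarrow> submodule M V (X i)"
    and "\<And>i. i < N \<Longrightarrow> \<not> X i \<subseteq> span (\<Union>j<i. X j)"
  shows "N \<le> height (vecs V)"
proof -
  let ?C = "\<lambda>i. span (\<Union>j<i. X j)"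
  have sub: "submodule M V (?C i)" if "i \<le> N" for i
    using assms(1) that by (intro submodule_span_Union) auto
  have "?C i \<subset> ?C (Suc i)" if "i < N" for i
  proof -
    have "?C i \<subseteq> ?C (Suc i)" by (intro span_mono) (auto simp: lessThan_Suc)
    moreover have "X i \<subseteq> ?C (Suc i)" using span_superset[of "\<Union>j<Suc i. X j"] by auto
    ultimately show ?thesis using assms(2)[OF that] by blast
  qed
  then have "chain ?C N" using sub by (simp add: chain_def)
  then show ?thesis using submoduleD(1)[OF sub[of N]] by (intro chain_le_height) auto
qed

end

lemma submodule_carrier_mono:
  "submodule M V X \<Longrightarrow> carrier G \<subseteq> carrier M \<Longrightarrow> submodule G V X"
  by (auto simp: submodule_def)

text \<open>With fewer operators every chain of submodules remains one.\<close>

lemma height_carrier_mono: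
  assumes M: "linear_module M V" and G: "linear_module G V" and sub: "carrier G \<subseteq> carrier M"
    and X: "submodule M V X"
  shows "linear_module.height M V X \<le> linear_module.height G V X"
proof -
  interpret M: linear_module M V by fact
  interpret G: linear_module G V by fact
  obtain C where C: "M.chain C (M.height X)" "C (M.height X) \<subseteq> X" using X by (rule M.height_attained)
  have "G.chain C (M.height X)"
    using C(1) submodule_carrier_mono[OF _ sub] by (auto simp: M.chain_def G.chain_def)
  then show ?thesis using C(2) by (rule G.chain_le_height)
qed

section \<open>Modules over a monoid whose unit group has invertible order\<close>

locale finite_group = group G for G (structure) +
  assumes finite_carrier: "finite (carrier G)"
begin

lemma sum_translate:
  assumes "h \<in> carrier G"
  shows "(\<Sum>g\<in>carrier G. f (h \<otimes> g)) = (\<Sum>g\<in>carrier G. f g)"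
proof (rule sum.reindex_bij_betw)
  show "bij_betw ((\<otimes>) h) (carrier G) (carrier G)"
    using assms by (intro bij_betwI[where g = "(\<otimes>) (inv h)"]) (auto simp: m_assoc[symmetric])
qed

lemma sum_inverse: "(\<Sum>g\<in>carrier G. f (inv g)) = (\<Sum>g\<in>carrier G. f g)"
  by (rule sum.reindex_bij_betw) (auto intro!: bij_betwI[where g = "\<lambda>g. inv g"])

end

locale maschke_module = finite_group G + linear_module G V
  for G :: "('a, 'z) monoid_scheme" (structure)
    and V :: "('a, 'k::field, 'v::ab_group_add) monoid_module" +
  assumes card_nonzero: "of_nat (card (carrier G)) \<noteq> (0::'k)"
begin

text \<open>Maschke's argument: averaging a linear retraction onto \<open>X\<close> over the group
  makes it equivariant, and the complement is the kernel of the average inside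
  \<open>W\<close>.\<close>

lemma complement_exists:
  assumes X: "submodule G V X" and W: "submodule G V W" and XW: "X \<subseteq> W"
  obtains Y where "submodule G V Y" "Y \<subseteq> W" "X \<inter> Y = {0}" "span (X \<union> Y) = W"
proof -
  have "inj_on id X" "subspace X" using submoduleD(2)[OF X] by auto
  then obtain p where p: "range p \<subseteq> X" "Vector_Spaces.linear (smul V) (smul V) p" "\<And>x. x \<in> X \<Longrightarrow> p x = x"
    using linear_exists_left_inverse_on[OF linear_id, of X] by auto
  define \<pi> where "\<pi> w = smul V (1 / of_nat (card (carrier G))) (\<Sum>g\<in>carrier G. action V g (p (action V (inv g) w)))" for w
  have lin: "Vector_Spaces.linear (smul V) (smul V) \<pi>"
    unfolding \<pi>_def Vector_Spaces.linear_iff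
    by (simp add: vector_space_axioms action_add action_scale linear_add[OF p(2)] linear_scale[OF p(2)]
        sum.distrib scale_right_distrib scale_sum_right[symmetric] mult.commute)
  have pV: "p w \<in> vecs V" for w using p(1) submoduleD(1)[OF X] by auto
  have eq: "action V h (\<pi> w) = \<pi> (action V h w)" if h: "h \<in> carrier G" and w: "w \<in> vecs V" for h w
  proof -
    have "(\<Sum>g\<in>carrier G. action V g (p (action V (inv g) (action V h w)))) =
        (\<Sum>g\<in>carrier G. action V (h \<otimes> g) (p (action V (inv (h \<otimes> g)) (action V h w))))"
      using sum_translate[OF h] by (rule sym)
    also have "\<dots> = (\<Sum>g\<in>carrier G. action V h (action V g (p (action V (inv g) w))))"
    proof (rule sum.cong[OF refl])
      fix g assume g: "g \<in> carrier G"
      have "action V (inv (h \<otimes> g)) (action V h w) = action V (inv (h \<otimes> g) \<otimes> h) w"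
        using g h w by (simp add: action_mult)
      also have "inv (h \<otimes> g) \<otimes> h = inv g" using g h by (simp add: inv_mult_group m_assoc)
      finally show "action V (h \<otimes> g) (p (action V (inv (h \<otimes> g)) (action V h w))) =
          action V h (action V g (p (action V (inv g) w)))"
        using g h pV by (simp add: action_mult)
    qed
    finally show ?thesis using h by (simp add: \<pi>_def action_scale action_sum)
  qed
  have \<pi>X: "\<pi> w \<in> X" for w
    unfolding \<pi>_def
    by (intro subspace_scale subspace_sum submoduleD[OF X]) (use p(1) in auto)
  have id: "\<pi> x = x" if "x \<in> X" for x
  proof -
    have "action V g (p (action V (inv g) x)) = x" if g: "g \<in> carrier G" for g
    proof -
      have "action V g (p (action V (inv g) x)) = action V g (action V (inv g) x)"
        using \<open>x \<in> X\<close> g submoduleD(3)[OF X] by (simp add: p(3))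
      also have "\<dots> = x"
        using g \<open>x \<in> X\<close> submoduleD(1)[OF X] by (subst action_mult[symmetric]) (auto simp: action_one)
      finally show ?thesis .
    qed
    then show ?thesis
      using card_nonzero by (simp add: \<pi>_def sum_constant_scale)
  qed
  let ?Y = "{w \<in> W. \<pi> w = 0}"
  note WV = submoduleD(1)[OF W]
  have Y: "submodule G V ?Y"
    unfolding submodule_def
  proof (intro conjI ballI)
    show "?Y \<subseteq> vecs V" using WV by blast
    show "subspace ?Y"
      using submoduleD(2)[OF W]
      by (auto simp: subspace_def linear_add[OF lin] linear_scale[OF lin] linear_0[OF lin])
    fix g w assume "g \<in> carrier G" "w \<in> ?Y"
    then show "action V g w \<in> ?Y"
      using WV submoduleD(3)[OF W] eq[symmetric] by (auto simp: action_zero)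
  qed
  moreover have "X \<inter> ?Y = {0}" using id zero_le_submodule[OF X] zero_le_submodule[OF Y] by auto
  moreover have "span (X \<union> ?Y) = W"
  proof
    show "span (X \<union> ?Y) \<subseteq> W" using XW submoduleD(2)[OF W] by (intro span_minimal) auto
    show "W \<subseteq> span (X \<union> ?Y)"
    proof
      fix w assume w: "w \<in> W"
      have "w - \<pi> w \<in> ?Y"
        using w subsetD[OF XW \<pi>X] submoduleD(2)[OF W] id[OF \<pi>X] by (auto intro: subspace_diff simp: linear_diff[OF lin])
      then have "\<pi> w + (w - \<pi> w) \<in> span (X \<union> ?Y)"
        using \<pi>X by (intro span_add) (auto intro: span_base)
      then show "w \<in> span (X \<union> ?Y)" by simp
    qed
  qed
  ultimately show ?thesis using that by blast
qed

end

text \<open>In a finite monoid a one-sided inverse is two-sided: x z = 1 makes left multiplication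
  by z injective, hence surjective. Consequently the nonunits form an ideal, and kG becomes a
  quotient of kM.\<close>

lemma (in monoid) Units_factor_finite:
  assumes fin: "finite (carrier G)" and x: "x \<in> carrier G" and y: "y \<in> carrier G" and xy: "x \<otimes> y \<in> Units G"
  shows "x \<in> Units G" "y \<in> Units G"
proof -
  define z where "z = y \<otimes> inv (x \<otimes> y)"
  have z: "z \<in> carrier G" using y xy by (simp add: z_def)
  have xz: "x \<otimes> z = \<one>" using x y xy by (simp add: z_def m_assoc[symmetric])
  have "inj_on ((\<otimes>) z) (carrier G)"
    by (rule inj_on_inverseI[of _ "(\<otimes>) x"]) (use x z xz in \<open>simp add: m_assoc[symmetric]\<close>)
  then have "(\<otimes>) z ` carrier G = carrier G"
    using fin z by (intro endo_inj_surj) auto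
  then obtain t where t: "t \<in> carrier G" "z \<otimes> t = \<one>" by (metis imageE one_closed)
  have "x = t" using x z t xz by (metis l_one m_assoc r_one)
  then show xU: "x \<in> Units G" using x z t xz by (auto simp: Units_def)
  have "y = inv x \<otimes> (x \<otimes> y)" using xU y x by (simp add: m_assoc[symmetric])
  then show "y \<in> Units G" using xU xy Units_m_closed Units_inv_Units by metis
qed

section \<open>Indecomposable modules and the ideal of nonunits\<close>

locale unit_maschke_module = monoid M + linear_module M V
  for M :: "('a, 'z) monoid_scheme" (structure)
    and V :: "('a, 'k::field, 'v::ab_group_add) monoid_module" +
  assumes finite_carrier: "finite (carrier M)"
    and card_Units_nonzero: "of_nat (card (Units M)) \<noteq> (0::'k)"
begin

sublocale G: maschke_module "units_of M" V
proof (intro maschke_module.intro maschke_module_axioms.intro linear_module.intro finite_group.intro finite_group_axioms.intro)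
  show "group (units_of M)" by (rule units_group)
  have "Units M \<subseteq> carrier M" by auto
  then show "is_module (units_of M) V"
    using is_module unfolding is_module_def units_of_carrier units_of_one units_of_mult
    by (meson subsetD)
  show "finite (carrier (units_of M))"
    using finite_carrier finite_subset[of "Units M" "carrier M"] by (auto simp: units_of_carrier)
qed (use finite_dim linear_action card_Units_nonzero Units_closed in \<open>auto simp: units_of_carrier\<close>)

definition nonunits :: "'a set" where
  "nonunits = carrier M - Units M"

text \<open>Let I be the span of the nonunits, an ideal of kM. This definition and the next give the
  part of \<open>W\<close> killed by I and the product I W. On the former, and on W / I W, the
  monoid acts through kM / I = kG, which is semisimple.\<close>

definition annihilated :: "'v set \<Rightarrow> 'v set" where
  "annihilated W = {w \<in> W. \<forall>x\<in>nonunits. action V x w = 0}"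

definition nonunit_part :: "'v set \<Rightarrow> 'v set" where
  "nonunit_part W = span (\<Union>x\<in>nonunits. action V x ` W)"

lemma nonunits_ideal:
  assumes "x \<in> nonunits" "g \<in> carrier M"
  shows "g \<otimes> x \<in> nonunits" "x \<otimes> g \<in> nonunits"
  using assms Units_factor_finite[OF finite_carrier, of g x] Units_factor_finite[OF finite_carrier, of x g]
  by (auto simp: nonunits_def)

lemma finite_nonunits: "finite nonunits"
  using finite_carrier by (simp add: nonunits_def)

lemma submodule_iff_units:
  "submodule M V X \<longleftrightarrow> submodule (units_of M) V X \<and> (\<forall>x\<in>nonunits. \<forall>w\<in>X. action V x w \<in> X)"
  using Units_closed by (auto simp: submodule_def nonunits_def units_of_carrier)

lemma submodule_annihilated:
  assumes W: "submodule M V W"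
  shows "submodule M V (annihilated W)"
  unfolding submodule_def
proof (intro conjI ballI)
  note WV = submoduleD[OF W]
  have nc: "x \<in> carrier M" if "x \<in> nonunits" for x using that by (simp add: nonunits_def)
  show "annihilated W \<subseteq> vecs V" using WV(1) by (auto simp: annihilated_def)
  show "subspace (annihilated W)"
    using WV(2) by (auto simp: annihilated_def subspace_def nc action_add action_scale action_zero)
  fix g w assume g: "g \<in> carrier M" and w: "w \<in> annihilated W"
  have "action V x (action V g w) = 0" if x: "x \<in> nonunits" for x
  proof -
    have "action V (x \<otimes> g) w = 0" using w nonunits_ideal(2)[OF x g] by (simp add: annihilated_def)
    then show ?thesis using w WV(1) g nc[OF x] by (auto simp: action_mult annihilated_def)
  qed
  then show "action V g w \<in> annihilated W" using w g WV(3) by (simp add: annihilated_def)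
qed

lemma nonunit_part_subset:
  assumes W: "submodule M V W"
  shows "nonunit_part W \<subseteq> W"
  unfolding nonunit_part_def
  using submoduleD[OF W] by (intro span_minimal) (auto simp: nonunits_def)

lemma submodule_nonunit_part:
  assumes W: "submodule M V W"
  shows "submodule M V (nonunit_part W)"
  unfolding nonunit_part_def
proof (rule submodule_span)
  have nc: "x \<in> carrier M" if "x \<in> nonunits" for x using that by (simp add: nonunits_def)
  show "(\<Union>x\<in>nonunits. action V x ` W) \<subseteq> vecs V"
    using submoduleD[OF W] nc by blast
  fix g s assume g: "g \<in> carrier M" and "s \<in> (\<Union>x\<in>nonunits. action V x ` W)"
  then obtain x w where x: "x \<in> nonunits" "w \<in> W" "s = action V x w" by blast
  then have "action V g s = action V (g \<otimes> x) w"
    using g nc submoduleD(1)[OF W] by (auto simp: action_mult)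
  then show "action V g s \<in> span (\<Union>x\<in>nonunits. action V x ` W)"
    using nonunits_ideal(1)[OF x(1) g] x(2) by (intro span_base) auto
qed

text \<open>Write A for the annihilated part and N for the nonunit part. Over kG one splits A = (A
  \<inter> N) \<oplus> X and then W = (N + X) \<oplus> Y. Both X and B = N + Y turn out to be
  kM-submodules, and W is their direct sum. If X = 0, then A lies in N. If B = 0, then W = X is
  annihilated, so its kG-submodules are kM-submodules and indecomposability makes it simple over
  kG.\<close>

lemma indecomposable_dichotomy:
  assumes W: "submodule M V W" and ind: "indecomposable_module M (V\<lparr>vecs := W\<rparr>)"
  shows "annihilated W = W \<and> G.height W \<le> 1 \<or> annihilated W \<subseteq> nonunit_part W"
proof -
  note sub_units = submodule_iff_units[THEN iffD1, THEN conjunct1]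
  have dec: "A = {0} \<or> B = {0}"
    if A: "submodule M V A" and B: "submodule M V B" and AB: "A \<inter> B = {0}" "span (A \<union> B) = W" for A B
  proof -
    have "A \<subseteq> W" "B \<subseteq> W" using AB(2) span_superset by blast+
    then have "submodule M (V\<lparr>vecs := W\<rparr>) A" "submodule M (V\<lparr>vecs := W\<rparr>) B"
      using A B by (auto simp: submodule_def)
    moreover have "W = {a + b | a b. a \<in> A \<and> b \<in> B}"
      using span_Un_subspaces[OF submoduleD(2)[OF A] submoduleD(2)[OF B]] AB(2) by simp
    ultimately show ?thesis using ind AB(1) unfolding indecomposable_module_def by auto
  qed
  let ?A = "annihilated W" and ?N = "nonunit_part W"
  note A = submodule_annihilated[OF W] and N = submodule_nonunit_part[OF W]
  have AW: "?A \<subseteq> W" by (auto simp: annihilated_def)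
  obtain X where X: "submodule (units_of M) V X" "X \<subseteq> ?A" "(?A \<inter> ?N) \<inter> X = {0}"
      "span ((?A \<inter> ?N) \<union> X) = ?A"
    using G.complement_exists[OF sub_units[OF submodule_Int[OF A N]] sub_units[OF A]] by blast
  \<comment> \<open>\<open>X\<close> is killed by the nonunits, so invariance under the units is
    enough.\<close>
  have XM: "submodule M V X"
    unfolding submodule_iff_units
    using X(1,2) zero_le_submodule[OF A] G.zero_le_submodule[OF X(1)] by (auto simp: annihilated_def)
  have NX: "submodule M V (span (?N \<union> X))" using N XM by (rule submodule_span_Un)
  have NXW: "span (?N \<union> X) \<subseteq> W"
    using nonunit_part_subset[OF W] X(2) AW submoduleD(2)[OF W] by (intro span_minimal) auto
  obtain Y where Y: "submodule (units_of M) V Y" "Y \<subseteq> W" "span (?N \<union> X) \<inter> Y = {0}"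
      "span (span (?N \<union> X) \<union> Y) = W"
    using G.complement_exists[OF sub_units[OF NX] sub_units[OF W] NXW] by blast
  let ?B = "span (?N \<union> Y)"
  have BG: "submodule (units_of M) V ?B"
    using G.submodule_span_Un[OF sub_units[OF N] Y(1)] .
  have BW: "?B \<subseteq> W"
    using nonunit_part_subset[OF W] Y(2) submoduleD(2)[OF W] by (intro span_minimal) auto
  \<comment> \<open>Nonunits map all of \<open>W\<close> into \<open>?N\<close>, so every space
    between \<open>?N\<close> and \<open>W\<close> that is invariant under the units is a
    submodule.\<close>
  have B: "submodule M V ?B"
    unfolding submodule_iff_units
  proof (intro conjI ballI BG)
    fix x w assume "x \<in> nonunits" "w \<in> ?B"
    then have "action V x w \<in> ?N" using BW unfolding nonunit_part_def by (intro span_base) auto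
    then show "action V x w \<in> ?B" by (intro span_base) simp
  qed
  have XB: "X \<inter> ?B = {0}"
  proof -
    have "x = 0" if x: "x \<in> X" "x \<in> ?B" for x
    proof -
      obtain n y where ny: "n \<in> ?N" "y \<in> Y" "x = n + y"
        using x(2) span_Un_subspaces[OF submoduleD(2)[OF N] G.submoduleD(2)[OF Y(1)]] by blast
      have "x - n \<in> span (?N \<union> X)" using x(1) ny(1) by (intro span_diff span_base) auto
      then have "y = 0" using ny Y(3) by auto
      then show ?thesis using ny x X(2,3) by auto
    qed
    then show ?thesis using zero_le_submodule[OF XM] zero_le_submodule[OF B] by blast
  qed
  have "span (X \<union> ?B) = W"
  proof
    show "span (X \<union> ?B) \<subseteq> W"
      using X(2) AW BW submoduleD(2)[OF W] by (intro span_minimal) auto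
    have "?N \<union> Y \<subseteq> span (X \<union> ?B)" "X \<subseteq> span (X \<union> ?B)"
      using span_superset[of "?N \<union> Y"] span_superset[of "X \<union> ?B"] by blast+
    then have "span (?N \<union> X) \<union> Y \<subseteq> span (X \<union> ?B)"
      by (intro Un_least span_minimal) auto
    then show "W \<subseteq> span (X \<union> ?B)"
      using span_minimal[of "span (?N \<union> X) \<union> Y" "span (X \<union> ?B)"] Y(4) by simp
  qed
  then consider "X = {0}" | "?B = {0}" using dec[OF XM B XB] by blast
  then show ?thesis
  proof cases
    case 1
    have "?A \<inter> ?N \<union> {0} = ?A \<inter> ?N"
      using zero_le_submodule[OF A] zero_le_submodule[OF N] by blast
    then have "?A \<inter> ?N = ?A"
      using X(4) 1 submoduleD(2)[OF submodule_Int[OF A N]] by (metis span_eq_iff)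
    then show ?thesis by blast
  next
    case 2
    then have "?N \<subseteq> {0}" "Y \<subseteq> {0}" using span_superset[of "?N \<union> Y"] by auto
    then have "span (?N \<union> X) \<union> Y \<subseteq> X"
      using zero_le_submodule[OF XM] submoduleD(2)[OF XM] by (intro Un_least span_minimal) auto
    then have "W \<subseteq> X" using Y(4) submoduleD(2)[OF XM] span_minimal by blast
    then have AW': "?A = W" using X(2) AW by blast
    have up: "submodule M V C" if "submodule (units_of M) V C" "C \<subseteq> W" for C
      unfolding submodule_iff_units
    proof (intro conjI ballI that(1))
      fix x w assume "x \<in> nonunits" "w \<in> C"
      then have "action V x w = 0" using AW' that(2) by (auto simp: annihilated_def)
      then show "action V x w \<in> C" using G.zero_le_submodule[OF that(1)] by simp
    qed
    have "G.height W \<le> 1"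
    proof (rule G.height_le_one[OF sub_units[OF W]])
      fix C assume C: "submodule (units_of M) V C" "C \<subseteq> W"
      obtain D where D: "submodule (units_of M) V D" "D \<subseteq> W" "C \<inter> D = {0}" "span (C \<union> D) = W"
        using G.complement_exists[OF C(1) sub_units[OF W] C(2)] by blast
      from dec[OF up[OF C] up[OF D(1,2)] D(3,4)] show "C = {0} \<or> C = W"
      proof
        assume "D = {0}"
        then have "C \<union> D = C" using G.zero_le_submodule[OF C(1)] by blast
        then show ?thesis using D(4) G.submoduleD(2)[OF C(1)] by (metis span_eq_iff)
      qed simp
    qed
    then show ?thesis using AW' by blast
  qed
qed

text \<open>The annihilated part is the joint kernel of the nonunits, and imposing one more of them
  lowers the dimension by at most its rank.\<close>

lemma dim_le_annihilated:
  assumes W: "submodule M V W"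
  shows "dim W \<le> dim (annihilated W) + (\<Sum>x\<in>nonunits. dim (action V x ` W))"
proof -
  have "dim W \<le> dim {w \<in> W. \<forall>x\<in>F. action V x w = 0} + (\<Sum>x\<in>F. dim (action V x ` W))"
    if "finite F" "F \<subseteq> nonunits" for F
    using that
  proof (induction F rule: finite_induct)
    case empty
    then show ?case by simp
  next
    case (insert x F)
    let ?X = "{w \<in> W. \<forall>x\<in>F. action V x w = 0}"
    have c: "y \<in> carrier M" if "y \<in> insert x F" for y using insert.prems that by (auto simp: nonunits_def)
    have XV: "?X \<subseteq> vecs V" and xV: "action V x ` W \<subseteq> vecs V"
      using submoduleD(1)[OF W] action_closed[OF c[of x]] by blast+
    have "subspace ?X"
      using submoduleD(2)[OF W] c by (auto simp: subspace_def action_add action_scale action_zero)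
    then have "dim ?X \<le> dim {w \<in> ?X. action V x w = 0} + dim (action V x ` ?X)"
      using XV xV c by (intro dim_le_kernel_image linear_action) blast+
    moreover have "dim (action V x ` ?X) \<le> dim (action V x ` W)"
      by (rule dim_subset[OF _ xV]) blast
    moreover have "{w \<in> ?X. action V x w = 0} = {w \<in> W. \<forall>x\<in>insert x F. action V x w = 0}" by auto
    ultimately show ?case using insert by auto
  qed
  from this[OF finite_nonunits order_refl] show ?thesis by (simp add: annihilated_def)
qed

lemma dim_nonunit_part_le:
  assumes W: "submodule M V W"
  shows "dim (nonunit_part W) \<le> (\<Sum>x\<in>nonunits. dim (action V x ` W))"
  unfolding nonunit_part_def dim_span
  by (rule dim_UN_le[OF finite_nonunits]) (use submoduleD[OF W] in \<open>auto simp: nonunits_def\<close>)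

end

context linear_module
begin

lemma span_UN_sum:
  assumes "finite J" "\<And>j. j \<in> J \<Longrightarrow> subspace (U j)" "x \<in> span (\<Union>j\<in>J. U j)"
  shows "\<exists>w. (\<forall>j\<in>J. w j \<in> U j) \<and> x = (\<Sum>j\<in>J. w j)"
  using assms
proof (induction J arbitrary: x rule: finite_induct)
  case empty
  then show ?case by simp
next
  case (insert i J)
  have "span (\<Union>j\<in>insert i J. U j) = {a + b | a b. a \<in> span (U i) \<and> b \<in> span (\<Union>j\<in>J. U j)}"
    by (simp add: span_Un)
  moreover have "span (U i) = U i" using insert.prems(1)[of i] by (simp add: span_eq_iff)
  ultimately obtain a b where ab: "a \<in> U i" "b \<in> span (\<Union>j\<in>J. U j)" "x = a + b"
    using insert.prems(2) by blast
  then obtain w where w: "\<forall>j\<in>J. w j \<in> U j" "b = (\<Sum>j\<in>J. w j)"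
    using insert.IH insert.prems(1) by blast
  have "(\<Sum>j\<in>J. (w(i := a)) j) = (\<Sum>j\<in>J. w j)"
    using insert.hyps(2) by (intro sum.cong) auto
  then show ?case
    using ab w insert.hyps by (intro exI[of _ "w(i := a)"]) auto
qed

end

context unit_maschke_module
begin

text \<open>Each summand outside \<open>J\<close> has kG-length at most 1. The summands in
  \<open>J\<close> are collected into one submodule \<open>W\<close>, for which the annihilated part
  still lies in the nonunit part. Its dimension is therefore at most twice the sum of the ranks of
  the nonunits: once for the annihilated part, and once for what the nonunits do not kill.\<close>

lemma num_summands_bounds:
  assumes "num_indecomposable_summands M V r"
  shows "r \<le> height (vecs V)"
    and "G.height (vecs V) \<le> r + 2 * (\<Sum>x\<in>nonunits. dim (action V x ` vecs V))"
proof -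
  obtain U where U: "\<And>i. i < r \<Longrightarrow> submodule M V (U i)"
      "\<And>i. i < r \<Longrightarrow> indecomposable_module M (V\<lparr>vecs := U i\<rparr>)"
    and bij: "bij_betw (\<lambda>w. \<Sum>i<r. w i) (\<Pi>\<^sub>E i\<in>{..<r}. U i) (vecs V)"
    using assms unfolding num_indecomposable_summands_def by blast
  note sU = submoduleD(2)[OF U(1)]
  have zero: "w i = 0" if w: "\<And>i. i < r \<Longrightarrow> w i \<in> U i" "(\<Sum>i<r. w i) = 0" and i: "i < r" for w i
  proof -
    have "restrict w {..<r} = restrict (\<lambda>_. 0) {..<r}"
      by (rule inj_onD[OF bij_betw_imp_inj_on[OF bij]])
        (use w subspace_0[OF sU] in auto)
    then show ?thesis using i by (metis lessThan_iff restrict_apply)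
  qed
  have zero_on: "w i = 0"
    if J: "J \<subseteq> {..<r}" and w: "\<And>i. i \<in> J \<Longrightarrow> w i \<in> U i" "(\<Sum>i\<in>J. w i) = 0" and i: "i \<in> J" for w i J
  proof -
    have "(\<Sum>i<r. if i \<in> J then w i else 0) = (\<Sum>i\<in>J. w i)"
      using J by (simp add: sum.If_cases Int_absorb1)
    then have "(if i \<in> J then w i else 0) = 0"
      using w J i subspace_0[OF sU] by (intro zero[of "\<lambda>i. if i \<in> J then w i else 0"]) auto
    then show ?thesis using i by simp
  qed
  show "r \<le> height (vecs V)"
  proof (rule height_ge_filtration)
    fix i assume i: "i < r"
    show "\<not> U i \<subseteq> span (\<Union>j<i. U j)"
    proof
      assume sub: "U i \<subseteq> span (\<Union>j<i. U j)"
      have "U i \<noteq> {0}" using U(2)[OF i] by (simp add: indecomposable_module_def)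
      then obtain u where u: "u \<in> U i" "u \<noteq> 0" using subspace_0[OF sU[OF i]] by blast
      obtain w where w: "\<And>j. j < i \<Longrightarrow> w j \<in> U j" "u = (\<Sum>j<i. w j)"
        using span_UN_sum[of "{..<i}" U u] sU i u(1) sub by auto
      have "(w(i := - u)) i = 0"
        by (rule zero_on[of "{..i}"])
          (use i w u(1) subspace_neg[OF sU[OF i]] in \<open>auto simp: lessThan_Suc_atMost[symmetric] less_Suc_eq\<close>)
      then show False using u(2) by simp
    qed
  qed (rule U(1))
  define J where "J = {i. i < r \<and> annihilated (U i) \<subseteq> nonunit_part (U i)}"
  define W where "W = span (\<Union>i\<in>J. U i)"
  have Jr: "J \<subseteq> {..<r}" and finJ: "finite J" by (auto simp: J_def)
  have W: "submodule M V W" unfolding W_def by (rule submodule_span_Union) (auto simp: J_def U(1))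
  have UW: "U i \<subseteq> W" if "i \<in> J" for i using that span_superset[of "\<Union>i\<in>J. U i"] by (auto simp: W_def)
  have "annihilated W \<subseteq> nonunit_part W"
  proof
    fix v assume v: "v \<in> annihilated W"
    obtain w where w: "\<And>j. j \<in> J \<Longrightarrow> w j \<in> U j" "v = (\<Sum>j\<in>J. w j)"
      using span_UN_sum[of J U v] v finJ sU by (auto simp: W_def annihilated_def J_def)
    \<comment> \<open>A nonunit acts componentwise, so by directness of the sum it kills
      \<open>v\<close> only if it kills every component.\<close>
    have "w j \<in> annihilated (U j)" if j: "j \<in> J" for j
      unfolding annihilated_def
    proof (intro CollectI conjI ballI w(1)[OF j])
      fix x assume x: "x \<in> nonunits"
      then have xM: "x \<in> carrier M" by (simp add: nonunits_def)
      show "action V x (w j) = 0"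
      proof (rule zero_on[OF Jr _ _ j])
        show "action V x (w i) \<in> U i" if "i \<in> J" for i
          using submoduleD(3)[OF U(1) xM] w(1)[OF that] that by (simp add: J_def)
        show "(\<Sum>i\<in>J. action V x (w i)) = 0"
          using v x w(2) by (simp add: annihilated_def action_sum[OF xM, symmetric])
      qed
    qed
    moreover have "nonunit_part (U j) \<subseteq> nonunit_part W" if "j \<in> J" for j
      unfolding nonunit_part_def using UW[OF that] by (intro span_mono) blast
    ultimately have "w j \<in> nonunit_part W" if "j \<in> J" for j
      using that by (auto simp: J_def)
    then show "v \<in> nonunit_part W"
      unfolding w(2) by (intro subspace_sum submoduleD(2)[OF submodule_nonunit_part[OF W]])
  qed
  then have "dim (annihilated W) \<le> dim (nonunit_part W)"
    using submoduleD(1)[OF submodule_nonunit_part[OF W]] by (rule dim_subset)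
  then have "dim W \<le> 2 * (\<Sum>x\<in>nonunits. dim (action V x ` W))"
    using dim_le_annihilated[OF W] dim_nonunit_part_le[OF W] by linarith
  also have "(\<Sum>x\<in>nonunits. dim (action V x ` W)) \<le> (\<Sum>x\<in>nonunits. dim (action V x ` vecs V))"
    using submoduleD(1)[OF W] action_closed by (intro sum_mono dim_subset) (auto simp: nonunits_def)
  finally have dW: "dim W \<le> 2 * (\<Sum>x\<in>nonunits. dim (action V x ` vecs V))" by simp
  let ?K = "{..<r} - J"
  note sub_units = submodule_iff_units[THEN iffD1, THEN conjunct1]
  have K: "submodule (units_of M) V (span (\<Union>i\<in>?K. U i))"
    by (intro sub_units submodule_span_Union) (auto simp: U(1))
  have "vecs V \<subseteq> span (span (\<Union>i\<in>?K. U i) \<union> W)"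
  proof
    fix v assume "v \<in> vecs V"
    then obtain w where w: "w \<in> (\<Pi>\<^sub>E i\<in>{..<r}. U i)" "v = (\<Sum>i<r. w i)"
      using bij by (auto simp: bij_betw_def)
    have "U i \<subseteq> span (span (\<Union>i\<in>?K. U i) \<union> W)" if "i < r" for i
      using UW[of i] span_superset[of "\<Union>i\<in>?K. U i"] span_superset[of "span (\<Union>i\<in>?K. U i) \<union> W"] that
      by blast
    then show "v \<in> span (span (\<Union>i\<in>?K. U i) \<union> W)"
      unfolding w(2) using w(1) by (intro span_sum) auto
  qed
  then have "G.height (vecs V) \<le> G.height (span (span (\<Union>i\<in>?K. U i) \<union> W))"
    by (intro G.height_mono G.submodule_span_Un K sub_units[OF W] submodule_self[OF G.is_module])
  also have "\<dots> \<le> G.height (span (\<Union>i\<in>?K. U i)) + G.height W"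
    by (intro G.height_Un_le K sub_units[OF W])
  also have "G.height (span (\<Union>i\<in>?K. U i)) \<le> (\<Sum>i\<in>?K. G.height (U i))"
    by (intro G.height_UN_le sub_units U(1)) auto
  also have "\<dots> \<le> (\<Sum>i\<in>?K. 1)"
    using indecomposable_dichotomy[OF U] by (intro sum_mono) (auto simp: J_def)
  also have "\<dots> \<le> r" using card_mono[of "{..<r}" ?K] by simp
  also have "G.height W \<le> dim W" by (intro G.height_le_dim sub_units[OF W])
  finally show "G.height (vecs V) \<le> r + 2 * (\<Sum>x\<in>nonunits. dim (action V x ` vecs V))"
    using dW by simp
qed

lemma module_length_le:
  assumes "module_length M V l"
  shows "l \<le> G.height (vecs V)"
  using module_length_eq_height[OF assms]
    height_carrier_mono[OF linear_module_axioms G.linear_module_axioms _ submodule_self[OF is_module]]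
  by (auto simp: units_of_carrier)

end

section \<open>The group algebra\<close>

interpretation fn: vector_space "fun_smul :: 'k::field \<Rightarrow> ('x \<Rightarrow> 'k) \<Rightarrow> 'x \<Rightarrow> 'k"
  by (rule vector_space_fun_smul)

interpretation fn2: vector_space_pair
  "fun_smul :: 'k::field \<Rightarrow> ('x \<Rightarrow> 'k) \<Rightarrow> 'x \<Rightarrow> 'k" "fun_smul :: 'k \<Rightarrow> ('y \<Rightarrow> 'k) \<Rightarrow> 'y \<Rightarrow> 'k" ..

lemma sum_fun_apply: "(\<Sum>i\<in>I. f i) x = (\<Sum>i\<in>I. f i x :: 'k::comm_monoid_add)"
  by (induction I rule: infinite_finite_induct) auto

text \<open>The group algebra of \<open>H\<close> is modelled by the functions on the whole type
  that vanish outside \<open>H\<close>. The group algebras of subgroups are then nested sets with a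
  common product.\<close>

definition supported :: "'a set \<Rightarrow> ('a \<Rightarrow> 'k::zero) set" where
  "supported H = {x. \<forall>g. g \<notin> H \<longrightarrow> x g = 0}"

definition delta :: "'a \<Rightarrow> 'a \<Rightarrow> 'k::zero_neq_one" where
  "delta g = (\<lambda>h. if h = g then 1 else 0)"

lemma delta_supported: "g \<in> H \<Longrightarrow> delta g \<in> supported H"
  by (auto simp: supported_def delta_def)

lemma supported_mono: "H \<subseteq> K \<Longrightarrow> supported H \<subseteq> supported K"
  by (auto simp: supported_def)

lemma subspace_supported: "fn.subspace (supported H)"
  by (auto simp: fn.subspace_def supported_def fun_smul_def)

lemma supported_expand:
  assumes "finite H" "x \<in> supported H"
  shows "x = (\<Sum>g\<in>H. fun_smul (x g) (delta g))"
proof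
  fix h
  have "(\<Sum>g\<in>H. fun_smul (x g) (delta g)) h = (\<Sum>g\<in>H. if g = h then x g else 0)"
    unfolding sum_fun_apply by (rule sum.cong) (auto simp: fun_smul_def delta_def)
  then show "x h = (\<Sum>g\<in>H. fun_smul (x g) (delta g)) h"
    using assms by (auto simp: supported_def)
qed

lemma span_delta:
  assumes H: "finite H"
  shows "fn.span (delta ` H) = (supported H :: ('a \<Rightarrow> 'k::field) set)"
proof
  show "fn.span (delta ` H) \<subseteq> supported H"
    by (intro fn.span_minimal subspace_supported) (auto intro: delta_supported)
  show "(supported H :: ('a \<Rightarrow> 'k) set) \<subseteq> fn.span (delta ` H)"
  proof
    fix x :: "'a \<Rightarrow> 'k" assume "x \<in> supported H"
    then have eq: "(\<Sum>g\<in>H. fun_smul (x g) (delta g)) = x" by (rule supported_expand[OF H, symmetric])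
    have "(\<Sum>g\<in>H. fun_smul (x g) (delta g)) \<in> fn.span (delta ` H :: ('a \<Rightarrow> 'k) set)"
      by (intro fn.span_sum fn.span_scale fn.span_base imageI)
    then show "x \<in> fn.span (delta ` H)" by (simp only: eq)
  qed
qed

lemma dim_supported:
  assumes H: "finite H"
  shows "fn.dim (supported H :: ('a \<Rightarrow> 'k::field) set) = card H"
proof -
  have inj: "inj_on (delta :: 'a \<Rightarrow> 'a \<Rightarrow> 'k) H"
    by (rule inj_onI) (metis delta_def zero_neq_one)
  have "fn.independent (delta ` H :: ('a \<Rightarrow> 'k) set)"
  proof (rule fn.independent_if_scalars_zero)
    fix c :: "('a \<Rightarrow> 'k) \<Rightarrow> 'k" and v :: "'a \<Rightarrow> 'k"
    assume 0: "(\<Sum>v\<in>delta ` H. fun_smul (c v) v) = 0" and "v \<in> delta ` H"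
    then obtain g where g: "g \<in> H" "v = delta g" by blast
    have "(\<Sum>v\<in>delta ` H. fun_smul (c v) v) = (\<Sum>h\<in>H. fun_smul (c (delta h)) (delta h))"
      by (subst sum.reindex[OF inj]) (simp add: comp_def)
    then have "0 = (\<Sum>h\<in>H. fun_smul (c (delta h)) (delta h)) g" using 0 by simp
    also have "\<dots> = (\<Sum>h\<in>H. if h = g then c (delta h) else 0)"
      unfolding sum_fun_apply by (rule sum.cong) (auto simp: fun_smul_def delta_def)
    finally show "c v = 0" using H g by simp
  qed (use H in auto)
  then have "fn.dim (fn.span (delta ` H :: ('a \<Rightarrow> 'k) set)) = card (delta ` H :: ('a \<Rightarrow> 'k) set)"
    by (rule fn.dim_span_eq_card_independent)
  then show ?thesis using inj by (simp add: span_delta[OF H] card_image)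
qed

section \<open>Convolution and the anti-involution on the group algebra\<close>

context finite_group
begin

definition conv :: "('a \<Rightarrow> 'k::field) \<Rightarrow> ('a \<Rightarrow> 'k) \<Rightarrow> 'a \<Rightarrow> 'k"  (infixl \<open>\<star>\<close> 70) where
  "x \<star> y = (\<lambda>g. if g \<in> carrier G then \<Sum>h\<in>carrier G. x h * y (inv h \<otimes> g) else 0)"

definition adjoint :: "('a \<Rightarrow> 'k::field) \<Rightarrow> 'a \<Rightarrow> 'k" where
  "adjoint x = (\<lambda>g. if g \<in> carrier G then x (inv g) else 0)"

lemma conv_supported: "x \<star> y \<in> supported (carrier G)"
  by (auto simp: conv_def supported_def)

lemma conv_assoc: "(x \<star> y) \<star> z = x \<star> (y \<star> z)"
proof
  fix g
  show "((x \<star> y) \<star> z) g = (x \<star> (y \<star> z)) g"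
  proof (cases "g \<in> carrier G")
    case g: True
    have "((x \<star> y) \<star> z) g = (\<Sum>h\<in>carrier G. \<Sum>l\<in>carrier G. x l * y (inv l \<otimes> h) * z (inv h \<otimes> g))"
      using g by (simp add: conv_def sum_distrib_right)
    also have "\<dots> = (\<Sum>l\<in>carrier G. \<Sum>h\<in>carrier G. x l * y (inv l \<otimes> h) * z (inv h \<otimes> g))"
      by (rule sum.swap)
    also have "\<dots> = (\<Sum>l\<in>carrier G. x l * (\<Sum>h\<in>carrier G. y h * z (inv h \<otimes> (inv l \<otimes> g))))"
    proof (rule sum.cong[OF refl])
      fix l assume l: "l \<in> carrier G"
      have "(\<Sum>h\<in>carrier G. x l * y (inv l \<otimes> h) * z (inv h \<otimes> g)) =
          (\<Sum>h\<in>carrier G. x l * y (inv l \<otimes> (l \<otimes> h)) * z (inv (l \<otimes> h) \<otimes> g))"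
        using sum_translate[OF l, of "\<lambda>h. x l * y (inv l \<otimes> h) * z (inv h \<otimes> g)"] by simp
      also have "\<dots> = (\<Sum>h\<in>carrier G. x l * (y h * z (inv h \<otimes> (inv l \<otimes> g))))"
        using l g by (intro sum.cong) (auto simp: m_assoc[symmetric] inv_mult_group)
      finally show "(\<Sum>h\<in>carrier G. x l * y (inv l \<otimes> h) * z (inv h \<otimes> g)) =
          x l * (\<Sum>h\<in>carrier G. y h * z (inv h \<otimes> (inv l \<otimes> g)))"
        by (simp add: sum_distrib_left)
    qed
    also have "\<dots> = (x \<star> (y \<star> z)) g" using g by (simp add: conv_def)
    finally show ?thesis .
  qed (simp add: conv_def)
qed

lemma conv_add_left: "(x + y) \<star> z = x \<star> z + y \<star> z"
  and conv_add_right: "x \<star> (y + z) = x \<star> y + x \<star> z"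
  and conv_diff_left: "(x - y) \<star> z = x \<star> z - y \<star> z"
  and conv_diff_right: "x \<star> (y - z) = x \<star> y - x \<star> z"
  and conv_smul_left: "fun_smul c x \<star> y = fun_smul c (x \<star> y)"
  and conv_smul_right: "x \<star> fun_smul c y = fun_smul c (x \<star> y)"
  and conv_zero_left: "0 \<star> x = 0"
  and conv_zero_right: "x \<star> 0 = 0"
  by (auto simp: conv_def fun_smul_def fun_eq_iff algebra_simps sum.distrib sum_subtractf sum_distrib_left)

lemma linear_conv_left: "Vector_Spaces.linear fun_smul fun_smul (\<lambda>x. x \<star> y)"
  and linear_conv_right: "Vector_Spaces.linear fun_smul fun_smul (\<lambda>x. y \<star> x)"
  by (auto simp: Vector_Spaces.linear_iff fn.vector_space_axioms conv_add_left conv_add_right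
      conv_smul_left conv_smul_right)

lemmas conv_sum_left = fn2.linear_sum[OF linear_conv_left]
  and conv_sum_right = fn2.linear_sum[OF linear_conv_right]

lemma delta_conv:
  assumes "g \<in> carrier G"
  shows "delta g \<star> x = (\<lambda>k. if k \<in> carrier G then x (inv g \<otimes> k) else 0)"
proof
  fix k
  have "(\<Sum>h\<in>carrier G. delta g h * x (inv h \<otimes> k)) = (\<Sum>h\<in>carrier G. if h = g then x (inv h \<otimes> k) else 0)"
    by (rule sum.cong) (auto simp: delta_def)
  then show "(delta g \<star> x) k = (if k \<in> carrier G then x (inv g \<otimes> k) else 0)"
    using assms finite_carrier by (simp add: conv_def)
qed

lemma conv_delta:
  assumes g: "g \<in> carrier G"
  shows "x \<star> delta g = (\<lambda>k. if k \<in> carrier G then x (k \<otimes> inv g) else 0)"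
proof
  fix k
  have "(x \<star> delta g) k = x (k \<otimes> inv g)" if k: "k \<in> carrier G"
  proof -
    have "inv h \<otimes> k = g \<longleftrightarrow> h = k \<otimes> inv g" if "h \<in> carrier G" for h
      using that g k by (metis inv_closed inv_solve_left inv_solve_right)
    then have "(\<Sum>h\<in>carrier G. x h * delta g (inv h \<otimes> k)) = (\<Sum>h\<in>carrier G. if h = k \<otimes> inv g then x h else 0)"
      by (intro sum.cong) (auto simp: delta_def)
    then show ?thesis using k g finite_carrier by (simp add: conv_def)
  qed
  then show "(x \<star> delta g) k = (if k \<in> carrier G then x (k \<otimes> inv g) else 0)"
    by (simp add: conv_def)
qed

lemma one_conv: "x \<in> supported (carrier G) \<Longrightarrow> delta \<one> \<star> x = x"
  and conv_one: "x \<in> supported (carrier G) \<Longrightarrow> x \<star> delta \<one> = x"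
  by (auto simp: delta_conv conv_delta supported_def fun_eq_iff)

lemma delta_conv_delta: "g \<in> carrier G \<Longrightarrow> h \<in> carrier G \<Longrightarrow> delta g \<star> delta h = delta (g \<otimes> h)"
proof
  fix k assume g: "g \<in> carrier G" and h: "h \<in> carrier G"
  have "inv g \<otimes> k = h \<longleftrightarrow> k = g \<otimes> h" if "k \<in> carrier G"
    using that g h by (metis inv_closed inv_inv inv_solve_left)
  then show "(delta g \<star> delta h) k = delta (g \<otimes> h) k"
    unfolding delta_conv[OF g] using g h by (auto simp: delta_def)
qed

lemma conv_supported_subgroup:
  assumes H: "subgroup H G" and x: "x \<in> supported H" and y: "y \<in> supported H"
  shows "x \<star> y \<in> supported H"
  unfolding supported_def
proof (intro CollectI allI impI)
  fix g assume g: "g \<notin> H"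
  have "x h * y (inv h \<otimes> g) = 0" if "h \<in> carrier G" "g \<in> carrier G" for h
  proof (cases "h \<in> H")
    case True
    have "inv h \<otimes> g \<notin> H"
    proof
      assume "inv h \<otimes> g \<in> H"
      then have "h \<otimes> (inv h \<otimes> g) \<in> H" using True H by (simp add: subgroup.m_closed)
      then show False using g that by (simp add: m_assoc[symmetric])
    qed
    then show ?thesis using y by (simp add: supported_def)
  qed (use x in \<open>simp add: supported_def\<close>)
  then have "(\<Sum>h\<in>carrier G. x h * y (inv h \<otimes> g)) = 0" if "g \<in> carrier G"
    using that by (intro sum.neutral ballI)
  then show "(x \<star> y) g = 0" by (simp add: conv_def)
qed

text \<open>The coefficient at the identity is, up to the factor |G|, the trace of the regular
  representation.\<close>

lemma trace_commute: "(x \<star> y) \<one> = (y \<star> x) \<one>"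
proof -
  have "(x \<star> y) \<one> = (\<Sum>h\<in>carrier G. x h * y (inv h))"
    unfolding conv_def by (auto intro!: sum.cong)
  also have "\<dots> = (\<Sum>h\<in>carrier G. x (inv h) * y (inv (inv h)))"
    by (rule sum_inverse[of "\<lambda>h. x h * y (inv h)", symmetric])
  also have "\<dots> = (y \<star> x) \<one>"
    unfolding conv_def by (auto intro!: sum.cong simp: mult.commute)
  finally show ?thesis .
qed

lemma adjoint_conv: "adjoint (x \<star> y) = adjoint y \<star> adjoint x"
proof
  fix g
  show "adjoint (x \<star> y) g = (adjoint y \<star> adjoint x) g"
  proof (cases "g \<in> carrier G")
    case g: True
    have "adjoint (x \<star> y) g = (\<Sum>h\<in>carrier G. x h * y (inv h \<otimes> inv g))"
      using g by (simp add: adjoint_def conv_def)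
    also have "\<dots> = (\<Sum>h\<in>carrier G. x (inv g \<otimes> h) * y (inv (inv g \<otimes> h) \<otimes> inv g))"
      using g sum_translate[of "inv g" "\<lambda>h. x h * y (inv h \<otimes> inv g)"] by simp
    also have "\<dots> = (\<Sum>h\<in>carrier G. y (inv h) * x (inv (inv h \<otimes> g)))"
      using g by (intro sum.cong) (auto simp: inv_mult_group m_assoc)
    also have "\<dots> = (adjoint y \<star> adjoint x) g"
      using g by (simp add: adjoint_def conv_def)
    finally show ?thesis .
  qed (simp add: adjoint_def conv_def)
qed

lemma adjoint_adjoint: "x \<in> supported (carrier G) \<Longrightarrow> adjoint (adjoint x) = x"
  by (auto simp: adjoint_def supported_def fun_eq_iff)

lemma linear_adjoint: "Vector_Spaces.linear fun_smul fun_smul adjoint"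
  by (auto simp: Vector_Spaces.linear_iff fn.vector_space_axioms adjoint_def fun_smul_def fun_eq_iff)

lemma adjoint_smul: "adjoint (fun_smul c x) = fun_smul c (adjoint x)"
  by (auto simp: adjoint_def fun_smul_def)

lemma adjoint_supported: "adjoint x \<in> supported (carrier G)"
  by (auto simp: adjoint_def supported_def)

lemma adjoint_one: "adjoint (delta \<one>) = delta \<one>"
  by (auto simp: adjoint_def delta_def fun_eq_iff inv_eq_1_iff)

definition regular :: "'a set \<Rightarrow> ('a, 'k::field, 'a \<Rightarrow> 'k) monoid_module" where
  "regular H = \<lparr>vecs = supported H, smul = fun_smul, action = (\<lambda>g x. delta g \<star> x)\<rparr>"

lemma regular_simps [simp]:
  "vecs (regular H) = supported H" "smul (regular H) = fun_smul"
  "action (regular H) g x = delta g \<star> x"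
  by (simp_all add: regular_def)

lemma maschke_module_regular:
  assumes H: "subgroup H G" and nz: "of_nat (card H) \<noteq> (0::'k::field)"
  shows "maschke_module (G\<lparr>carrier := H\<rparr>) (regular H :: ('a, 'k, 'a \<Rightarrow> 'k) monoid_module)"
proof -
  have HG: "H \<subseteq> carrier G" using H by (rule subgroup.subset)
  have fH: "finite H" using HG finite_carrier by (rule finite_subset)
  have inG: "x \<in> supported (carrier G)" if "x \<in> supported H" for x :: "'a \<Rightarrow> 'k"
    using that supported_mono[OF HG] by blast
  have "is_module (G\<lparr>carrier := H\<rparr>) (regular H :: ('a, 'k, 'a \<Rightarrow> 'k) monoid_module)"
    unfolding is_module_def
    using fn.vector_space_axioms subspace_supported conv_supported_subgroup[OF H delta_supported] HG
    by (auto simp: conv_add_right conv_smul_right one_conv inG delta_supported subsetD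
        delta_conv_delta[symmetric] conv_assoc)
  moreover have "finite_dim (regular H :: ('a, 'k, 'a \<Rightarrow> 'k) monoid_module)"
    unfolding finite_dim_def using span_delta[OF fH] fH by (intro exI[of _ "delta ` H"]) simp
  moreover have "Vector_Spaces.linear fun_smul fun_smul (\<lambda>x. (delta g :: 'a \<Rightarrow> 'k) \<star> x)" for g
    by (rule linear_conv_right)
  ultimately show ?thesis
    using subgroup_imp_group[OF H] fH nz
    by (intro maschke_module.intro maschke_module_axioms.intro linear_module.intro
        finite_group.intro finite_group_axioms.intro) (auto simp: regular_def)
qed


lemma conv_delta_expand:
  assumes "x \<in> supported H" "H \<subseteq> carrier G"
  shows "x \<star> y = (\<Sum>h\<in>H. fun_smul (x h) (delta h \<star> y))"
proof -
  have "finite H" using assms(2) finite_carrier by (rule finite_subset)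
  then have "x \<star> y = (\<Sum>h\<in>H. fun_smul (x h) (delta h)) \<star> y"
    using supported_expand[OF _ assms(1)] by simp
  then show ?thesis by (simp add: conv_sum_left conv_smul_left)
qed

text \<open>Von Neumann regularity, from a complement of the left ideal generated by \<open>x\<close>.\<close>

lemma conv_regular:
  assumes H: "subgroup H G" and nz: "of_nat (card H) \<noteq> (0::'k::field)" and x: "x \<in> supported H"
  shows "\<exists>a\<in>supported H. x \<star> a \<star> x = (x :: 'a \<Rightarrow> 'k)"
proof -
  interpret R: maschke_module "G\<lparr>carrier := H\<rparr>" "regular H :: ('a, 'k, 'a \<Rightarrow> 'k) monoid_module"
    using H nz by (rule maschke_module_regular)
  have HG: "H \<subseteq> carrier G" using H by (rule subgroup.subset)
  let ?X = "(\<lambda>a. a \<star> x) ` supported H"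
  have X: "submodule (G\<lparr>carrier := H\<rparr>) (regular H) ?X"
    unfolding submodule_def regular_simps
  proof (intro conjI ballI)
    show "?X \<subseteq> supported H" using conv_supported_subgroup[OF H _ x] by blast
    show "fn.subspace ?X"
      using fn2.linear_subspace_image[OF linear_conv_left subspace_supported] .
    fix g w assume "g \<in> carrier (G\<lparr>carrier := H\<rparr>)" "w \<in> ?X"
    then obtain a where "g \<in> H" "a \<in> supported H" "w = a \<star> x" by auto
    then have "delta g \<star> w = (delta g \<star> a) \<star> x" "delta g \<star> a \<in> supported H"
      using conv_supported_subgroup[OF H delta_supported] by (auto simp: conv_assoc)
    then show "delta g \<star> w \<in> ?X" by blast
  qed
  have self: "submodule (G\<lparr>carrier := H\<rparr>) (regular H) (supported H :: ('a \<Rightarrow> 'k) set)"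
    using submodule_self[OF R.is_module] by simp
  have "?X \<subseteq> supported H" using R.submoduleD(1)[OF X] unfolding regular_simps .
  from R.complement_exists[OF X self this]
  obtain Y where Y: "submodule (G\<lparr>carrier := H\<rparr>) (regular H) Y" "?X \<inter> Y = {0}" "fn.span (?X \<union> Y) = supported H"
    unfolding regular_simps by metis
  \<comment> \<open>From 1 = a x + y it follows that x y = x - x a x = (1 - x a) x. This element
    lies in \<open>Y\<close> and also in the left ideal \<open>?X\<close>, hence vanishes.\<close>
  have "delta \<one> \<in> fn.span (?X \<union> Y)"
    unfolding Y(3) using H by (intro delta_supported subgroup.one_closed)
  then have "delta \<one> \<in> {u + y | u y. u \<in> ?X \<and> y \<in> Y}"
    using R.span_Un_subspaces[OF R.submoduleD(2)[OF X] R.submoduleD(2)[OF Y(1)]]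
    unfolding regular_simps by (simp only:)
  then obtain a y where ay: "a \<in> supported H" "y \<in> Y" "delta \<one> = a \<star> x + y" by blast
  have xG: "x \<in> supported (carrier G)" using x supported_mono[OF HG] by blast
  have "x = x \<star> delta \<one>" by (rule conv_one[OF xG, symmetric])
  also have "\<dots> = x \<star> y + x \<star> a \<star> x"
    by (simp only: ay(3) conv_add_right conv_assoc add.commute)
  finally have eq: "x - x \<star> a \<star> x = x \<star> y" by (rule diff_eq_eq[THEN iffD2])
  have "x \<star> y = (\<Sum>h\<in>H. fun_smul (x h) (delta h \<star> y))" by (rule conv_delta_expand[OF x HG])
  also have "\<dots> \<in> Y"
    using R.submoduleD(2,3)[OF Y(1)] ay(2) unfolding regular_simps
    by (intro fn.subspace_sum fn.subspace_scale) auto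
  finally have "x \<star> y \<in> Y" .
  moreover have "x \<star> y = (delta \<one> - x \<star> a) \<star> x"
    by (simp only: eq[symmetric] conv_diff_left one_conv[OF xG])
  then have "x \<star> y \<in> ?X"
    using x(1) ay(1) H
    by (intro image_eqI[of _ _ "delta \<one> - x \<star> a"] fn.subspace_diff[OF subspace_supported]
        conv_supported_subgroup delta_supported subgroup.one_closed)
  ultimately have "x \<star> y = 0" using Y(2) by blast
  then have "x = x \<star> a \<star> x" by (rule eq[THEN trans, THEN right_minus_eq[THEN iffD1]])
  then show ?thesis using ay(1) by (intro bexI[of _ a]) (rule sym)
qed

section \<open>Primitive idempotents and complete orthogonal systems\<close>

definition primitive :: "'a set \<Rightarrow> ('a \<Rightarrow> 'k::field) \<Rightarrow> bool" where
  "primitive H e \<longleftrightarrow> e \<in> supported H \<and> e \<star> e = e \<and> e \<noteq> 0 \<and>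
     (\<forall>f\<in>supported H. f \<star> f = f \<and> e \<star> f = f \<and> f \<star> e = f \<longrightarrow> f = 0 \<or> f = e)"

definition idempotent_system :: "'a set \<Rightarrow> ('a \<Rightarrow> 'k::field) set \<Rightarrow> bool" where
  "idempotent_system H E \<longleftrightarrow> finite E \<and> E \<subseteq> supported H \<and> 0 \<notin> E \<and> (\<forall>e\<in>E. e \<star> e = e) \<and>
     (\<forall>e\<in>E. \<forall>f\<in>E. e \<noteq> f \<longrightarrow> e \<star> f = 0) \<and> \<Sum>E = delta \<one>"

text \<open>This is minimality of the left ideal generated by \<open>e\<close>. Regularity provides
  an idempotent f = a x with x f = x. Then e f is an idempotent below \<open>e\<close>, hence 0 or
  \<open>e\<close>. If it is 0, then f = f e f = 0 and x = x f = 0; if it is \<open>e\<close>, then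
  (e a) x = e.\<close>

lemma primitive_simple:
  assumes H: "subgroup H G" and nz: "of_nat (card H) \<noteq> (0::'k::field)" and e: "primitive H (e :: 'a \<Rightarrow> 'k)"
    and x: "x \<in> supported H" "x \<star> e = x" "x \<noteq> 0"
  shows "\<exists>a\<in>supported H. a \<star> x = e"
proof -
  obtain a where a: "a \<in> supported H" "x \<star> a \<star> x = x" using conv_regular[OF H nz x(1)] by blast
  have e': "e \<in> supported H" "e \<star> e = e" using e by (auto simp: primitive_def)
  define f where "f = a \<star> x"
  have f: "f \<in> supported H" "f \<star> f = f" "f \<star> e = f" "x \<star> f = x"
    using a x conv_supported_subgroup[OF H a(1) x(1)] by (auto simp: f_def conv_assoc)
  have "(e \<star> f) \<star> (e \<star> f) = e \<star> ((f \<star> e) \<star> f)" by (simp add: conv_assoc)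
  then have "(e \<star> f) \<star> (e \<star> f) = e \<star> f" using f by simp
  moreover have "e \<star> (e \<star> f) = e \<star> f" using e'(2) by (simp add: conv_assoc[symmetric])
  moreover have "e \<star> f \<star> e = e \<star> f" using f by (simp add: conv_assoc)
  moreover have "e \<star> f \<in> supported H" using H e'(1) f(1) by (rule conv_supported_subgroup)
  ultimately have "e \<star> f = 0 \<or> e \<star> f = e" using e unfolding primitive_def by blast
  then show ?thesis
  proof
    assume 0: "e \<star> f = 0"
    have "f = (f \<star> e) \<star> f" using f by simp
    also have "\<dots> = f \<star> (e \<star> f)" by (rule conv_assoc)
    finally have "f = 0" using 0 by (simp only: conv_zero_right)
    then have "x = 0" using f(4) by (metis conv_zero_right)
    then show ?thesis using x(3) by simp
  next
    assume "e \<star> f = e"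
    then show ?thesis
      using conv_supported_subgroup[OF H e'(1) a(1)]
      by (intro bexI[of _ "e \<star> a"]) (auto simp: f_def conv_assoc)
  qed
qed

lemma idempotent_system_independent:
  fixes E :: "('a \<Rightarrow> 'k::field) set"
  assumes "idempotent_system H E"
  shows "fn.independent E"
proof -
  have E: "finite E" "0 \<notin> E" "\<And>e. e \<in> E \<Longrightarrow> e \<star> e = e"
      "\<And>e f. e \<in> E \<Longrightarrow> f \<in> E \<Longrightarrow> e \<noteq> f \<Longrightarrow> e \<star> f = 0"
    using assms by (auto simp: idempotent_system_def)
  show ?thesis
  proof (rule fn.independent_if_scalars_zero[OF E(1)])
    fix c e assume 0: "(\<Sum>f\<in>E. fun_smul (c f) f) = 0" and e: "e \<in> E"
    have "(\<Sum>f\<in>E. fun_smul (c f) (f \<star> e)) = (\<Sum>f\<in>E. if f = e then fun_smul (c f) f else 0)"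
      using E(3,4) e by (intro sum.cong) auto
    then have "fun_smul (c e) e = (\<Sum>f\<in>E. fun_smul (c f) (f \<star> e))"
      using e E(1) by simp
    also have "\<dots> = (\<Sum>f\<in>E. fun_smul (c f) f) \<star> e"
      by (simp add: conv_sum_left conv_smul_left)
    also have "\<dots> = 0" unfolding 0 by (rule conv_zero_left)
    finally show "c e = 0" using E(2) e fn.scale_eq_0_iff by metis
  qed
qed

lemma card_system_le:
  fixes E :: "('a \<Rightarrow> 'k::field) set"
  assumes E: "idempotent_system H E" and HG: "H \<subseteq> carrier G"
  shows "card E \<le> card H"
proof -
  have fH: "finite H" using HG finite_carrier by (rule finite_subset)
  have "E \<subseteq> fn.span (delta ` H)" using E span_delta[OF fH] by (auto simp: idempotent_system_def)
  then have "card E \<le> card (delta ` H :: ('a \<Rightarrow> 'k) set)"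
    using fn.independent_span_bound[OF finite_imageI[OF fH] idempotent_system_independent[OF E]] by blast
  also have "\<dots> \<le> card H" using fH by (rule card_image_le)
  finally show ?thesis .
qed

text \<open>A refinement of maximal cardinality is primitive, since a proper idempotent f below e
  would allow e to be replaced by f and e - f. Cardinalities are bounded because orthogonal
  idempotents are independent. The last property, that each new idempotent lies below an old one, is
  what links consecutive groups of a chain.\<close>

lemma primitive_refinement_exists:
  fixes E0 :: "('a \<Rightarrow> 'k::field) set"
  assumes E0: "idempotent_system H E0" and HG: "H \<subseteq> carrier G"
  obtains E where "idempotent_system H E" "\<And>e. e \<in> E \<Longrightarrow> primitive H e"
    "\<And>e. e \<in> E \<Longrightarrow> \<exists>e0\<in>E0. e0 \<star> e = e \<and> e \<star> e0 = e"
proof -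
  let ?P = "\<lambda>E. idempotent_system H E \<and> (\<forall>e\<in>E. \<exists>e0\<in>E0. e0 \<star> e = e \<and> e \<star> e0 = e)"
  have "?P E0" using E0 by (auto simp: idempotent_system_def)
  moreover have "\<forall>E. ?P E \<longrightarrow> card E < Suc (card H)"
    using card_system_le[OF _ HG] by (auto simp: less_Suc_eq_le)
  ultimately have "\<exists>E. ?P E \<and> (\<forall>E'. ?P E' \<longrightarrow> card E' \<le> card E)"
    by (rule ex_has_greatest_nat)
  then obtain E where P: "?P E" and max: "\<And>E'. ?P E' \<Longrightarrow> card E' \<le> card E" by blast
  have E: "finite E" "E \<subseteq> supported H" "0 \<notin> E" "\<And>e. e \<in> E \<Longrightarrow> e \<star> e = e"
      "\<And>e f. e \<in> E \<Longrightarrow> f \<in> E \<Longrightarrow> e \<noteq> f \<Longrightarrow> e \<star> f = 0" "\<Sum>E = delta \<one>"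
    using P by (auto simp: idempotent_system_def)
  have "primitive H e" if e: "e \<in> E" for e
    unfolding primitive_def
  proof (intro conjI ballI impI)
    show "e \<in> supported H" "e \<star> e = e" "e \<noteq> 0" using E e by auto
    fix f assume f: "f \<in> supported H" "f \<star> f = f \<and> e \<star> f = f \<and> f \<star> e = f"
    show "f = 0 \<or> f = e"
    proof (rule ccontr)
      assume "\<not> (f = 0 \<or> f = e)"
      then have f0: "f \<noteq> 0" "f \<noteq> e" by auto
      define f' where "f' = e - f"
      have f'0: "f' \<noteq> 0" using f0 by (simp add: f'_def)
      have f': "f' \<star> f' = f'" "e \<star> f' = f'" "f' \<star> e = f'" "f \<star> f' = 0" "f' \<star> f = 0"
        using f E(4)[OF e] by (simp_all add: f'_def conv_diff_left conv_diff_right)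
      have nE: "f \<notin> E" "f' \<notin> E"
        using E(5)[OF e, of f] E(5)[OF e, of f'] f f' f0 f'0 by (auto simp: f'_def)
      have ff': "f \<noteq> f'" using f f' f0 by auto
      have orth: "x \<star> g = 0" "g \<star> x = 0" if "g \<in> E - {e}" "x = f \<or> x = f'" for g x
      proof -
        have "x \<star> e = x" "e \<star> x = x" using that(2) f f' by auto
        then have "x \<star> g = x \<star> (e \<star> g)" "g \<star> x = (g \<star> e) \<star> x" by (metis conv_assoc)+
        then show "x \<star> g = 0" "g \<star> x = 0"
          using E(5)[of e g] E(5)[of g e] that(1) e conv_zero_left conv_zero_right by auto
      qed
      let ?E = "insert f (insert f' (E - {e}))"
      have "\<Sum>?E = f + (f' + \<Sum>(E - {e}))"
        using E(1) nE ff' by simp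
      also have "\<dots> = \<Sum>E" using E(1) e by (simp add: f'_def sum_diff1)
      finally have sum: "\<Sum>?E = delta \<one>" using E(6) by simp
      obtain e0 where e0: "e0 \<in> E0" "e0 \<star> e = e" "e \<star> e0 = e" using P e by blast
      have "e0 \<star> x = x \<and> x \<star> e0 = x" if "x = f \<or> x = f'" for x
      proof -
        have "x \<star> e = x" "e \<star> x = x" using that f f' by auto
        then show ?thesis using e0 by (metis conv_assoc)
      qed
      then have "\<forall>x\<in>?E. \<exists>e0\<in>E0. e0 \<star> x = x \<and> x \<star> e0 = x"
        using P e0(1) by blast
      moreover have "f' \<in> supported H"
        unfolding f'_def using E(2) e f(1) by (intro fn.subspace_diff[OF subspace_supported]) auto
      then have "idempotent_system H ?E"
        unfolding idempotent_system_def
        using sum E f f' f0 f'0 orth by (intro conjI) auto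
      ultimately have "card ?E \<le> card E" using max by blast
      moreover have "0 < card E" using E(1) e by (auto simp: card_gt_0_iff)
      then have "card ?E = card E + 1"
        using E(1) nE ff' e by simp
      ultimately show False by simp
    qed
  qed
  then show ?thesis using that P by blast
qed

end

section \<open>Modules over the group algebra and almost free modules\<close>

context maschke_module
begin

sublocale alg: vector_space_pair "fun_smul :: 'k \<Rightarrow> ('a \<Rightarrow> 'k) \<Rightarrow> 'a \<Rightarrow> 'k" "smul V" ..

definition act :: "('a \<Rightarrow> 'k) \<Rightarrow> 'v \<Rightarrow> 'v" where
  "act x w = (\<Sum>g\<in>carrier G. smul V (x g) (action V g w))"

lemma linear_act: "Vector_Spaces.linear fun_smul (smul V) (\<lambda>x. act x w)"
  by (simp add: Vector_Spaces.linear_iff fn.vector_space_axioms vector_space_axioms act_def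
      fun_smul_def scale_left_distrib sum.distrib scale_sum_right)

lemma act_delta: "g \<in> carrier G \<Longrightarrow> act (delta g) w = action V g w"
proof -
  assume g: "g \<in> carrier G"
  have "act (delta g) w = (\<Sum>h\<in>carrier G. if h = g then action V h w else 0)"
    unfolding act_def by (rule sum.cong) (auto simp: delta_def)
  then show ?thesis using g finite_carrier by simp
qed

lemma act_submodule: "submodule G V X \<Longrightarrow> w \<in> X \<Longrightarrow> act x w \<in> X"
  unfolding act_def by (intro subspace_sum subspace_scale submoduleD)

lemma act_conv:
  assumes w: "w \<in> vecs V"
  shows "act (x \<star> y) w = act x (act y w)"
proof -
  have "act (x \<star> y) w = (\<Sum>g\<in>carrier G. \<Sum>h\<in>carrier G. smul V (x h * y (inv h \<otimes> g)) (action V g w))"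
    unfolding act_def by (rule sum.cong) (auto simp: conv_def scale_sum_left)
  also have "\<dots> = (\<Sum>h\<in>carrier G. \<Sum>g\<in>carrier G. smul V (x h * y (inv h \<otimes> g)) (action V g w))"
    by (rule sum.swap)
  also have "\<dots> = (\<Sum>h\<in>carrier G. smul V (x h) (action V h (act y w)))"
  proof (rule sum.cong[OF refl])
    fix h assume h: "h \<in> carrier G"
    have "(\<Sum>g\<in>carrier G. smul V (x h * y (inv h \<otimes> g)) (action V g w)) =
        (\<Sum>g\<in>carrier G. smul V (x h * y (inv h \<otimes> (h \<otimes> g))) (action V (h \<otimes> g) w))"
      by (rule sum_translate[OF h, symmetric])
    also have "\<dots> = (\<Sum>g\<in>carrier G. smul V (x h) (action V h (smul V (y g) (action V g w))))"
      using h w by (intro sum.cong) (auto simp: m_assoc[symmetric] action_mult action_scale)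
    finally show "(\<Sum>g\<in>carrier G. smul V (x h * y (inv h \<otimes> g)) (action V g w)) =
        smul V (x h) (action V h (act y w))"
      using h by (simp add: act_def action_sum scale_sum_right)
  qed
  finally show ?thesis by (simp add: act_def)
qed

text \<open>The submodule kG z w generated by z w, an image of the left ideal kG z.\<close>

definition ideal_orbit :: "('a \<Rightarrow> 'k) \<Rightarrow> 'v \<Rightarrow> 'v set" where
  "ideal_orbit z w = (\<lambda>x. act (x \<star> z) w) ` supported (carrier G)"

lemma linear_act_conv: "Vector_Spaces.linear fun_smul (smul V) (\<lambda>x. act (x \<star> z) w)"
  using Vector_Spaces.linear_compose[OF linear_conv_left linear_act] by (simp add: comp_def)

lemma submodule_ideal_orbit:
  assumes w: "w \<in> vecs V"
  shows "submodule G V (ideal_orbit z w)"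
  unfolding submodule_def ideal_orbit_def
proof (intro conjI ballI)
  show "(\<lambda>x. act (x \<star> z) w) ` supported (carrier G) \<subseteq> vecs V"
    using act_submodule[OF submodule_self[OF is_module] w] by blast
  show "subspace ((\<lambda>x. act (x \<star> z) w) ` supported (carrier G))"
    using linear_act_conv subspace_supported by (rule alg.linear_subspace_image)
  fix g v assume g: "g \<in> carrier G" and "v \<in> (\<lambda>x. act (x \<star> z) w) ` supported (carrier G)"
  then obtain x where x: "v = act (x \<star> z) w" by blast
  have "v \<in> vecs V" unfolding x using act_submodule[OF submodule_self[OF is_module] w] .
  then have "action V g v = act (delta g \<star> x \<star> z) w"
    using g w by (simp add: x conv_assoc act_conv act_delta)
  then show "action V g v \<in> (\<lambda>x. act (x \<star> z) w) ` supported (carrier G)"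
    using conv_supported by blast
qed

text \<open>kG e w is a homomorphic image of the minimal left ideal kG e, hence zero or
  simple.\<close>

lemma height_ideal_orbit:
  assumes e: "primitive (carrier G) e" and w: "w \<in> vecs V"
  shows "height (ideal_orbit e w) \<le> 1"
proof (rule height_le_one[OF submodule_ideal_orbit[OF w]])
  fix B assume B: "submodule G V B" "B \<subseteq> ideal_orbit e w"
  show "B = {0} \<or> B = ideal_orbit e w"
  proof (cases "B \<subseteq> {0}")
    case True
    then show ?thesis using zero_le_submodule[OF B(1)] by blast
  next
    case False
    then obtain x where x: "act (x \<star> e) w \<in> B" "act (x \<star> e) w \<noteq> 0"
      using B(2) by (auto simp: ideal_orbit_def)
    have "x \<star> e \<noteq> 0" using x(2) alg.linear_0[OF linear_act] by metis
    moreover have "x \<star> e \<star> e = x \<star> e" using e by (simp add: primitive_def conv_assoc)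
    ultimately obtain a where a: "a \<star> (x \<star> e) = e"
      using primitive_simple[OF subgroup_self card_nonzero e conv_supported] by blast
    have "act e w = act a (act (x \<star> e) w)" using a act_conv[OF w, of a "x \<star> e"] by simp
    then have eB: "act e w \<in> B" using act_submodule[OF B(1) x(1)] by simp
    have "ideal_orbit e w \<subseteq> B"
      using act_submodule[OF B(1) eB] by (auto simp: ideal_orbit_def act_conv[OF w])
    then show ?thesis using B(2) by blast
  qed
qed

text \<open>The left ideal kG (1 - e) does not contain \<open>e\<close>, so it is proper. The strict
  inequality expresses that the orbit of \<open>w\<close> cannot stay free once its component at
  \<open>e\<close> is removed.\<close>

lemma dim_ideal_orbit:
  assumes e: "e \<star> e = e" "e \<noteq> 0" "e \<in> supported (carrier G)" and w: "w \<in> vecs V"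
  shows "dim (ideal_orbit (delta \<one> - e) w) < card (carrier G)"
proof -
  let ?S = "supported (carrier G) :: ('a \<Rightarrow> 'k) set"
  have "maschke_module (G\<lparr>carrier := carrier G\<rparr>) (regular (carrier G) :: ('a, 'k, 'a \<Rightarrow> 'k) monoid_module)"
    using subgroup_self card_nonzero by (rule maschke_module_regular)
  then interpret R: maschke_module G "regular (carrier G) :: ('a, 'k, 'a \<Rightarrow> 'k) monoid_module" by simp
  let ?I = "(\<lambda>x. x \<star> (delta \<one> - e)) ` ?S"
  have IS: "?I \<subseteq> ?S" using conv_supported by blast
  have "submodule G (regular (carrier G)) ?I"
    unfolding submodule_def regular_simps
  proof (intro conjI ballI IS)
    show "fn.subspace ?I" using linear_conv_left subspace_supported by (rule fn2.linear_subspace_image)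
    fix g v assume "v \<in> ?I"
    then obtain x where "v = x \<star> (delta \<one> - e)" by blast
    then have "delta g \<star> v = (delta g \<star> x) \<star> (delta \<one> - e)" by (simp add: conv_assoc)
    then show "delta g \<star> v \<in> ?I" using conv_supported by blast
  qed
  moreover have "submodule G (regular (carrier G)) ?S"
    using submodule_self[OF R.is_module] by simp
  moreover have "e \<notin> ?I"
  proof
    assume "e \<in> ?I"
    then obtain x where "e = x \<star> (delta \<one> - e)" by blast
    then have "e \<star> e = x \<star> ((delta \<one> - e) \<star> e)" by (metis conv_assoc)
    also have "(delta \<one> - e) \<star> e = 0" using e by (simp add: conv_diff_left one_conv)
    finally show False using e(1,2) conv_zero_right by metis
  qed
  then have "?I \<subset> ?S" using IS e by blast
  ultimately have "fn.dim ?I < fn.dim ?S"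
    using submodule_dim_less[OF R.is_module R.finite_dim] by simp
  then have lt: "fn.dim ?I < card (carrier G)" using dim_supported[OF finite_carrier] by metis
  obtain B where B: "finite B" "?I \<subseteq> fn.span B" "card B = fn.dim ?I"
    using R.obtain_finite_basis[of ?I] IS unfolding regular_simps by metis
  have "ideal_orbit (delta \<one> - e) w = (\<lambda>x. act x w) ` ?I"
    by (auto simp: ideal_orbit_def)
  also have "\<dots> \<subseteq> (\<lambda>x. act x w) ` fn.span B" using B(2) by blast
  also have "\<dots> = span ((\<lambda>x. act x w) ` B)" by (rule alg.linear_span_image[OF linear_act, symmetric])
  finally have "dim (ideal_orbit (delta \<one> - e) w) \<le> card ((\<lambda>x. act x w) ` B)"
    using B(1) by (intro dim_le_card) auto
  also have "\<dots> \<le> card B" using B(1) by (rule card_image_le)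
  finally show ?thesis using lt B(3) by simp
qed

lemma act_in_span_orbit: "act x w \<in> span ((\<lambda>g. action V g w) ` carrier G)"
  unfolding act_def by (intro span_sum span_scale span_base imageI)

text \<open>
  The hypotheses say that the vectors \<open>g w\<close> together with \<open>Q\<close> form a basis, so that \<open>V\<close> is
  the direct sum of \<open>card J\<close> copies of the group algebra and of the span of \<open>Q\<close>.
\<close>

lemma height_almost_free:
  fixes E :: "('a \<Rightarrow> 'k) set"
  assumes E: "idempotent_system (carrier G) E" "\<And>e. e \<in> E \<Longrightarrow> primitive (carrier G) e"
    and J: "finite J" "J \<subseteq> vecs V" and Q: "finite Q" "Q \<subseteq> vecs V"
    and span: "vecs V \<subseteq> span ((\<Union>w\<in>J. (\<lambda>g. action V g w) ` carrier G) \<union> Q)"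
    and card: "card J * card (carrier G) + card Q \<le> dim (vecs V)"
  shows "card J * card E \<le> height (vecs V)" "height (vecs V) \<le> card J * card E + card Q"
proof -
  have E': "finite E" "\<And>e. e \<in> E \<Longrightarrow> e \<star> e = e" "\<And>e f. e \<in> E \<Longrightarrow> f \<in> E \<Longrightarrow> e \<noteq> f \<Longrightarrow> e \<star> f = 0"
      "\<Sum>E = delta \<one>" "0 \<notin> E" "E \<subseteq> supported (carrier G)"
    using E(1) by (auto simp: idempotent_system_def)
  let ?X = "\<lambda>(e, w). ideal_orbit e w"
  let ?F = "span (\<Union>i\<in>E \<times> J. ?X i)"
  have X: "submodule G V (?X i)" if "i \<in> E \<times> J" for i
    using that J(2) by (auto intro: submodule_ideal_orbit)
  have F: "submodule G V ?F" using X by (intro submodule_span_Union) auto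
  have orbit: "action V g w \<in> ?F" if w: "w \<in> J" and g: "g \<in> carrier G" for g w
  proof -
    have "action V g w = act (\<Sum>e\<in>E. delta g \<star> e) w"
      using g by (simp add: conv_sum_right[symmetric] E'(4) conv_one[OF delta_supported] act_delta)
    also have "\<dots> = (\<Sum>e\<in>E. act (delta g \<star> e) w)" by (rule alg.linear_sum[OF linear_act])
    also have "\<dots> \<in> ?F"
      using w g by (intro span_sum span_base) (auto simp: ideal_orbit_def intro: delta_supported)
    finally show ?thesis .
  qed
  have "(\<Union>w\<in>J. (\<lambda>g. action V g w) ` carrier G) \<union> Q \<subseteq> span (?F \<union> Q)"
    using orbit span_superset[of "?F \<union> Q"] by blast
  then have FQ: "vecs V \<subseteq> span (?F \<union> Q)" using span span_minimal by blast
  show "height (vecs V) \<le> card J * card E + card Q"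
  proof -
    have "dim (vecs V) \<le> dim (?F \<union> Q)"
      using FQ submoduleD(1)[OF F] Q(2) by (intro dim_mono) auto
    also have "\<dots> \<le> dim ?F + dim Q" using submoduleD(1)[OF F] Q(2) by (rule dim_Un_le)
    also have "dim Q \<le> card Q" using span_superset Q(1) by (rule dim_le_card)
    finally have "dim (vecs V) \<le> dim ?F + card Q" by simp
    \<comment> \<open>\<open>?F\<close> has codimension at most \<open>card Q\<close>, and beyond
      \<open>?F\<close> the height is bounded by the dimension.\<close>
    moreover have "height (vecs V) + dim ?F \<le> height ?F + dim (vecs V)"
      by (rule height_quotient_le[OF submodule_self[OF is_module] F submoduleD(1)[OF F]])
    moreover have "height ?F \<le> (\<Sum>i\<in>E \<times> J. height (?X i))"
      using E'(1) J(1) X by (intro height_UN_le) auto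
    moreover have "(\<Sum>i\<in>E \<times> J. height (?X i)) \<le> (\<Sum>i\<in>E \<times> J. 1)"
    proof (rule sum_mono)
      fix i assume "i \<in> E \<times> J"
      then obtain e w where i: "i = (e, w)" "e \<in> E" "w \<in> vecs V" using J(2) by blast
      show "height (?X i) \<le> 1" unfolding i(1) prod.case using E(2)[OF i(2)] i(3) by (rule height_ideal_orbit)
    qed
    ultimately show ?thesis by (simp add: card_cartesian_product mult.commute)
  qed
  show "card J * card E \<le> height (vecs V)"
  proof -
    obtain f where f: "bij_betw f {..<card (E \<times> J)} (E \<times> J)"
      using ex_bij_betw_nat_finite[of "E \<times> J"] E'(1) J(1) by (auto simp: atLeast0LessThan)
    have "card (E \<times> J) \<le> height (vecs V)"
    proof (rule height_ge_filtration)
      fix i assume i: "i < card (E \<times> J)"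
      then have fi: "f i \<in> E \<times> J" using f by (auto dest: bij_betwE)
      then show "submodule G V (?X (f i))" by (rule X)
      obtain e w where ew: "f i = (e, w)" "e \<in> E" "w \<in> J" using fi by auto
      let ?O = "\<Union>w'\<in>J - {w}. (\<lambda>g. action V g w') ` carrier G"
      let ?Y = "ideal_orbit (delta \<one> - e) w"
      \<comment> \<open>\<open>?T\<close> omits only the component kG e w. If that component were
        contained in the sum of the earlier ones, \<open>?T\<close> would be the whole space,
        although its dimension is smaller than
        \<open>card J * card (carrier G) + card Q\<close>.\<close>
      let ?T = "span (Q \<union> (?O \<union> ?Y))"
      have wV: "w \<in> vecs V" using ew J(2) by blast
      show "\<not> ?X (f i) \<subseteq> span (\<Union>j<i. ?X (f j))"
      proof
        assume sub: "?X (f i) \<subseteq> span (\<Union>j<i. ?X (f j))"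
        have T: "Q \<subseteq> ?T" "?O \<subseteq> ?T" "?Y \<subseteq> ?T"
          using span_superset[of "Q \<union> (?O \<union> ?Y)"] by blast+
        have other: "?X p \<subseteq> ?T" if p: "p \<in> E \<times> J" "p \<noteq> (e, w)" for p
        proof -
          obtain e' w' where p': "p = (e', w')" "e' \<in> E" "w' \<in> J" using p by auto
          show ?thesis
          proof (cases "w' = w")
            case True
            then have "e' \<star> e = 0" using p p' ew E'(3) by auto
            moreover have "e' \<star> delta \<one> = e'" using p'(2) E'(6) by (auto intro: conv_one)
            ultimately have ee: "e' \<star> (delta \<one> - e) = e'" by (simp add: conv_diff_right)
            have "ideal_orbit e' w \<subseteq> ?Y"
            proof
              fix v assume "v \<in> ideal_orbit e' w"
              then obtain x where "v = act (x \<star> e') w" by (auto simp: ideal_orbit_def)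
              then have "v = act ((x \<star> e') \<star> (delta \<one> - e)) w" by (simp add: conv_assoc ee)
              then show "v \<in> ?Y" unfolding ideal_orbit_def using conv_supported by blast
            qed
            then show ?thesis using T(3) True p'(1) by auto
          next
            case False
            have "span ((\<lambda>g. action V g w') ` carrier G) \<subseteq> ?T"
              using T(2) False p'(3) by (intro span_minimal) auto
            then show ?thesis using act_in_span_orbit p'(1) by (auto simp: ideal_orbit_def)
          qed
        qed
        have "f j \<in> E \<times> J \<and> f j \<noteq> (e, w)" if "j < i" for j
        proof
          show "f j \<in> E \<times> J" using bij_betwE[OF f] that i by simp
          show "f j \<noteq> (e, w)"
            using inj_onD[OF bij_betw_imp_inj_on[OF f], of j i] that i ew(1) by auto
        qed
        then have "(\<Union>j<i. ?X (f j)) \<subseteq> ?T" using other by (intro UN_least) simp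
        then have "span (\<Union>j<i. ?X (f j)) \<subseteq> ?T" by (rule span_minimal) simp
        then have "?X (e, w) \<subseteq> ?T" using sub unfolding ew(1) by (rule subset_trans[rotated])
        then have "?X p \<subseteq> ?T" if "p \<in> E \<times> J" for p
          using other[OF that] by (cases "p = (e, w)") simp_all
        then have "(\<Union>i\<in>E \<times> J. ?X i) \<subseteq> ?T" by (rule UN_least)
        then have "?F \<subseteq> ?T" by (rule span_minimal) simp
        then have "?F \<union> Q \<subseteq> ?T" using T(1) by (rule Un_least)
        then have "span (?F \<union> Q) \<subseteq> ?T" by (rule span_minimal) simp
        with FQ have "vecs V \<subseteq> ?T" by (rule subset_trans)
        moreover have OV: "?O \<subseteq> vecs V"
          using J(2) action_closed by (intro UN_least image_subsetI) (simp add: subset_iff)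
        moreover have YV: "?Y \<subseteq> vecs V" using submoduleD(1)[OF submodule_ideal_orbit[OF wV]] .
        ultimately have "dim (vecs V) \<le> dim (Q \<union> (?O \<union> ?Y))" using Q(2) by (intro dim_mono Un_least)
        also have "\<dots> \<le> dim Q + dim (?O \<union> ?Y)" using Q(2) OV YV by (intro dim_Un_le Un_least)
        also have "dim (?O \<union> ?Y) \<le> dim ?O + dim ?Y" using OV YV by (rule dim_Un_le)
        also have "dim Q \<le> card Q" using span_superset Q(1) by (rule dim_le_card)
        also have "dim ?O \<le> (\<Sum>w'\<in>J - {w}. card (carrier G))"
        proof -
          have "finite ?O" using J(1) finite_carrier by auto
          then have "dim ?O \<le> card ?O" using span_superset by (intro dim_le_card)
          also have "\<dots> \<le> (\<Sum>w'\<in>J - {w}. card ((\<lambda>g. action V g w') ` carrier G))"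
            using J(1) by (intro card_UN_le) auto
          also have "\<dots> \<le> (\<Sum>w'\<in>J - {w}. card (carrier G))"
            using finite_carrier by (intro sum_mono card_image_le)
          finally show ?thesis .
        qed
        also have "dim ?Y < card (carrier G)"
          using E'(2)[OF ew(2)] E'(5,6) ew(2) wV by (intro dim_ideal_orbit) blast+
        finally have "dim (vecs V) < card Q + (card (J - {w}) * card (carrier G) + card (carrier G))"
          by simp
        also have "card (J - {w}) * card (carrier G) + card (carrier G) = card J * card (carrier G)"
          unfolding card_Suc_Diff1[OF J(1) ew(3), symmetric] by simp
        finally show False using card by simp
      qed
    qed
    then show ?thesis by (simp add: card_cartesian_product mult.commute)
  qed
qed

end

text \<open>Both cardinalities equal the length of the regular module, which is free on the single
  generator 1 with empty remainder.\<close>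

lemma (in finite_group) card_primitive_system_unique:
  fixes E E' :: "('a \<Rightarrow> 'k::field) set"
  assumes nz: "of_nat (card (carrier G)) \<noteq> (0::'k)"
    and E: "idempotent_system (carrier G) E" "\<And>e. e \<in> E \<Longrightarrow> primitive (carrier G) e"
    and E': "idempotent_system (carrier G) E'" "\<And>e. e \<in> E' \<Longrightarrow> primitive (carrier G) e"
  shows "card E = card E'"
proof -
  have "maschke_module (G\<lparr>carrier := carrier G\<rparr>) (regular (carrier G) :: ('a, 'k, 'a \<Rightarrow> 'k) monoid_module)"
    using subgroup_self nz by (rule maschke_module_regular)
  then interpret R: maschke_module G "regular (carrier G) :: ('a, 'k, 'a \<Rightarrow> 'k) monoid_module" by simp
  have "R.height (supported (carrier G)) = card F"
    if F: "idempotent_system (carrier G) F" "\<And>e. e \<in> F \<Longrightarrow> primitive (carrier G) e" for F :: "('a \<Rightarrow> 'k) set"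
  proof -
    have "(\<lambda>g. delta g \<star> delta \<one>) ` carrier G = (delta ` carrier G :: ('a \<Rightarrow> 'k) set)"
      by (auto simp: delta_conv_delta)
    then have "fn.span ((\<Union>w\<in>{delta \<one>}. (\<lambda>g. delta g \<star> w) ` carrier G) \<union> {}) =
        (supported (carrier G) :: ('a \<Rightarrow> 'k) set)"
      using span_delta[OF finite_carrier] by simp
    then have "vecs (regular (carrier G)) \<subseteq> R.span ((\<Union>w\<in>{delta \<one>}. (\<lambda>g. action (regular (carrier G)) g w) ` carrier G) \<union> {})"
      by simp
    note bounds = R.height_almost_free[OF F _ _ _ _ this]
    have "card F \<le> R.height (vecs (regular (carrier G)))"
      using bounds(1) dim_supported[OF finite_carrier, where 'k='k] by (simp add: delta_supported)
    moreover have "R.height (vecs (regular (carrier G))) \<le> card F"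
      using bounds(2) dim_supported[OF finite_carrier, where 'k='k] by (simp add: delta_supported)
    ultimately show ?thesis by simp
  qed
  from this[OF E] this[OF E'] show ?thesis by simp
qed

section \<open>Idempotents adapted to a chain of subgroups\<close>

context finite_group
begin

text \<open>The corner at \<open>e\<close> consists of the multiples of \<open>e\<close>. For
  nonzero \<open>e\<close> this is absolute primitivity: unlike \<open>primitive\<close>, it
  survives extension of the field.\<close>

definition split_idempotent :: "'a set \<Rightarrow> ('a \<Rightarrow> 'k::field) \<Rightarrow> bool" where
  "split_idempotent H e \<longleftrightarrow> e \<in> supported H \<and> e \<star> e = e \<and> e \<noteq> 0 \<and>
     (\<forall>x\<in>supported H. \<exists>c. e \<star> x \<star> e = fun_smul c e)"

lemma split_idempotent_primitive:
  assumes "split_idempotent H e"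
  shows "primitive H e"
  unfolding primitive_def
proof (intro conjI ballI impI)
  show e: "e \<in> supported H" "e \<star> e = e" "e \<noteq> 0" using assms by (auto simp: split_idempotent_def)
  fix f assume f: "f \<in> supported H" "f \<star> f = f \<and> e \<star> f = f \<and> f \<star> e = f"
  then obtain c where c: "f = fun_smul c e"
    using assms by (metis split_idempotent_def)
  have "fun_smul (c * c) e = fun_smul c e"
    using f(2) e(2) unfolding c by (simp add: conv_smul_left conv_smul_right)
  then have "c * c = c" using e(3) fn.scale_right_imp_eq by blast
  then have "c = 0 \<or> c = 1" by simp
  then show "f = 0 \<or> f = e" using c by auto
qed

text \<open>
  Averaging \<open>x\<close> over \<open>H\<close> gives an element \<open>c\<close> of the centraliser of \<open>H\<close>, which is self-adjoint because
  every element of \<open>K\<close> is inverted by some element of \<open>H\<close>; and \<open>e \<star> c \<star> e\<close> is a nonzero multiple of \<open>x\<close>.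
\<close>

lemma adjoint_corner:
  fixes e x :: "'a \<Rightarrow> 'k::field"
  assumes H: "subgroup H G" and K: "subgroup K G" and HK: "H \<subseteq> K"
    and rev: "\<And>g. g \<in> K \<Longrightarrow> \<exists>h\<in>H. h \<otimes> g \<otimes> inv h = inv g"
    and e: "split_idempotent H e" "adjoint e = e"
    and x: "x \<in> supported K" "e \<star> x = x" "x \<star> e = x"
  shows "adjoint x = x"
proof -
  have HG: "H \<subseteq> carrier G" and KG: "K \<subseteq> carrier G" using H K by (auto dest: subgroup.subset)
  interpret H: finite_group "G\<lparr>carrier := H\<rparr>"
    using subgroup_imp_group[OF H] finite_subset[OF HG finite_carrier]
    by (intro finite_group.intro finite_group_axioms.intro) auto
  have eH: "e \<in> supported H" "e \<star> e = e" "e \<noteq> 0"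
    and corner: "\<forall>x\<in>supported H. \<exists>c. e \<star> x \<star> e = fun_smul c e"
    using e(1) by (auto simp: split_idempotent_def)
  have "\<exists>c. e \<star> delta g \<star> e = fun_smul c e" if "g \<in> H" for g
    using corner delta_supported[OF that] by (rule bspec)
  then have "\<forall>g\<in>H. \<exists>c. e \<star> delta g \<star> e = fun_smul c e" by (rule ballI)
  from bchoice[OF this] obtain \<beta> where \<beta>: "\<And>g. g \<in> H \<Longrightarrow> e \<star> delta g \<star> e = fun_smul (\<beta> g) e"
    by blast
  have Hc: "g \<in> carrier G" "inv g \<in> H" if "g \<in> H" for g
    using that HG subgroup.m_inv_closed[OF H that] by auto
  \<comment> \<open>\<open>\<beta>\<close> is a diagonal matrix coefficient of the simple module
    belonging to \<open>e\<close>; the trace property expresses it through the coefficients of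
    \<open>e\<close>.\<close>
  have \<beta>1: "\<beta> g * e \<one> = e (inv g)" if g: "g \<in> H" for g
  proof -
    have "\<beta> g * e \<one> = (e \<star> delta g \<star> e) \<one>" by (simp only: \<beta>[OF g] fun_smul_def)
    also have "\<dots> = (e \<star> (e \<star> delta g)) \<one>" by (rule trace_commute)
    also have "\<dots> = (e \<star> delta g) \<one>" by (simp only: conv_assoc[symmetric] eH)
    finally show ?thesis using Hc[OF g] by (simp add: conv_delta)
  qed
  have e1: "e \<one> \<noteq> 0"
  proof
    assume 0: "e \<one> = 0"
    have "e g = 0" for g
    proof (cases "g \<in> H")
      case True
      then show ?thesis using \<beta>1[OF Hc(2)[OF True]] Hc(1)[OF True] 0 by simp
    qed (use eH in \<open>simp add: supported_def\<close>)
    then have "e = 0" by (simp add: fun_eq_iff)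
    then show False using eH(3) by contradiction
  qed
  \<comment> \<open>A Schur orthogonality sum. The following equations show \<mu> e(1)^2 = e(1), so
    \<mu> is the reciprocal of e(1) and in particular nonzero.\<close>
  define \<mu> where "\<mu> = (\<Sum>g\<in>H. \<beta> g * \<beta> (inv g))"
  have "\<mu> * e \<one> * e \<one> = (\<Sum>g\<in>H. (\<beta> (inv g) * e \<one>) * (\<beta> g * e \<one>))"
    unfolding \<mu>_def sum_distrib_right by (rule sum.cong) auto
  also have "\<dots> = (\<Sum>g\<in>H. e g * e (inv g))"
    by (rule sum.cong) (simp_all add: \<beta>1 Hc)
  also have "\<dots> = (\<Sum>g\<in>carrier G. e g * e (inv g))"
    using HG finite_carrier eH(1) by (intro sum.mono_neutral_left) (auto simp: supported_def)
  also have "\<dots> = (e \<star> e) \<one>" unfolding conv_def by (auto intro!: sum.cong)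
  finally have "\<mu> \<noteq> 0" using eH(2) e1 by auto
  define c where "c = (\<Sum>g\<in>H. delta g \<star> x \<star> delta (inv g))"
  have ece: "e \<star> c \<star> e = fun_smul \<mu> x"
  proof -
    have "e \<star> c \<star> e = (\<Sum>g\<in>H. e \<star> (delta g \<star> x \<star> delta (inv g)) \<star> e)"
      by (simp only: c_def conv_sum_left conv_sum_right)
    also have "\<dots> = (\<Sum>g\<in>H. fun_smul (\<beta> g * \<beta> (inv g)) x)"
    proof (rule sum.cong[OF refl])
      fix g assume g: "g \<in> H"
      have "e \<star> (delta g \<star> x \<star> delta (inv g)) \<star> e = e \<star> (delta g \<star> (e \<star> x \<star> e) \<star> delta (inv g)) \<star> e"
        by (simp only: x)
      also have "\<dots> = (e \<star> delta g \<star> e) \<star> x \<star> (e \<star> delta (inv g) \<star> e)"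
        by (simp only: conv_assoc)
      also have "\<dots> = fun_smul (\<beta> g * \<beta> (inv g)) x"
        using Hc[OF g] g by (simp add: \<beta> conv_smul_left conv_smul_right x mult.commute)
      finally show "e \<star> (delta g \<star> x \<star> delta (inv g)) \<star> e = fun_smul (\<beta> g * \<beta> (inv g)) x" .
    qed
    also have "\<dots> = fun_smul \<mu> x" by (simp only: \<mu>_def fn.scale_sum_left)
    finally show ?thesis .
  qed
  have c: "c k = (\<Sum>g\<in>H. x (inv g \<otimes> k \<otimes> g))" if k: "k \<in> carrier G" for k
    unfolding c_def sum_fun_apply
  proof (rule sum.cong[OF refl])
    fix g assume "g \<in> H"
    then have g: "g \<in> carrier G" using HG by blast
    show "(delta g \<star> x \<star> delta (inv g)) k = x (inv g \<otimes> k \<otimes> g)"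
      using g k by (simp add: conv_delta delta_conv m_assoc)
  qed
  have c_out: "c k = 0" if k: "k \<in> carrier G" "k \<notin> K" for k
  proof -
    have "x (inv g \<otimes> k \<otimes> g) = 0" if g: "g \<in> H" for g
    proof -
      have "inv g \<otimes> k \<otimes> g \<notin> K"
      proof
        assume *: "inv g \<otimes> k \<otimes> g \<in> K"
        have gK: "g \<in> K" "g \<in> carrier G" using g HK HG by auto
        then have "g \<otimes> (inv g \<otimes> k \<otimes> g) \<otimes> inv g \<in> K"
          using K * by (simp add: subgroup.m_closed subgroup.m_inv_closed)
        also have "g \<otimes> (inv g \<otimes> k \<otimes> g) \<otimes> inv g = k"
          using gK k by (simp add: m_assoc[symmetric]) (simp add: m_assoc)
        finally show False using k by simp
      qed
      then show ?thesis using x(1) by (simp add: supported_def)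
    qed
    then show ?thesis using c[OF k(1)] by simp
  qed
  have "adjoint c = c"
  proof
    fix k
    consider "k \<notin> carrier G" | "k \<in> carrier G" "k \<notin> K" | "k \<in> K" by blast
    then show "adjoint c k = c k"
    proof cases
      case 1
      have "c \<in> supported (carrier G)"
        unfolding c_def by (intro fn.subspace_sum subspace_supported conv_supported)
      then show ?thesis using 1 by (simp add: adjoint_def supported_def)
    next
      case 2
      then have "inv k \<notin> K" using subgroup.m_inv_closed[OF K, of "inv k"] by auto
      then show ?thesis using 2 c_out by (simp add: adjoint_def)
    next
      case 3
      then have k: "k \<in> carrier G" using KG by blast
      obtain h where h: "h \<in> H" "h \<otimes> k \<otimes> inv h = inv k" using rev[OF 3] by blast
      have hG: "h \<in> carrier G" using h HG by blast
      have "adjoint c k = (\<Sum>g\<in>H. x (inv g \<otimes> inv k \<otimes> g))" using k by (simp add: adjoint_def c)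
      \<comment> \<open>Shifting the summation by the element \<open>h\<close> that inverts
        \<open>k\<close> turns the sum for the inverse of \<open>k\<close> into the sum for
        \<open>k\<close>.\<close>
      also have "\<dots> = (\<Sum>g\<in>H. x (inv (h \<otimes> g) \<otimes> inv k \<otimes> (h \<otimes> g)))"
        using H.sum_translate[of h "\<lambda>g. x (inv g \<otimes> inv k \<otimes> g)"] h(1) by simp
      also have "\<dots> = (\<Sum>g\<in>H. x (inv g \<otimes> k \<otimes> g))"
      proof (rule sum.cong[OF refl])
        fix g assume "g \<in> H"
        then have g: "g \<in> carrier G" using HG by blast
        have "inv (h \<otimes> g) \<otimes> inv k \<otimes> (h \<otimes> g) = inv g \<otimes> (inv h \<otimes> (h \<otimes> k \<otimes> inv h) \<otimes> h) \<otimes> g"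
          unfolding h(2) using g hG k by (simp add: inv_mult_group m_assoc)
        also have "inv h \<otimes> (h \<otimes> k \<otimes> inv h) \<otimes> h = k"
          using hG k by (simp add: m_assoc[symmetric]) (simp add: m_assoc)
        finally show "x (inv (h \<otimes> g) \<otimes> inv k \<otimes> (h \<otimes> g)) = x (inv g \<otimes> k \<otimes> g)" by simp
      qed
      finally show ?thesis using c[OF k] by simp
    qed
  qed
  then have "adjoint (e \<star> c \<star> e) = e \<star> c \<star> e" by (simp add: adjoint_conv e(2) conv_assoc)
  then have "fun_smul \<mu> (adjoint x) = fun_smul \<mu> x" by (simp add: ece adjoint_smul)
  then show ?thesis using \<open>\<mu> \<noteq> 0\<close> fn.scale_left_imp_eq by blast
qed

text \<open>The value p(y) in the corner algebra with unit \<open>e\<close>: the zeroth power of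
  \<open>y\<close> is \<open>e\<close>.\<close>

definition poly_conv :: "('a \<Rightarrow> 'k::field) \<Rightarrow> ('a \<Rightarrow> 'k) \<Rightarrow> 'k poly \<Rightarrow> 'a \<Rightarrow> 'k" where
  "poly_conv e y p = (\<Sum>i\<le>degree p. fun_smul (coeff p i) (((\<star>) y ^^ i) e))"

lemma poly_conv_eq:
  assumes "degree p \<le> n"
  shows "poly_conv e y p = (\<Sum>i\<le>n. fun_smul (coeff p i) (((\<star>) y ^^ i) e))"
  unfolding poly_conv_def
  by (rule sum.mono_neutral_left) (use assms in \<open>auto simp: coeff_eq_0 simp del: zero_fun_def\<close>)

lemma poly_conv_linear_factor:
  "poly_conv e y ([:- c, 1:] * q) = y \<star> poly_conv e y q - fun_smul c (poly_conv e y q)"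
proof -
  let ?n = "Suc (degree q)" and ?y = "\<lambda>i. ((\<star>) y ^^ i) e"
  have "degree ([:- c, 1:] * q) \<le> ?n"
    using degree_mult_le[of "[:- c, 1:]" q] by simp
  then have "poly_conv e y ([:- c, 1:] * q) = (\<Sum>i\<le>?n. fun_smul (coeff ([:- c, 1:] * q) i) (?y i))"
    by (rule poly_conv_eq)
  also have eq: "[:- c, 1:] * q = pCons 0 q - smult c q" by simp
  also have "(\<Sum>i\<le>?n. fun_smul (coeff (pCons 0 q - smult c q) i) (?y i)) =
      (\<Sum>i\<le>?n. fun_smul (coeff (pCons 0 q) i) (?y i)) - (\<Sum>i\<le>?n. fun_smul c (fun_smul (coeff q i) (?y i)))"
    unfolding sum_subtractf[symmetric]
    by (rule sum.cong) (auto simp: fn.scale_left_diff_distrib[symmetric])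
  also have "(\<Sum>i\<le>?n. fun_smul (coeff (pCons 0 q) i) (?y i)) = (\<Sum>i\<le>degree q. fun_smul (coeff q i) (?y (Suc i)))"
    by (subst sum.atMost_Suc_shift) (simp del: zero_fun_def)
  also have "\<dots> = y \<star> poly_conv e y q"
    by (simp add: poly_conv_def conv_sum_right conv_smul_right)
  also have "(\<Sum>i\<le>?n. fun_smul c (fun_smul (coeff q i) (?y i))) = fun_smul c (poly_conv e y q)"
    by (simp only: poly_conv_eq[of q ?n e y, OF le_SucI[OF order_refl]] fn.scale_sum_right)
  finally show ?thesis by (simp only: eq)
qed


text \<open>By \<open>primitive_simple\<close> the corner has no zero divisors. Being
  finite-dimensional, it contains for each y a nonzero polynomial relation p(y) = 0; over an
  algebraically closed field linear factors can be split off from p until one of them, y - c e,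
  vanishes. So y is a multiple of \<open>e\<close>.\<close>

lemma commutative_corner_split:
  fixes e :: "'a \<Rightarrow> 'k::alg_closed_field"
  assumes H: "subgroup H G" and nz: "of_nat (card H) \<noteq> (0::'k)" and e: "primitive H e"
    and comm: "\<And>x y. x \<in> supported H \<Longrightarrow> y \<in> supported H \<Longrightarrow> e \<star> x = x \<Longrightarrow> x \<star> e = x \<Longrightarrow>
      e \<star> y = y \<Longrightarrow> y \<star> e = y \<Longrightarrow> x \<star> y = y \<star> x"
  shows "split_idempotent H e"
proof -
  have HG: "H \<subseteq> carrier G" using H by (rule subgroup.subset)
  have fH: "finite H" using HG finite_carrier by (rule finite_subset)
  have e': "e \<in> supported H" "e \<star> e = e" "e \<noteq> 0" using e by (auto simp: primitive_def)
  let ?B = "{x \<in> supported H. e \<star> x = x \<and> x \<star> e = x}"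
  have nodiv: "z = 0" if y: "y \<in> ?B" "y \<noteq> 0" and z: "z \<in> ?B" "y \<star> z = 0" for y z
  proof -
    obtain a where "a \<star> y = e" using primitive_simple[OF H nz e _ _ y(2)] y(1) by blast
    then have "e \<star> z = a \<star> (y \<star> z)" by (simp add: conv_assoc[symmetric])
    also have "\<dots> = 0" using z(2) conv_zero_right by metis
    finally show ?thesis using z(1) by simp
  qed
  have scalar: "\<exists>c. y = fun_smul c e" if y: "y \<in> ?B" for y
  proof -
    let ?y = "\<lambda>i. ((\<star>) y ^^ i) e"
    have yB: "?y i \<in> ?B" for i
    proof (induction i)
      case 0
      then show ?case using e' by simp
    next
      case (Suc i)
      let ?w = "?y i"
      have "e \<star> (y \<star> ?w) = (e \<star> y) \<star> ?w" "(y \<star> ?w) \<star> e = y \<star> (?w \<star> e)"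
        by (simp_all only: conv_assoc)
      moreover have "y \<star> ?w \<in> supported H"
        by (rule conv_supported_subgroup[OF H]) (use y Suc in auto)
      ultimately show ?case using y Suc by simp
    qed
    have subB: "fn.subspace ?B"
      using subspace_supported[of H]
      by (auto simp: fn.subspace_def conv_add_left conv_add_right conv_smul_left conv_smul_right
          conv_zero_left conv_zero_right simp del: zero_fun_def)
    have pB: "poly_conv e y p \<in> ?B" for p
      unfolding poly_conv_def by (intro fn.subspace_sum[OF subB] fn.subspace_scale[OF subB] yB)
    have "\<exists>p. p \<noteq> 0 \<and> poly_conv e y p = 0"
    \<comment> \<open>Dependence is a property of the set of powers, so two coinciding powers have
      to be treated separately; they give a difference of monomials.\<close>
    proof (cases "inj_on ?y {..card H}")
      case False
      then obtain i j where ij: "i \<le> card H" "j \<le> card H" "i \<noteq> j" "?y i = ?y j"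
        unfolding inj_on_def by auto
      let ?p = "monom 1 i - monom 1 j :: 'k poly"
      have "coeff ?p i = 1" using ij(3) by simp
      then have "?p \<noteq> 0" by (metis coeff_0 zero_neq_one)
      have dp: "degree ?p \<le> card H"
        using ij by (intro degree_diff_le) (auto intro: order_trans[OF degree_monom_le])
      have "poly_conv e y ?p = (\<Sum>l\<le>card H. (if l = i then ?y l else 0) - (if l = j then ?y l else 0))"
        unfolding poly_conv_eq[OF dp] using ij(3) by (intro sum.cong) auto
      also have "\<dots> = ?y i - ?y j" using ij(1,2) by (simp add: sum_subtractf)
      also have "\<dots> = 0" using ij(4) by simp
      finally show ?thesis using \<open>?p \<noteq> 0\<close> by blast
    next
      case inj: True
      let ?S = "?y ` {..card H}"
      have "?S \<subseteq> fn.span (delta ` H)" using yB span_delta[OF fH] by blast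
      moreover have "card (delta ` H :: ('a \<Rightarrow> 'k) set) < card ?S"
        using card_image[OF inj] card_image_le[OF fH, of "delta :: 'a \<Rightarrow> 'a \<Rightarrow> 'k"] by simp
      ultimately have "\<not> fn.independent ?S"
        using fn.independent_span_bound[of "delta ` H" ?S] fH by auto
      then obtain u v where u: "v \<in> ?S" "u v \<noteq> 0" "(\<Sum>v\<in>?S. fun_smul (u v) v) = 0"
        using fn.dependent_finite[of ?S] by auto
      obtain i where i: "i \<le> card H" "v = ?y i" using u(1) by auto
      let ?p = "\<Sum>l\<le>card H. monom (u (?y l)) l"
      have cp: "coeff ?p l = (if l \<le> card H then u (?y l) else 0)" for l
        by (simp add: coeff_sum)
      have "?p \<noteq> 0" using cp[of i] i u(2) by (metis coeff_0)
      have dp: "degree ?p \<le> card H" using cp by (intro degree_le) auto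
      have "poly_conv e y ?p = (\<Sum>l\<le>card H. fun_smul (u (?y l)) (?y l))"
        unfolding poly_conv_eq[OF dp] using cp by (intro sum.cong) auto
      also have "\<dots> = (\<Sum>v\<in>?S. fun_smul (u v) v)"
        by (subst sum.reindex[OF inj]) (simp add: comp_def)
      also have "\<dots> = 0" by (rule u(3))
      finally show ?thesis using \<open>?p \<noteq> 0\<close> by blast
    qed
    then obtain p where "p \<noteq> 0" "poly_conv e y p = 0" by blast
    then show ?thesis
    proof (induction "degree p" arbitrary: p)
      case 0
      then obtain a where a: "p = [:a:]" "a \<noteq> 0" by (metis degree_eq_zeroE pCons_0_0)
      have "fun_smul a e = poly_conv e y p" by (simp add: poly_conv_def a(1))
      also note 0(3)
      finally have "fun_smul a e = 0" .
      then show ?case using a(2) e'(3) fn.scale_eq_0_iff by blast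
    next
      case (Suc n)
      then obtain c where "poly p c = 0" using alg_closed_imp_poly_has_root[of p] by auto
      then obtain q where q: "p = [:- c, 1:] * q" unfolding poly_eq_0_iff_dvd by blast
      have q0: "q \<noteq> 0" using q Suc.prems(1) by auto
      have dq: "n = degree q"
        using Suc.hyps(2) q0 unfolding q by (subst (asm) degree_mult_eq) auto
      let ?z = "y - fun_smul c e"
      have zB: "?z \<in> ?B"
        using y e' by (intro fn.subspace_diff[OF subB] fn.subspace_scale[OF subB]) auto
      have "?z \<star> poly_conv e y q = y \<star> poly_conv e y q - fun_smul c (e \<star> poly_conv e y q)"
        by (simp only: conv_diff_left conv_smul_left)
      also have "e \<star> poly_conv e y q = poly_conv e y q" using pB[of q] by blast
      also have "y \<star> poly_conv e y q - fun_smul c (poly_conv e y q) = 0"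
        using Suc.prems(2) unfolding q poly_conv_linear_factor .
      finally have prod: "?z \<star> poly_conv e y q = 0" .
      show ?case
      proof (cases "?z = 0")
        case True
        then have "y = fun_smul c e" by (rule right_minus_eq[THEN iffD1])
        then show ?thesis by blast
      next
        case False
        have "poly_conv e y q = 0" using nodiv[OF zB False pB prod] .
        then show ?thesis using Suc.hyps(1)[OF dq q0] by blast
      qed
    qed
  qed
  have "e \<star> x \<star> e \<in> ?B" if x: "x \<in> supported H" for x
  proof -
    have "e \<star> x \<star> e \<in> supported H" by (intro conv_supported_subgroup[OF H] e'(1) x)
    moreover have "e \<star> (e \<star> x \<star> e) = (e \<star> e) \<star> x \<star> e" "(e \<star> x \<star> e) \<star> e = e \<star> x \<star> (e \<star> e)"
      by (simp_all only: conv_assoc)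
    ultimately show ?thesis using e'(2) by simp
  qed
  then have "\<forall>x\<in>supported H. \<exists>c. e \<star> x \<star> e = fun_smul c e" using scalar by blast
  then show ?thesis unfolding split_idempotent_def using e' by blast
qed

section \<open>Self-adjoint systems along a chain of subgroups\<close>

definition self_adjoint_split_system :: "'a set \<Rightarrow> ('a \<Rightarrow> 'k::field) set \<Rightarrow> bool" where
  "self_adjoint_split_system H E \<longleftrightarrow>
     idempotent_system H E \<and> (\<forall>e\<in>E. split_idempotent H e \<and> adjoint e = e)"

text \<open>Each primitive idempotent of the refinement lies below a split self-adjoint idempotent
  for \<open>H\<close>, so \<open>adjoint_corner\<close> shows that the anti-involution fixes its
  corner pointwise. Products in the corner are again fixed, which gives x y = y x, because the
  anti-involution reverses products. \<open>commutative_corner_split\<close> then applies.\<close>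

lemma self_adjoint_split_system_step:
  fixes E :: "('a \<Rightarrow> 'k::alg_closed_field) set"
  assumes H: "subgroup H G" and K: "subgroup K G" and HK: "H \<subseteq> K"
    and nz: "of_nat (card K) \<noteq> (0::'k)"
    and rev: "\<And>g. g \<in> K \<Longrightarrow> \<exists>h\<in>H. h \<otimes> g \<otimes> inv h = inv g"
    and E: "self_adjoint_split_system H E"
  shows "\<exists>E' :: ('a \<Rightarrow> 'k) set. self_adjoint_split_system K E'"
proof -
  have KG: "K \<subseteq> carrier G" using K by (rule subgroup.subset)
  have "idempotent_system K E"
    using E supported_mono[OF HK] by (auto simp: self_adjoint_split_system_def idempotent_system_def)
  then obtain E' where E': "idempotent_system K E'" "\<And>e. e \<in> E' \<Longrightarrow> primitive K e"
      "\<And>e. e \<in> E' \<Longrightarrow> \<exists>e0\<in>E. e0 \<star> e = e \<and> e \<star> e0 = e"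
    using primitive_refinement_exists[OF _ KG] by blast
  have "split_idempotent K e \<and> adjoint e = e" if e: "e \<in> E'" for e
  proof -
    obtain e0 where e0: "e0 \<in> E" "e0 \<star> e = e" "e \<star> e0 = e" using E'(3)[OF e] by blast
    have sa: "adjoint x = x" if x: "x \<in> supported K" "e \<star> x = x" "x \<star> e = x" for x
    proof (rule adjoint_corner[OF H K HK rev])
      show "split_idempotent H e0" "adjoint e0 = e0"
        using E e0(1) by (auto simp: self_adjoint_split_system_def)
      show "e0 \<star> x = x" using x(2) e0(2) by (metis conv_assoc)
      show "x \<star> e0 = x" using x(3) e0(3) by (metis conv_assoc)
    qed (use x in auto)
    have "split_idempotent K e"
    proof (rule commutative_corner_split[OF K nz E'(2)[OF e]])
      fix x y assume x: "x \<in> supported K" "e \<star> x = x" "x \<star> e = x"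
        and y: "y \<in> supported K" "e \<star> y = y" "y \<star> e = y"
      have "adjoint (x \<star> y) = x \<star> y"
      proof (rule sa)
        show "x \<star> y \<in> supported K" using K x(1) y(1) by (rule conv_supported_subgroup)
        show "e \<star> (x \<star> y) = x \<star> y" by (simp only: conv_assoc[symmetric] x)
        show "x \<star> y \<star> e = x \<star> y" by (simp only: conv_assoc y)
      qed
      then show "x \<star> y = y \<star> x" by (simp only: adjoint_conv sa[OF x] sa[OF y])
    qed
    moreover have "adjoint e = e" using E'(2)[OF e] by (intro sa) (auto simp: primitive_def)
    ultimately show ?thesis ..
  qed
  then show ?thesis using E'(1) unfolding self_adjoint_split_system_def by blast
qed

lemma self_adjoint_split_system_exists:
  assumes H: "\<And>i. i \<le> m \<Longrightarrow> subgroup (H i) G" "H 0 = {\<one>}" "\<And>i. i < m \<Longrightarrow> H i \<subseteq> H (Suc i)"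
    and nz: "\<And>i. i \<le> m \<Longrightarrow> of_nat (card (H i)) \<noteq> (0::'k::alg_closed_field)"
    and rev: "\<And>i g. i < m \<Longrightarrow> g \<in> H (Suc i) \<Longrightarrow> \<exists>h\<in>H i. h \<otimes> g \<otimes> inv h = inv g"
    and i: "i \<le> m"
  shows "\<exists>E :: ('a \<Rightarrow> 'k) set. self_adjoint_split_system (H i) E"
  using i
proof (induction i)
  case 0
  have d: "delta \<one> \<star> x = x" if "x \<in> supported {\<one>}" for x :: "'a \<Rightarrow> 'k"
    using that supported_mono[of "{\<one>}" "carrier G"] by (auto intro: one_conv)
  have "delta \<one> \<noteq> (0 :: 'a \<Rightarrow> 'k)" by (auto simp: delta_def fun_eq_iff)
  moreover have "\<exists>c. delta \<one> \<star> x \<star> delta \<one> = fun_smul c (delta \<one>)" if x: "x \<in> supported {\<one>}" for x :: "'a \<Rightarrow> 'k"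
  proof -
    have "x = fun_smul (x \<one>) (delta \<one>)"
      using supported_expand[OF _ x] by simp
    then have "delta \<one> \<star> x \<star> delta \<one> = fun_smul (x \<one>) (delta \<one>)"
      using d[OF x] d[OF delta_supported] by (metis conv_smul_left singletonI)
    then show ?thesis by blast
  qed
  ultimately have "self_adjoint_split_system (H 0) {delta \<one> :: 'a \<Rightarrow> 'k}"
    using d[OF delta_supported] delta_supported[of \<one> "{\<one>}"]
    by (simp add: self_adjoint_split_system_def idempotent_system_def split_idempotent_def adjoint_one H(2)
        del: zero_fun_def)
  then show ?case by blast
next
  case (Suc i)
  then obtain E :: "('a \<Rightarrow> 'k) set" where "self_adjoint_split_system (H i) E" by auto
  then show ?case
    using Suc.prems H nz rev by (intro self_adjoint_split_system_step[of "H i" "H (Suc i)"]) auto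
qed

end

section \<open>Counting self-adjoint elements\<close>

context vector_space
begin

lemma independent_Un_disjoint_spans:
  assumes B: "finite B" "independent B" and C: "finite C" "independent C" and BC: "span B \<inter> span C = {0}"
  shows "independent (B \<union> C)" "B \<inter> C = {}"
proof -
  show disj: "B \<inter> C = {}"
  proof (rule ccontr)
    assume "B \<inter> C \<noteq> {}"
    then obtain x where x: "x \<in> B" "x \<in> C" by blast
    then have "x \<in> span B \<inter> span C" by (simp add: span_base)
    then have "0 \<in> B" using BC x(1) by simp
    then show False using B(2) dependent_zero by blast
  qed
  show "independent (B \<union> C)"
  proof (rule independent_if_scalars_zero)
    fix f x assume 0: "(\<Sum>x\<in>B \<union> C. scale (f x) x) = 0" and x: "x \<in> B \<union> C"
    let ?b = "\<Sum>x\<in>B. scale (f x) x" and ?c = "\<Sum>x\<in>C. scale (f x) x"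
    have "?b + ?c = 0" using 0 B(1) C(1) disj by (simp add: sum.union_disjoint)
    then have "?b = - ?c" by (rule eq_neg_iff_add_eq_0[THEN iffD2])
    moreover have bc: "?b \<in> span B" "?c \<in> span C"
      by (auto intro!: span_sum span_scale intro: span_base)
    ultimately have "?b \<in> span B \<inter> span C" using span_neg[OF bc(2)] by simp
    then have b0: "?b = 0" using BC by simp
    then have c0: "?c = 0" using \<open>?b + ?c = 0\<close> by simp
    show "f x = 0"
      using x independentD[OF B(2,1) order_refl b0] independentD[OF C(2,1) order_refl c0] by blast
  qed (use B(1) C(1) in simp)
qed

lemma dim_direct_sum:
  assumes X: "subspace X" "X \<subseteq> span S" and Y: "subspace Y" "Y \<subseteq> span S" and S: "finite S" and XY: "X \<inter> Y = {0}"
  shows "dim (span (X \<union> Y)) = dim X + dim Y"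
proof -
  obtain B where B: "B \<subseteq> X" "independent B" "X \<subseteq> span B" "card B = dim X" by (rule basis_exists)
  obtain C where C: "C \<subseteq> Y" "independent C" "Y \<subseteq> span C" "card C = dim Y" by (rule basis_exists)
  have "finite B" "finite C"
    using independent_span_bound[OF S B(2)] independent_span_bound[OF S C(2)] B(1) C(1) X(2) Y(2) by auto
  moreover have sp: "span B = X" "span C = Y"
    using span_subspace[OF B(1,3) X(1)] span_subspace[OF C(1,3) Y(1)] by auto
  ultimately have "independent (B \<union> C)" "B \<inter> C = {}"
    using independent_Un_disjoint_spans[of B C] B(2) C(2) XY by auto
  moreover have "span (X \<union> Y) = span (B \<union> C)"
    using sp by (simp add: span_Un span_eq_iff[THEN iffD2, OF X(1)] span_eq_iff[THEN iffD2, OF Y(1)])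
  ultimately show ?thesis
    using B(4) C(4) card_Un_disjoint[OF \<open>finite B\<close> \<open>finite C\<close>] dim_span_eq_card_independent[of "B \<union> C"]
    by simp
qed

end

context finite_group
begin

text \<open>The hypotheses say that \<open>A = U \<oplus> D \<oplus> U\<^sup>*\<close>, with \<open>D\<close> fixed by the adjunction.\<close>

lemma dim_self_adjoint:
  fixes U D :: "('a \<Rightarrow> 'k::field) set"
  defines "A \<equiv> supported (carrier G) :: ('a \<Rightarrow> 'k) set"
  assumes U: "fn.subspace U" "U \<subseteq> A" and D: "fn.subspace D" "D \<subseteq> A"
    and dec: "\<And>x. x \<in> A \<Longrightarrow> \<exists>u\<in>U. \<exists>d\<in>D. \<exists>u'\<in>U. x = u + d + adjoint u'"
    and uniq: "\<And>u d u'. u \<in> U \<Longrightarrow> d \<in> D \<Longrightarrow> u' \<in> U \<Longrightarrow> u + d + adjoint u' = 0 \<Longrightarrow> u = 0"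
    and self: "\<And>d. d \<in> D \<Longrightarrow> adjoint d = d"
  shows "fn.dim A + fn.dim D = 2 * fn.dim {x \<in> A. adjoint x = x}"
proof -
  \<comment> \<open>Let S be the self-adjoint elements and T the elements of the form u + adjoint u.
    Then A = U \<oplus> S and S = D \<oplus> T with T isomorphic to U, and the claim follows by
    eliminating the dimension of U. No division by 2 occurs, so characteristic 2 is covered.\<close>
  let ?S = "{x \<in> A. adjoint x = x}"
  let ?t = "\<lambda>u. u + adjoint u" let ?T = "?t ` U"
  note adj = fn2.linear_add[OF linear_adjoint] fn2.linear_diff[OF linear_adjoint] fn2.linear_0[OF linear_adjoint]
    fn2.linear_neg[OF linear_adjoint]
  have AA: "adjoint (adjoint x) = x" if "x \<in> A" for x using that unfolding A_def by (rule adjoint_adjoint)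
  have fin: "finite (delta ` carrier G)" "A = fn.span (delta ` carrier G)"
    using finite_carrier span_delta[OF finite_carrier] by (auto simp: A_def)
  have sA: "fn.subspace A" unfolding A_def by (rule subspace_supported)
  have adjA: "adjoint x \<in> A" for x unfolding A_def by (rule adjoint_supported)
  have sS: "fn.subspace ?S"
    using sA unfolding fn.subspace_def by (simp add: adj adjoint_smul del: zero_fun_def)
  have lt: "Vector_Spaces.linear fun_smul fun_smul ?t"
    by (intro fn2.linear_compose_add linear_adjoint fn.linear_ident)
  have sT: "fn.subspace ?T" using lt U(1) by (rule fn2.linear_subspace_image)
  have TS: "?T \<subseteq> ?S"
  proof (rule image_subsetI)
    fix u assume "u \<in> U"
    then have u: "u \<in> A" using U(2) by blast
    then have "?t u \<in> A" using sA adjA by (intro fn.subspace_add)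
    moreover have "adjoint (?t u) = ?t u" by (simp only: adj AA[OF u] add.commute)
    ultimately show "?t u \<in> ?S" by simp
  qed
  have z: "0 \<in> U" "0 \<in> D" "0 \<in> ?T" "0 \<in> ?S" using U(1) D(1) sT sS fn.subspace_0 by blast+
  have US: "U \<inter> ?S = {0}"
  proof -
    have "u = 0" if u: "u \<in> U" "adjoint u = u" for u
    proof (rule uniq[OF u(1) z(2) fn.subspace_neg[OF U(1) u(1)]])
      show "u + 0 + adjoint (- u) = 0" by (simp only: adj u(2) add_0_right right_minus)
    qed
    then show ?thesis using z by blast
  qed
  have DT: "D \<inter> ?T = {0}"
  proof -
    have "?t u = 0" if u: "u \<in> U" "?t u \<in> D" for u
    proof -
      have "u + (- ?t u) + adjoint u = 0" by (simp add: algebra_simps)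
      then have "u = 0" by (rule uniq[OF u(1) fn.subspace_neg[OF D(1) u(2)] u(1)])
      then show ?thesis by (simp only: adj add_0_right)
    qed
    then show ?thesis using z by blast
  qed
  have "A \<subseteq> fn.span (U \<union> ?S)"
  proof
    fix x assume "x \<in> A"
    then obtain u d u' where x: "u \<in> U" "d \<in> D" "u' \<in> U" "x = u + d + adjoint u'" using dec by blast
    have "d \<in> ?S" using x(2) D(2) self by auto
    moreover have "?t u' \<in> ?S" using TS x(3) by blast
    ultimately have "d + ?t u' \<in> ?S" using sS by (rule fn.subspace_add[rotated])
    moreover have "u - u' \<in> U" using U(1) x(1,3) by (rule fn.subspace_diff)
    ultimately have "(u - u') + (d + ?t u') \<in> fn.span (U \<union> ?S)"
      by (intro fn.span_add[OF fn.span_base fn.span_base] UnI1 UnI2)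
    moreover have "(u - u') + (d + ?t u') = x" unfolding x(4) by (simp add: algebra_simps)
    ultimately show "x \<in> fn.span (U \<union> ?S)" by (simp only:)
  qed
  moreover have "fn.span (U \<union> ?S) \<subseteq> A" using U(2) sA by (intro fn.span_minimal) auto
  ultimately have "A = fn.span (U \<union> ?S)" by (rule subset_antisym)
  then have "fn.dim A = fn.dim (fn.span (U \<union> ?S))" by (rule arg_cong)
  also have "\<dots> = fn.dim U + fn.dim ?S"
    using U sS fin US by (intro fn.dim_direct_sum[of _ "delta ` carrier G"]) auto
  finally have 1: "fn.dim A = fn.dim U + fn.dim ?S" .
  have "?S \<subseteq> fn.span (D \<union> ?T)"
  proof
    fix x assume x: "x \<in> ?S"
    then obtain u d u' where u: "u \<in> U" "d \<in> D" "u' \<in> U" "x = u + d + adjoint u'" using dec by blast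
    have "adjoint x = adjoint u + d + u'" unfolding u(4) using u U(2) self by (auto simp: adj AA)
    moreover have "adjoint x = x" using x by simp
    ultimately have "u + d + adjoint u' - (adjoint u + d + u') = 0" unfolding u(4)[symmetric] by simp
    then have "(u - u') + 0 + adjoint (u' - u) = 0" by (simp add: adj algebra_simps)
    then have "u - u' = 0"
      by (rule uniq[OF fn.subspace_diff[OF U(1) u(1,3)] z(2) fn.subspace_diff[OF U(1) u(3,1)]])
    then have "x = d + ?t u" using u(4) by (simp add: algebra_simps)
    moreover have "d + ?t u \<in> fn.span (D \<union> ?T)"
      using u(1,2) by (intro fn.span_add[OF fn.span_base fn.span_base] UnI1 UnI2 imageI)
    ultimately show "x \<in> fn.span (D \<union> ?T)" by (simp only:)
  qed
  moreover have "fn.span (D \<union> ?T) \<subseteq> ?S"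
    using D(2) self TS sS by (intro fn.span_minimal) auto
  ultimately have "?S = fn.span (D \<union> ?T)" by (rule subset_antisym)
  then have "fn.dim ?S = fn.dim (fn.span (D \<union> ?T))" by (rule arg_cong)
  also have "\<dots> = fn.dim D + fn.dim ?T"
    using D sT TS fin DT by (intro fn.dim_direct_sum[of _ "delta ` carrier G"]) auto
  also have "fn.dim ?T = fn.dim U"
  proof -
    obtain B where B: "B \<subseteq> U" "fn.independent B" "U \<subseteq> fn.span B" "card B = fn.dim U"
      by (rule fn.basis_exists)
    have sp: "fn.span B = U" using B(1,3) U(1) by (rule fn.span_subspace)
    have inj: "inj_on ?t U"
      unfolding fn2.linear_inj_on_iff_eq_0[OF lt U(1)]
    proof (intro ballI impI)
      fix u assume u: "u \<in> U" "?t u = 0"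
      then show "u = 0" using uniq[OF u(1) z(2) u(1)] by simp
    qed
    have "fn.independent (?t ` B)"
      using fn2.linear_independent_injective_image[OF lt B(2)] inj sp by simp
    moreover have "fn.span (?t ` B) = ?T" unfolding fn2.linear_span_image[OF lt] sp ..
    ultimately have "fn.dim ?T = card (?t ` B)" using fn.dim_span_eq_card_independent by fastforce
    also have "\<dots> = card B" using inj_on_subset[OF inj B(1)] by (rule card_image)
    finally show ?thesis using B(4) by simp
  qed
  finally show ?thesis using 1 by simp
qed


text \<open>An injection into the naturals selects one element from each pair of distinct mutually
  inverse elements. With L the selected elements and I the elements of square 1, the algebra is the
  direct sum of kL, kI and the adjoint of kL.\<close>

lemma dim_involutions:
  "card (carrier G) + card {g \<in> carrier G. g \<otimes> g = \<one>} =
    2 * fn.dim {x \<in> supported (carrier G) :: ('a \<Rightarrow> 'k::field) set. adjoint x = x}"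
proof -
  obtain \<iota> :: "'a \<Rightarrow> nat" where \<iota>: "inj_on \<iota> (carrier G)"
    using finite_imp_inj_to_nat_seg[OF finite_carrier] by blast
  have inv_iff: "inv g = g \<longleftrightarrow> g \<otimes> g = \<one>" if "g \<in> carrier G" for g
    using that by (metis inv_equality r_inv)
  let ?A = "supported (carrier G) :: ('a \<Rightarrow> 'k) set"
  let ?L = "{g \<in> carrier G. \<iota> g < \<iota> (inv g)}" and ?I = "{g \<in> carrier G. g \<otimes> g = \<one>}"
  have "fn.dim ?A + fn.dim (supported ?I :: ('a \<Rightarrow> 'k) set) = 2 * fn.dim {x \<in> ?A. adjoint x = x}"
  proof (rule dim_self_adjoint)
    show "fn.subspace (supported ?L)" "fn.subspace (supported ?I)" by (rule subspace_supported)+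
    show "supported ?L \<subseteq> ?A" "supported ?I \<subseteq> ?A" by (rule supported_mono; blast)+
    show "adjoint d = d" if "d \<in> supported ?I" for d :: "'a \<Rightarrow> 'k"
    proof
      fix g
      show "adjoint d g = d g"
      proof (cases "g \<in> carrier G \<and> g \<otimes> g = \<one>")
        case True
        then show ?thesis using inv_iff[of g] by (simp add: adjoint_def)
      next
        case False
        moreover have "inv g \<otimes> inv g \<noteq> \<one>" if "g \<in> carrier G"
        proof
          assume "inv g \<otimes> inv g = \<one>"
          then have "inv (g \<otimes> g) = \<one>" using that by (simp add: inv_mult_group)
          then show False using False that by (simp add: inv_eq_1_iff)
        qed
        ultimately show ?thesis using \<open>d \<in> supported ?I\<close> by (auto simp: adjoint_def supported_def)
      qed
    qed
    fix x :: "'a \<Rightarrow> 'k" assume x: "x \<in> ?A"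
    let ?u = "\<lambda>g. if g \<in> ?L then x g else 0" and ?d = "\<lambda>g. if g \<in> ?I then x g else 0"
      and ?u' = "\<lambda>g. if g \<in> ?L then x (inv g) else 0"
    have "x = ?u + ?d + adjoint ?u'"
    proof
      fix g
      show "x g = (?u + ?d + adjoint ?u') g"
      proof (cases "g \<in> carrier G")
        case g: True
        have "\<iota> g = \<iota> (inv g) \<longleftrightarrow> g \<otimes> g = \<one>"
          using inv_iff[OF g] inj_on_eq_iff[OF \<iota> g inv_closed[OF g]] by auto
        then show ?thesis using g by (auto simp: adjoint_def)
      qed (use x in \<open>auto simp: supported_def adjoint_def\<close>)
    qed
    moreover have "?u \<in> supported ?L" "?d \<in> supported ?I" "?u' \<in> supported ?L"
      by (auto simp: supported_def)
    ultimately show "\<exists>u\<in>supported ?L. \<exists>d\<in>supported ?I. \<exists>u'\<in>supported ?L. x = u + d + adjoint u'"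
      by blast
  next
    fix u d u' :: "'a \<Rightarrow> 'k"
    assume u: "u \<in> supported ?L" and d: "d \<in> supported ?I" and u': "u' \<in> supported ?L"
      and 0: "u + d + adjoint u' = 0"
    show "u = 0"
    proof
      fix g
      show "u g = 0 g"
      proof (cases "g \<in> ?L")
        case True
        then have "d g = 0" "u' (inv g) = 0"
          using d u' inv_iff[of g] by (auto simp: supported_def)
        moreover have "u g + d g + adjoint u' g = 0" using fun_cong[OF 0, of g] by simp
        ultimately show ?thesis using True by (simp add: adjoint_def)
      qed (use u in \<open>simp add: supported_def\<close>)
    qed
  qed
  then show ?thesis using finite_carrier by (simp add: dim_supported)
qed

text \<open>In the Peirce decomposition into the spaces e A f, the anti-involution interchanges e A
  f and f A e. The diagonal part is the span of \<open>E\<close>, because the corners are scalar. So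
  \<open>dim_self_adjoint\<close> gives |G| + |E| for twice the dimension of the self-adjoint
  elements, while \<open>dim_involutions\<close> gives |G| plus the number of elements of square
  1.\<close>

lemma card_self_adjoint_split_system:
  fixes E :: "('a \<Rightarrow> 'k::field) set"
  assumes "self_adjoint_split_system (carrier G) E"
  shows "card E = card {g \<in> carrier G. g \<otimes> g = \<one>}"
proof -
  have sys: "idempotent_system (carrier G) E" and split: "\<And>e. e \<in> E \<Longrightarrow> split_idempotent (carrier G) e"
    and sa: "\<And>e. e \<in> E \<Longrightarrow> adjoint e = e"
    using assms by (auto simp: self_adjoint_split_system_def)
  have E: "finite E" "E \<subseteq> supported (carrier G)" "\<And>e. e \<in> E \<Longrightarrow> e \<star> e = e"
      "\<And>e f. e \<in> E \<Longrightarrow> f \<in> E \<Longrightarrow> e \<noteq> f \<Longrightarrow> e \<star> f = 0" "\<Sum>E = delta \<one>"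
    using sys by (auto simp: idempotent_system_def)
  obtain \<iota> :: "('a \<Rightarrow> 'k) \<Rightarrow> nat" where \<iota>: "inj_on \<iota> E"
    using finite_imp_inj_to_nat_seg[OF E(1)] by blast
  let ?A = "supported (carrier G) :: ('a \<Rightarrow> 'k) set"
  \<comment> \<open>The strictly upper triangular part with respect to the order that
    \<open>\<iota>\<close> puts on \<open>E\<close>.\<close>
  let ?U = "{x \<in> ?A. \<forall>e\<in>E. \<forall>f\<in>E. \<not> \<iota> e < \<iota> f \<longrightarrow> e \<star> x \<star> f = 0}"
  have peirce: "x = (\<Sum>e\<in>E. \<Sum>f\<in>E. e \<star> x \<star> f)" if x: "x \<in> ?A" for x
  proof -
    have "x = \<Sum>E \<star> x \<star> \<Sum>E" by (simp only: E(5) one_conv[OF x] conv_one[OF x])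
    then have "x = (\<Sum>f\<in>E. \<Sum>e\<in>E. e \<star> x \<star> f)" by (simp only: conv_sum_left conv_sum_right)
    then show ?thesis by (rule trans[OF _ sum.swap])
  qed
  have corner: "e' \<star> (e \<star> x \<star> f) \<star> f' = (if e' = e \<and> f' = f then e \<star> x \<star> f else 0)"
    if "e \<in> E" "f \<in> E" "e' \<in> E" "f' \<in> E" for e f e' f' x
  proof -
    have "e' \<star> (e \<star> x \<star> f) \<star> f' = (e' \<star> e) \<star> x \<star> (f \<star> f')" by (simp only: conv_assoc)
    also have "e' \<star> e = (if e' = e then e else 0)" using E(3,4) that by auto
    also have "f \<star> f' = (if f' = f then f else 0)" using E(3,4) that by auto
    finally show ?thesis by (simp add: conv_zero_left conv_zero_right del: zero_fun_def)
  qed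
  have adj: "e \<star> adjoint x \<star> f = adjoint (f \<star> x \<star> e)" if "e \<in> E" "f \<in> E" for e f x
    using that by (simp only: adjoint_conv sa conv_assoc)
  have sA: "fn.subspace ?A" by (rule subspace_supported)
  have adj0: "adjoint 0 = (0 :: 'a \<Rightarrow> 'k)" by (rule fn2.linear_0[OF linear_adjoint])
  have "fn.dim ?A + fn.dim (fn.span E) = 2 * fn.dim {x \<in> ?A. adjoint x = x}"
  proof (rule dim_self_adjoint)
    show "fn.subspace ?U"
      using sA unfolding fn.subspace_def
      by (simp add: conv_add_left conv_add_right conv_smul_left conv_smul_right
          conv_zero_left conv_zero_right del: zero_fun_def)
    show "?U \<subseteq> ?A" by blast
    show "fn.subspace (fn.span E)" by simp
    show "fn.span E \<subseteq> ?A" using E(2) subspace_supported by (rule fn.span_minimal)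
    show "adjoint d = d" if "d \<in> fn.span E" for d
      using linear_adjoint fn.linear_ident that
      by (rule fn2.linear_eq_on) (rule sa)
    fix x assume x: "x \<in> ?A"
    let ?s = "\<lambda>P. \<Sum>(e, f) | (e, f) \<in> E \<times> E \<and> P e f. e \<star> x \<star> f"
    have fin: "finite {(e, f). (e, f) \<in> E \<times> E \<and> P e f}" for P
      by (rule finite_subset[of _ "E \<times> E"]) (use E(1) in auto)
    have sum3: "x = ?s (\<lambda>e f. \<iota> e < \<iota> f) + ?s (\<lambda>e f. e = f) + ?s (\<lambda>e f. \<iota> f < \<iota> e)"
    proof -
      let ?Z = "\<lambda>P. {(e, f). (e, f) \<in> E \<times> E \<and> P e f}" and ?g = "\<lambda>(e, f). e \<star> x \<star> f"
      have tri: "\<iota> e < \<iota> f \<or> e = f \<or> \<iota> f < \<iota> e" if "e \<in> E" "f \<in> E" for e f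
        using inj_onD[OF \<iota> _ that] by linarith
      have eq: "E \<times> E = ?Z (\<lambda>e f. \<iota> e < \<iota> f) \<union> ?Z (\<lambda>e f. e = f) \<union> ?Z (\<lambda>e f. \<iota> f < \<iota> e)"
        using tri by auto
      have "x = sum ?g (E \<times> E)" using peirce[OF x] by (simp add: sum.cartesian_product)
      also have "\<dots> = sum ?g (?Z (\<lambda>e f. \<iota> e < \<iota> f) \<union> ?Z (\<lambda>e f. e = f) \<union> ?Z (\<lambda>e f. \<iota> f < \<iota> e))"
        by (rule arg_cong[OF eq])
      also have "\<dots> = sum ?g (?Z (\<lambda>e f. \<iota> e < \<iota> f) \<union> ?Z (\<lambda>e f. e = f)) + ?s (\<lambda>e f. \<iota> f < \<iota> e)"
        by (intro sum.union_disjoint finite_UnI fin) auto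
      also have "sum ?g (?Z (\<lambda>e f. \<iota> e < \<iota> f) \<union> ?Z (\<lambda>e f. e = f)) = ?s (\<lambda>e f. \<iota> e < \<iota> f) + ?s (\<lambda>e f. e = f)"
        by (intro sum.union_disjoint fin) auto
      finally show ?thesis .
    qed
    have supp: "?s P \<in> ?A" for P
      by (rule fn.subspace_sum[OF subspace_supported]) (auto intro: conv_supported)
    have sandwich: "e' \<star> ?s P \<star> f' = (if P e' f' then e' \<star> x \<star> f' else 0)" if ef: "e' \<in> E" "f' \<in> E" for P e' f'
    proof -
      let ?Z = "{(e, f). (e, f) \<in> E \<times> E \<and> P e f}"
      have "e' \<star> ?s P \<star> f' = (\<Sum>p\<in>?Z. e' \<star> (case p of (e, f) \<Rightarrow> e \<star> x \<star> f) \<star> f')"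
        by (simp only: conv_sum_left conv_sum_right)
      also have "\<dots> = (\<Sum>p\<in>?Z. if p = (e', f') then e' \<star> x \<star> f' else 0)"
      proof (rule sum.cong[OF refl])
        fix p assume "p \<in> ?Z"
        then obtain e f where p: "p = (e, f)" "e \<in> E" "f \<in> E" by blast
        show "e' \<star> (case p of (e, f) \<Rightarrow> e \<star> x \<star> f) \<star> f' = (if p = (e', f') then e' \<star> x \<star> f' else 0)"
          unfolding p(1) prod.case corner[OF p(2,3) ef] by (cases "e' = e \<and> f' = f") auto
      qed
      also have "\<dots> = (if (e', f') \<in> ?Z then e' \<star> x \<star> f' else 0)"
        by (rule sum.delta[OF fin])
      finally show ?thesis using ef by simp
    qed
    let ?u' = "adjoint (?s (\<lambda>e f. \<iota> f < \<iota> e))"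
    have U1: "?s (\<lambda>e f. \<iota> e < \<iota> f) \<in> ?U"
    proof (intro CollectI conjI ballI impI supp)
      fix e f assume "e \<in> E" "f \<in> E" "\<not> \<iota> e < \<iota> f"
      then show "e \<star> ?s (\<lambda>e f. \<iota> e < \<iota> f) \<star> f = 0" by (simp only: sandwich if_False)
    qed
    have U2: "?u' \<in> ?U"
    proof (intro CollectI conjI ballI impI adjoint_supported)
      fix e f assume "e \<in> E" "f \<in> E" "\<not> \<iota> e < \<iota> f"
      then show "e \<star> ?u' \<star> f = 0" by (simp only: adj sandwich if_False adj0)
    qed
    have D: "?s (\<lambda>e f. e = f) \<in> fn.span E"
    proof (rule fn.span_sum)
      fix p assume "p \<in> {(e, f). (e, f) \<in> E \<times> E \<and> e = f}"
      then obtain e where e: "p = (e, e)" "e \<in> E" by blast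
      then obtain c where "e \<star> x \<star> e = fun_smul c e" using split x by (auto simp: split_idempotent_def)
      then show "(case p of (e, f) \<Rightarrow> e \<star> x \<star> f) \<in> fn.span E"
        using e by (simp add: fn.span_scale fn.span_base)
    qed
    have "adjoint ?u' = ?s (\<lambda>e f. \<iota> f < \<iota> e)" by (rule adjoint_adjoint[OF supp])
    then have "x = ?s (\<lambda>e f. \<iota> e < \<iota> f) + ?s (\<lambda>e f. e = f) + adjoint ?u'"
      by (simp only: sum3[symmetric])
    then show "\<exists>u\<in>?U. \<exists>d\<in>fn.span E. \<exists>u'\<in>?U. x = u + d + adjoint u'"
      by (rule bexI[OF bexI[OF bexI[OF _ U2] D] U1])
  next
    fix u d u' assume u: "u \<in> ?U" and d: "d \<in> fn.span E" and u': "u' \<in> ?U" and 0: "u + d + adjoint u' = 0"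
    have "e \<star> u \<star> f = 0" if ef: "e \<in> E" "f \<in> E" for e f
    proof (cases "\<iota> e < \<iota> f")
      case True
      then have "e \<noteq> f" by auto
      have "e \<star> d \<star> f = 0"
      proof (rule fn2.linear_eq_0_on_span[OF _ _ d])
        show "Vector_Spaces.linear fun_smul fun_smul (\<lambda>d. e \<star> d \<star> f)"
          using Vector_Spaces.linear_compose[OF linear_conv_right linear_conv_left] by (simp add: comp_def)
        fix e' assume e': "e' \<in> E"
        show "e \<star> e' \<star> f = 0"
        proof (cases "e' = e")
          case True
          then show ?thesis using E(3)[OF ef(1)] E(4)[OF ef \<open>e \<noteq> f\<close>] by simp
        next
          case False
          then have "e \<star> e' = 0" using E(4)[OF ef(1) e'] by blast
          then show ?thesis by (simp only: conv_zero_left)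
        qed
      qed
      moreover have "f \<star> u' \<star> e = 0" using u' ef True by simp
      then have "e \<star> adjoint u' \<star> f = 0" by (simp only: adj[OF ef] adj0)
      moreover have "e \<star> (u + d + adjoint u') \<star> f = 0" by (simp only: 0 conv_zero_left conv_zero_right)
      ultimately show ?thesis by (simp only: conv_add_left conv_add_right add_0_right)
    qed (use u ef in simp)
    then have "(\<Sum>e\<in>E. \<Sum>f\<in>E. e \<star> u \<star> f) = 0" by (intro sum.neutral ballI)
    moreover have "u \<in> ?A" using u by blast
    ultimately show "u = 0" using peirce by (simp only:)
  qed
  then show ?thesis
    using dim_involutions[where 'k='k] dim_supported[OF finite_carrier, where 'k='k]
      fn.dim_span_eq_card_independent[OF idempotent_system_independent[OF sys]] by simp
qed

end

section \<open>Scalar extension to the algebraic closure\<close>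

context finite_group
begin

lemma to_ac_conv:
  fixes x y :: "'a \<Rightarrow> 'k::field"
  shows "to_ac \<circ> (x \<star> y) = (to_ac \<circ> x) \<star> (to_ac \<circ> y)"
  by (auto simp: conv_def fun_eq_iff to_ac_sum)

text \<open>Over the closure the corner is still spanned by the elements e g e with g in the group,
  and these are multiples of \<open>e\<close> already over the small field.\<close>

lemma to_ac_split_idempotent:
  fixes e :: "'a \<Rightarrow> 'k::field"
  assumes e: "split_idempotent (carrier G) e"
  shows "split_idempotent (carrier G) (to_ac \<circ> e)"
proof -
  have e': "e \<in> supported (carrier G)" "e \<star> e = e" "e \<noteq> 0"
    and corner: "\<And>x. x \<in> supported (carrier G) \<Longrightarrow> \<exists>c. e \<star> x \<star> e = fun_smul c e"
    using e by (auto simp: split_idempotent_def)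
  let ?e = "to_ac \<circ> e"
  have "?e \<star> ?e = ?e" by (simp only: to_ac_conv[symmetric] e')
  moreover have "?e \<noteq> 0" using e'(3) by (auto simp: fun_eq_iff)
  moreover have "?e \<in> supported (carrier G)" using e'(1) by (auto simp: supported_def)
  moreover have "\<exists>c. ?e \<star> x \<star> ?e = fun_smul c ?e" if x: "x \<in> supported (carrier G)" for x
  proof -
    have "\<exists>c. ?e \<star> delta g \<star> ?e = fun_smul c ?e" if g: "g \<in> carrier G" for g
    proof -
      obtain c where c: "e \<star> delta g \<star> e = fun_smul c e" using corner[OF delta_supported[OF g]] by blast
      have "to_ac \<circ> delta g = (delta g :: 'a \<Rightarrow> 'k alg_closure)" by (auto simp: delta_def)
      then have "?e \<star> delta g \<star> ?e = to_ac \<circ> (e \<star> delta g \<star> e)" by (simp only: to_ac_conv)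
      also have "\<dots> = fun_smul (to_ac c) ?e" unfolding c by (auto simp: fun_smul_def)
      finally show ?thesis by blast
    qed
    then have "\<forall>g\<in>carrier G. \<exists>c. ?e \<star> delta g \<star> ?e = fun_smul c ?e" by blast
    from bchoice[OF this] obtain c where c: "\<And>g. g \<in> carrier G \<Longrightarrow> ?e \<star> delta g \<star> ?e = fun_smul (c g) ?e"
      by blast
    have "?e \<star> x \<star> ?e = ?e \<star> (\<Sum>g\<in>carrier G. fun_smul (x g) (delta g)) \<star> ?e"
      using supported_expand[OF finite_carrier x] by (rule arg_cong)
    also have "\<dots> = (\<Sum>g\<in>carrier G. fun_smul (x g) (?e \<star> delta g \<star> ?e))"
      by (simp only: conv_sum_left conv_sum_right conv_smul_left conv_smul_right)
    also have "\<dots> = (\<Sum>g\<in>carrier G. fun_smul (x g * c g) ?e)"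
      by (rule sum.cong) (simp_all only: c fn.scale_scale)
    also have "\<dots> = fun_smul (\<Sum>g\<in>carrier G. x g * c g) ?e" by (simp only: fn.scale_sum_left)
    finally show ?thesis by blast
  qed
  ultimately show ?thesis unfolding split_idempotent_def by blast
qed

lemma to_ac_idempotent_system:
  fixes E :: "('a \<Rightarrow> 'k::field) set"
  assumes "idempotent_system (carrier G) E"
  shows "idempotent_system (carrier G) ((\<lambda>e. to_ac \<circ> e) ` E)" "card ((\<lambda>e. to_ac \<circ> e) ` E) = card E"
proof -
  have E: "finite E" "E \<subseteq> supported (carrier G)" "0 \<notin> E" "\<And>e. e \<in> E \<Longrightarrow> e \<star> e = e"
      "\<And>e f. e \<in> E \<Longrightarrow> f \<in> E \<Longrightarrow> e \<noteq> f \<Longrightarrow> e \<star> f = 0" "\<Sum>E = delta \<one>"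
    using assms by (auto simp: idempotent_system_def)
  have inj: "inj (\<lambda>e :: 'a \<Rightarrow> 'k. to_ac \<circ> e)"
    by (rule injI) (auto simp: fun_eq_iff)
  have zero: "to_ac \<circ> (0 :: 'a \<Rightarrow> 'k) = 0" by (auto simp: fun_eq_iff)
  have injE: "inj_on (\<lambda>e :: 'a \<Rightarrow> 'k. to_ac \<circ> e) E" using inj by (rule inj_on_subset) simp
  then show "card ((\<lambda>e. to_ac \<circ> e) ` E) = card E" by (rule card_image)
  have "\<Sum>((\<lambda>e. to_ac \<circ> e) ` E) = (\<Sum>e\<in>E. to_ac \<circ> e)"
    by (subst sum.reindex[OF injE]) (simp add: comp_def)
  also have "\<dots> = to_ac \<circ> \<Sum>E" by (auto simp: fun_eq_iff sum_fun_apply to_ac_sum)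
  also have "\<dots> = delta \<one>" unfolding E(6) by (auto simp: delta_def fun_eq_iff)
  finally have sum: "\<Sum>((\<lambda>e. to_ac \<circ> e) ` E) = delta \<one>" .
  show "idempotent_system (carrier G) ((\<lambda>e. to_ac \<circ> e) ` E)"
    unfolding idempotent_system_def
  proof (intro conjI ballI impI sum)
    show "finite ((\<lambda>e. to_ac \<circ> e) ` E)" using E(1) by simp
    show "(\<lambda>e. to_ac \<circ> e) ` E \<subseteq> supported (carrier G)"
      using E(2) by (auto simp: supported_def)
    show "0 \<notin> (\<lambda>e. to_ac \<circ> e) ` E"
      using E(3) injD[OF inj] zero by (metis imageE)
    show "x \<star> x = x" if "x \<in> (\<lambda>e. to_ac \<circ> e) ` E" for x
      using that E(4) by (auto simp: to_ac_conv[symmetric])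
    show "x \<star> y = 0" if xy: "x \<in> (\<lambda>e. to_ac \<circ> e) ` E" "y \<in> (\<lambda>e. to_ac \<circ> e) ` E" "x \<noteq> y" for x y
    proof -
      obtain e f where ef: "e \<in> E" "f \<in> E" "x = to_ac \<circ> e" "y = to_ac \<circ> f" using xy by blast
      then have "e \<star> f = 0" using E(5) xy(3) by blast
      then show ?thesis by (simp only: ef to_ac_conv[symmetric] zero)
    qed
  qed
qed

text \<open>The self-adjoint system is available only over the closure, and \<open>E\<close> need
  not be self-adjoint. Both become systems of primitive idempotents there, so they have the same
  size.\<close>

lemma card_split_system:
  fixes E :: "('a \<Rightarrow> 'k::field) set"
  assumes H: "\<And>i. i \<le> m \<Longrightarrow> subgroup (H i) G" "H 0 = {\<one>}" "\<And>i. i < m \<Longrightarrow> H i \<subseteq> H (Suc i)" "H m = carrier G"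
    and nz: "\<And>i. i \<le> m \<Longrightarrow> of_nat (card (H i)) \<noteq> (0::'k)"
    and rev: "\<And>i g. i < m \<Longrightarrow> g \<in> H (Suc i) \<Longrightarrow> \<exists>h\<in>H i. h \<otimes> g \<otimes> inv h = inv g"
    and E: "idempotent_system (carrier G) E" "\<And>e. e \<in> E \<Longrightarrow> split_idempotent (carrier G) e"
  shows "card E = card {g \<in> carrier G. g \<otimes> g = \<one>}"
proof -
  have nz': "of_nat (card (H i)) \<noteq> (0 :: 'k alg_closure)" if "i \<le> m" for i
    using nz[OF that] by (metis to_ac_eq_0_iff to_ac_of_nat)
  obtain F :: "('a \<Rightarrow> 'k alg_closure) set" where F: "self_adjoint_split_system (carrier G) F"
    using self_adjoint_split_system_exists[of m H, OF H(1-3) nz' rev order_refl] unfolding H(4) by blast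
  have nzG: "of_nat (card (carrier G)) \<noteq> (0 :: 'k alg_closure)" using nz'[of m] H(4) by simp
  have "card E = card ((\<lambda>e. to_ac \<circ> e) ` E)" using to_ac_idempotent_system(2)[OF E(1)] by simp
  also have "\<dots> = card F"
  proof (rule card_primitive_system_unique[OF nzG to_ac_idempotent_system(1)[OF E(1)]])
    fix e assume "e \<in> (\<lambda>e. to_ac \<circ> e) ` E"
    then show "primitive (carrier G) e"
      using E(2) by (auto intro: split_idempotent_primitive to_ac_split_idempotent)
  next
    show "idempotent_system (carrier G) F" using F by (simp add: self_adjoint_split_system_def)
    fix e assume "e \<in> F"
    then show "primitive (carrier G) e"
      using F by (auto simp: self_adjoint_split_system_def intro: split_idempotent_primitive)
  qed
  also have "\<dots> = card {g \<in> carrier G. g \<otimes> g = \<one>}" by (rule card_self_adjoint_split_system[OF F])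
  finally show ?thesis .
qed

end

lemma (in monoid) finite_group_units_of:
  assumes "finite (carrier G)"
  shows "finite_group (units_of G)"
  using units_group finite_subset[OF _ assms, of "Units G"]
  by (auto simp: finite_group_def finite_group_axioms_def units_of_carrier)

text \<open>
  The minimal left ideal generated by a primitive idempotent of the group algebra of the units, with
  all nonunits acting as zero, is a simple module of the monoid; its endomorphisms are the right
  multiplications.
\<close>

lemma (in monoid) splitting_field_imp_split_idempotent:
  fixes e :: "'a \<Rightarrow> 'k::field"
  assumes fin: "finite (carrier G)" and split: "splitting_field TYPE('k) G"
    and nz: "of_nat (card (Units G)) \<noteq> (0::'k)"
    and e: "finite_group.primitive (units_of G) (Units G) e"
  shows "finite_group.split_idempotent (units_of G) (Units G) e"
proof -
  interpret U: finite_group "units_of G" using fin by (rule finite_group_units_of)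
  have cU: "carrier (units_of G) = Units G" by (rule units_of_carrier)
  note conv_supported = U.conv_supported[unfolded cU]
  have sub: "subgroup (Units G) (units_of G)" using U.subgroup_self by (simp add: cU)
  let ?conv = "finite_group.conv (units_of G)"
  have e': "e \<in> supported (Units G)" "?conv e e = e" "e \<noteq> 0" using e by (auto simp: U.primitive_def)
  let ?S = "\<lparr>vecs = {x \<in> supported (Units G). ?conv x e = x}, smul = fun_smul,
      action = (\<lambda>g x. if g \<in> Units G then ?conv (delta g) x else 0)\<rparr> :: ('a, 'k, 'a \<Rightarrow> 'k) monoid_module"
  have subS: "fn.subspace {x \<in> supported (Units G). ?conv x e = x}"
    using subspace_supported[of "Units G"] unfolding fn.subspace_def
    by (auto simp: U.conv_add_left U.conv_smul_left U.conv_zero_left simp del: zero_fun_def)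
  have one: "?conv (delta \<one>) x = x" if "x \<in> supported (Units G)" for x :: "'a \<Rightarrow> 'k"
    using U.one_conv[unfolded cU units_of_one] that by blast
  have mult: "?conv (delta (g \<otimes> h)) x = ?conv (delta g) (?conv (delta h) x)"
    if "g \<in> Units G" "h \<in> Units G" for g h and x :: "'a \<Rightarrow> 'k"
  proof -
    have "delta (g \<otimes> h) = ?conv (delta g) (delta h :: 'a \<Rightarrow> 'k)"
      using U.delta_conv_delta[unfolded cU units_of_mult, OF that] by (rule sym)
    then show ?thesis by (simp only: U.conv_assoc)
  qed
  have mod: "is_module G ?S"
    unfolding is_module_def monoid_module.simps
  proof (intro conjI ballI allI)
    show "vector_space (fun_smul :: 'k \<Rightarrow> ('a \<Rightarrow> 'k) \<Rightarrow> _)" by (rule fn.vector_space_axioms)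
    show "(if \<one> \<in> Units G then ?conv (delta \<one>) x else 0) = x"
      if "x \<in> {x \<in> supported (Units G). ?conv x e = x}" for x
      using one that by simp
    fix g x assume "g \<in> carrier G" and x: "x \<in> {x \<in> supported (Units G). ?conv x e = x}"
    show "(if g \<in> Units G then ?conv (delta g) x else 0) \<in> {x \<in> supported (Units G). ?conv x e = x}"
      using x conv_supported fn.subspace_0[OF subS] by (auto simp: U.conv_assoc)
    fix h assume h: "h \<in> carrier G"
    \<comment> \<open>A product is a unit only if both factors are, which makes the extension by
      zero to the nonunits multiplicative.\<close>
    have "g \<otimes> h \<in> Units G \<longleftrightarrow> g \<in> Units G \<and> h \<in> Units G"
      using Units_factor_finite[OF fin \<open>g \<in> carrier G\<close> h] by blast
    then show "(if g \<otimes> h \<in> Units G then ?conv (delta (g \<otimes> h)) x else 0) =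
        (if g \<in> Units G then ?conv (delta g) (if h \<in> Units G then ?conv (delta h) x else 0) else 0)"
      using mult by (auto simp: U.conv_zero_right simp del: zero_fun_def)
  qed (use subS in \<open>auto simp: U.conv_add_right U.conv_smul_right\<close>)
  have "simple_module G ?S"
    unfolding simple_module_def
  proof (intro conjI mod allI impI)
    show "vecs ?S \<noteq> {0}" using e' by auto
    fix W assume W: "submodule G ?S W"
    have sW: "fn.subspace W" "W \<subseteq> vecs ?S" using W by (auto simp: submodule_def)
    show "W = {0} \<or> W = vecs ?S"
    proof (cases "W \<subseteq> {0}")
      case True
      then show ?thesis using fn.subspace_0[OF sW(1)] by blast
    next
      case False
      then obtain x where x: "x \<in> W" "x \<noteq> 0" by blast
      have actW: "?conv y w \<in> W" if "w \<in> W" "y \<in> supported (Units G)" for w y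
      proof -
        have "?conv y w = (\<Sum>g\<in>Units G. fun_smul (y g) (?conv (delta g) w))"
          using that(2) by (rule U.conv_delta_expand) (simp add: cU)
        also have "\<dots> \<in> W"
        proof (intro fn.subspace_sum[OF sW(1)] fn.subspace_scale[OF sW(1)])
          fix g assume g: "g \<in> Units G"
          then have "action ?S g w \<in> W" using W that(1) by (auto simp: submodule_def simp del: monoid_module.simps)
          then show "?conv (delta g) w \<in> W" using g by simp
        qed
        finally show ?thesis .
      qed
      have xS: "x \<in> supported (Units G)" "?conv x e = x" using x(1) sW(2) by auto
      obtain a where a: "a \<in> supported (Units G)" "?conv a x = e"
        using U.primitive_simple[OF sub nz e xS x(2)] by blast
      have "e \<in> W" using actW[OF x(1) a(1)] a(2) by simp
      have "y \<in> W" if "y \<in> vecs ?S" for y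
      proof -
        have "y \<in> supported (Units G)" "?conv y e = y" using that by auto
        then show ?thesis using actW[OF \<open>e \<in> W\<close>, of y] by simp
      qed
      then show ?thesis using sW(2) by blast
    qed
  qed
  then have scal: "\<exists>c. \<forall>s\<in>vecs ?S. \<phi> s = smul ?S c s" if "endomorphism G ?S \<phi>" for \<phi>
    using split that unfolding splitting_field_def by blast
  have "\<exists>c. ?conv (?conv e x) e = fun_smul c e" if x: "x \<in> supported (Units G)" for x
  proof -
    let ?u = "?conv (?conv e x) e"
    have ue: "?conv ?u e = ?u" "?conv e ?u = ?u"
      by (simp_all only: U.conv_assoc e'(2)) (simp only: U.conv_assoc[symmetric] e'(2))
    \<comment> \<open>The scalar by which right multiplication with e x e acts is read off by
      applying it to \<open>e\<close>, whose image is e x e.\<close>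
    have "endomorphism G ?S (\<lambda>s. ?conv s ?u)"
      unfolding endomorphism_def monoid_module.simps
    proof (intro conjI ballI allI)
      fix s assume s: "s \<in> {x \<in> supported (Units G). ?conv x e = x}"
      show "?conv s ?u \<in> {x \<in> supported (Units G). ?conv x e = x}"
        using conv_supported ue(1) by (auto simp: U.conv_assoc)
      show "?conv (if g \<in> Units G then ?conv (delta g) s else 0) ?u =
          (if g \<in> Units G then ?conv (delta g) (?conv s ?u) else 0)" for g
        by (simp add: U.conv_assoc U.conv_zero_left del: zero_fun_def)
    qed (simp_all add: U.conv_add_left U.conv_smul_left)
    then obtain c where "\<forall>s\<in>vecs ?S. ?conv s ?u = smul ?S c s" using scal by blast
    moreover have "e \<in> vecs ?S" using e' by simp
    ultimately have "?conv e ?u = smul ?S c e" by blast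
    then have "?u = fun_smul c e" using ue(2) by simp
    then show ?thesis by blast
  qed
  then show ?thesis unfolding U.split_idempotent_def using e' by blast
qed

section \<open>Tensor powers\<close>

locale fd_module =
  fixes M :: "('a, 'z) monoid_scheme" and V :: "('a, 'k::field, 'v::ab_group_add) monoid_module"
  assumes is_module: "is_module M V" and finite_dim: "finite_dim V"
begin

sublocale vector_space "smul V"
  using is_module by (simp add: is_module_def)

lemma subspace_vecs: "subspace (vecs V)"
  and action_closed: "g \<in> carrier M \<Longrightarrow> v \<in> vecs V \<Longrightarrow> action V g v \<in> vecs V"
  and action_add: "g \<in> carrier M \<Longrightarrow> v \<in> vecs V \<Longrightarrow> w \<in> vecs V \<Longrightarrow> action V g (v + w) = action V g v + action V g w"
  and action_scale: "g \<in> carrier M \<Longrightarrow> v \<in> vecs V \<Longrightarrow> action V g (smul V c v) = smul V c (action V g v)"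
  and action_one: "v \<in> vecs V \<Longrightarrow> action V \<one>\<^bsub>M\<^esub> v = v"
  and action_mult: "g \<in> carrier M \<Longrightarrow> h \<in> carrier M \<Longrightarrow> v \<in> vecs V \<Longrightarrow>
    action V (g \<otimes>\<^bsub>M\<^esub> h) v = action V g (action V h v)"
  using is_module by (auto simp: is_module_def)

lemma obtain_basis:
  obtains B where "finite B" "B \<subseteq> vecs V" "independent B" "span B = vecs V" "card B = module_dim V"
proof -
  obtain E where E: "finite E" "span E = vecs V" using finite_dim by (auto simp: finite_dim_def)
  obtain B where B: "B \<subseteq> vecs V" "independent B" "vecs V \<subseteq> span B" "card B = dim (vecs V)"
    by (rule basis_exists)
  have "finite B" using independent_span_bound[OF E(1) B(2)] B(1) E(2) by auto
  moreover have "span B = vecs V" using B(1,3) subspace_vecs by (rule span_subspace)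
  ultimately show ?thesis using B that by (simp add: module_dim_def)
qed

section \<open>Pure tensors, concatenation and bases\<close>

definition lists_over :: "'v set \<Rightarrow> nat \<Rightarrow> 'v list set" where
  "lists_over X n = {vs. length vs = n \<and> set vs \<subseteq> X}"

abbreviation pt :: "'v list \<Rightarrow> ('v list \<Rightarrow> 'k) \<Rightarrow> 'k" where
  "pt \<equiv> pure_tensor V"

abbreviation power_space :: "nat \<Rightarrow> (('v list \<Rightarrow> 'k) \<Rightarrow> 'k) set" where
  "power_space n \<equiv> vecs (tensor_power V n)"

lemma power_space_eq: "power_space n = fn.span (pt ` lists_over (vecs V) n)"
  by (simp add: tensor_power_def lists_over_def)

lemma smul_tensor_power [simp]: "smul (tensor_power V n) = fun_smul"
  by (simp add: tensor_power_def)

text \<open>Concatenation of lists plays the role of the tensor product of pure tensors. With one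
  factor fixed it is multilinear in the other, so the universal property yields a linear map between
  tensor powers. The function \<open>j\<close> tells where slot \<open>i\<close> ends up after
  padding.\<close>

lemma linear_concat:
  assumes "\<And>us i u. us \<in> lists_over (vecs V) a \<Longrightarrow> i < a \<Longrightarrow> u \<in> vecs V \<Longrightarrow>
      \<phi> us \<in> lists_over (vecs V) (b + a) \<and> \<phi> (us[i := u]) = (\<phi> us)[j i := u] \<and> j i < b + a"
  obtains L where "Vector_Spaces.linear fun_smul fun_smul L"
    "\<And>us. us \<in> lists_over (vecs V) a \<Longrightarrow> L (pt us) = pt (\<phi> us)"
proof -
  have "multilinear (smul V) (vecs V) a fun_smul (\<lambda>us. pt (\<phi> us))"
    unfolding multilinear_def
  proof (intro allI impI)
    fix us i assume "length us = a \<and> set us \<subseteq> vecs V \<and> i < a"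
    then have us: "us \<in> lists_over (vecs V) a" "i < a" by (auto simp: lists_over_def)
    note \<phi> = assms[OF us]
    have z: "0 \<in> vecs V" using subspace_vecs by (rule subspace_0)
    have ml: "length (\<phi> us) = b + a \<and> set (\<phi> us) \<subseteq> vecs V \<and> j i < b + a"
      using \<phi>[OF z] by (auto simp: lists_over_def)
    note m = multilinear_pure_tensor[of V "b + a", unfolded multilinear_def, rule_format, OF ml]
    show "(\<forall>u\<in>vecs V. \<forall>w\<in>vecs V. pt (\<phi> (us[i := u + w])) = pt (\<phi> (us[i := u])) + pt (\<phi> (us[i := w]))) \<and>
        (\<forall>c. \<forall>u\<in>vecs V. pt (\<phi> (us[i := smul V c u])) = fun_smul c (pt (\<phi> (us[i := u]))))"
      using m \<phi> subspace_add[OF subspace_vecs] subspace_scale[OF subspace_vecs] by simp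
  qed
  from tensor_power_universal[OF vector_space_fun_smul this] show ?thesis
    using that unfolding lists_over_def by blast
qed

lemma concat_right_span:
  assumes v: "v \<in> lists_over (vecs V) b" and S: "S \<subseteq> lists_over (vecs V) a" and u: "u \<in> lists_over (vecs V) a"
    and us: "pt u \<in> fn.span (pt ` S)"
  shows "pt (u @ v) \<in> fn.span (pt ` (\<lambda>s. s @ v) ` S)"
proof -
  obtain L where L: "Vector_Spaces.linear fun_smul fun_smul L"
      "\<And>us. us \<in> lists_over (vecs V) a \<Longrightarrow> L (pt us) = pt (us @ v)"
    by (rule linear_concat[of a "\<lambda>us. us @ v" b "\<lambda>i. i"]) (use v in \<open>auto simp: lists_over_def list_update_append\<close>)
  have "L (pt u) \<in> L ` fn.span (pt ` S)" using us by blast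
  also have "\<dots> = fn.span (L ` pt ` S)" by (rule fn2.linear_span_image[OF L(1), symmetric])
  also have "L ` pt ` S = pt ` (\<lambda>s. s @ v) ` S"
    unfolding image_image using S by (intro image_cong refl L(2)) blast
  finally show ?thesis by (simp only: L(2)[OF u])
qed

lemma concat_left_span:
  assumes v: "v \<in> lists_over (vecs V) b" and S: "S \<subseteq> lists_over (vecs V) a" and u: "u \<in> lists_over (vecs V) a"
    and us: "pt u \<in> fn.span (pt ` S)"
  shows "pt (v @ u) \<in> fn.span (pt ` (\<lambda>s. v @ s) ` S)"
proof -
  obtain L where L: "Vector_Spaces.linear fun_smul fun_smul L"
      "\<And>us. us \<in> lists_over (vecs V) a \<Longrightarrow> L (pt us) = pt (v @ us)"
    by (rule linear_concat[of a "\<lambda>us. v @ us" b "\<lambda>i. b + i"]) (use v in \<open>auto simp: lists_over_def list_update_append\<close>)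
  have "L (pt u) \<in> L ` fn.span (pt ` S)" using us by blast
  also have "\<dots> = fn.span (L ` pt ` S)" by (rule fn2.linear_span_image[OF L(1), symmetric])
  also have "L ` pt ` S = pt ` (\<lambda>s. v @ s) ` S"
    unfolding image_image using S by (intro image_cong refl L(2)) blast
  finally show ?thesis by (simp only: L(2)[OF u])
qed

lemma singleton_span:
  assumes R: "R \<subseteq> vecs V" and v: "v \<in> span R"
  shows "pt [v] \<in> fn.span (pt ` (\<lambda>r. [r]) ` R)"
proof -
  have sRV: "span R \<subseteq> vecs V" using R subspace_vecs by (rule span_minimal)
  have z: "0 \<in> vecs V" using subspace_vecs by (rule subspace_0)
  have "length [0 :: 'v] = 1 \<and> set [0 :: 'v] \<subseteq> vecs V \<and> (0::nat) < 1" using z by simp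
  note m = multilinear_pure_tensor[of V 1, unfolded multilinear_def, rule_format, OF this]
  have add: "pt [u + w] = pt [u] + pt [w]" if "u \<in> vecs V" "w \<in> vecs V" for u w
    using m that by (simp add: lists_over_def)
  have scale: "pt [smul V c u] = fun_smul c (pt [u])" if "u \<in> vecs V" for c u
    using m that by (simp add: lists_over_def)
  from v have "v \<in> vecs V \<and> pt [v] \<in> fn.span (pt ` (\<lambda>r. [r]) ` R)"
  proof (induction rule: span_induct_alt)
    case base
    have "pt [0] = fun_smul 0 (pt [0])" using scale[OF z, of 0] by simp
    then show ?case using z fn.span_zero fn.scale_zero_left by metis
  next
    case (step c x y)
    have x: "x \<in> vecs V" "smul V c x \<in> vecs V" using step R subspace_vecs by (auto intro: subspace_scale)
    have "pt [smul V c x + y] = fun_smul c (pt [x]) + pt [y]" using add[OF x(2)] scale[OF x(1)] step by simp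
    moreover have "fun_smul c (pt [x]) + pt [y] \<in> fn.span (pt ` (\<lambda>r. [r]) ` R)"
      using fn.span_add[OF fn.span_scale[OF fn.span_base[OF imageI[OF imageI[OF step(1)]]]]] step by blast
    moreover have "smul V c x + y \<in> vecs V" using x step subspace_vecs by (auto intro: subspace_add)
    ultimately show ?case by (simp only: simp_thms)
  qed
  then show ?thesis by simp
qed

lemma lists_over_span:
  assumes R: "R \<subseteq> vecs V" and vs: "vs \<in> lists_over (span R) n"
  shows "pt vs \<in> fn.span (pt ` lists_over R n)"
  using vs
proof (induction n arbitrary: vs)
  case 0
  then show ?case by (auto simp: lists_over_def intro: fn.span_base)
next
  case (Suc n)
  have sRV: "span R \<subseteq> vecs V" using R subspace_vecs by (rule span_minimal)
  obtain v t where vt: "vs = v # t" "v \<in> span R" "t \<in> lists_over (span R) n"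
    using Suc.prems by (cases vs) (auto simp: lists_over_def)
  have t: "t \<in> lists_over (vecs V) n" using vt(3) sRV by (auto simp: lists_over_def)
  have "pt ([v] @ t) \<in> fn.span (pt ` (\<lambda>s. s @ t) ` (\<lambda>r. [r]) ` R)"
    by (rule concat_right_span[OF t _ _ singleton_span[OF R vt(2)], of 1])
      (use R sRV vt(2) in \<open>auto simp: lists_over_def\<close>)
  moreover have "pt ` (\<lambda>s. s @ t) ` (\<lambda>r. [r]) ` R \<subseteq> fn.span (pt ` lists_over R (Suc n))"
  proof (clarify)
    fix r assume r: "r \<in> R"
    have "pt ([r] @ t) \<in> fn.span (pt ` (\<lambda>s. [r] @ s) ` lists_over R n)"
      by (rule concat_left_span[OF _ _ t Suc.IH[OF vt(3)], of _ 1]) (use r R in \<open>auto simp: lists_over_def\<close>)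
    also have "\<dots> \<subseteq> fn.span (pt ` lists_over R (Suc n))"
      using r by (intro fn.span_mono image_mono) (auto simp: lists_over_def)
    finally show "pt ([r] @ t) \<in> fn.span (pt ` lists_over R (Suc n))" .
  qed
  ultimately have "pt ([v] @ t) \<in> fn.span (pt ` lists_over R (Suc n))"
    using fn.span_minimal[OF _ fn.subspace_span] by blast
  then show ?case using vt(1) by simp
qed

lemma multilinear_product_form:
  assumes \<phi>: "\<And>i u w. u \<in> vecs V \<Longrightarrow> w \<in> vecs V \<Longrightarrow> \<phi> i (u + w) = \<phi> i u + \<phi> i w"
    "\<And>i c u. u \<in> vecs V \<Longrightarrow> \<phi> i (smul V c u) = c * \<phi> i u"
  shows "multilinear_form V n (\<lambda>vs. \<Prod>i<n. \<phi> i (vs ! i))"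
  unfolding multilinear_def
proof (intro allI impI)
  fix vs i assume a: "length vs = n \<and> set vs \<subseteq> vecs V \<and> i < n"
  have "(\<Prod>k<n. \<phi> k (vs[i := x] ! k)) = \<phi> i x * (\<Prod>k\<in>{..<n} - {i}. \<phi> k (vs ! k))" for x
  proof -
    have "(\<Prod>k<n. \<phi> k (vs[i := x] ! k)) = \<phi> i (vs[i := x] ! i) * (\<Prod>k\<in>{..<n} - {i}. \<phi> k (vs[i := x] ! k))"
      using a by (intro prod.remove) auto
    also have "(\<Prod>k\<in>{..<n} - {i}. \<phi> k (vs[i := x] ! k)) = (\<Prod>k\<in>{..<n} - {i}. \<phi> k (vs ! k))"
      by (rule prod.cong) auto
    finally show ?thesis using a by simp
  qed
  then show "(\<forall>u\<in>vecs V. \<forall>w\<in>vecs V. (\<Prod>k<n. \<phi> k (vs[i := u + w] ! k)) =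
        (\<Prod>k<n. \<phi> k (vs[i := u] ! k)) + (\<Prod>k<n. \<phi> k (vs[i := w] ! k))) \<and>
      (\<forall>c. \<forall>u\<in>vecs V. (\<Prod>k<n. \<phi> k (vs[i := smul V c u] ! k)) = c * (\<Prod>k<n. \<phi> k (vs[i := u] ! k)))"
    by (simp add: \<phi> distrib_right mult.assoc)
qed

lemma lists_over_eq: "lists_over X n = {vs. set vs \<subseteq> X \<and> length vs = n}"
  by (auto simp: lists_over_def)

lemma finite_lists_over: "finite X \<Longrightarrow> finite (lists_over X n)"
  unfolding lists_over_eq by (rule finite_lists_length_eq)

lemma card_lists_over: "finite X \<Longrightarrow> card (lists_over X n) = card X ^ n"
  unfolding lists_over_eq by (rule card_lists_length_eq)

lemma pure_tensor_apply: "length vs = n \<Longrightarrow> multilinear_form V n f \<Longrightarrow> pt vs f = f vs"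
  by (simp add: pure_tensor_def)

text \<open>The index set is arbitrary because there are two uses: tensors of basis vectors, indexed
  by lists, and the translates of one tensor, indexed by units.\<close>

lemma independent_pure_tensors:
  assumes fin: "finite I"
    and ev: "\<And>i j. i \<in> I \<Longrightarrow> j \<in> I \<Longrightarrow> F j (x i) = (if i = j then 1 else 0)"
    and lin: "\<And>j. Vector_Spaces.linear fun_smul (*) (F j :: (('v list \<Rightarrow> 'k) \<Rightarrow> 'k) \<Rightarrow> 'k)"
  shows "inj_on x I" "fn.independent (x ` I)"
proof -
  interpret K: vector_space "(*) :: 'k \<Rightarrow> 'k \<Rightarrow> 'k"
    by unfold_locales (auto simp: algebra_simps)
  interpret TK: vector_space_pair "fun_smul :: 'k \<Rightarrow> (('v list \<Rightarrow> 'k) \<Rightarrow> 'k) \<Rightarrow> _" "(*) :: 'k \<Rightarrow> 'k \<Rightarrow> 'k" ..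
  show inj: "inj_on x I"
  proof (rule inj_onI, rule ccontr)
    fix i j assume ij: "i \<in> I" "j \<in> I" "x i = x j" "i \<noteq> j"
    have "F j (x i) = 0" unfolding ev[OF ij(1,2)] using ij(4) by (rule if_not_P)
    moreover have "F j (x j) = 1" unfolding ev[OF ij(2,2)] by simp
    ultimately show False unfolding ij(3) by simp
  qed
  show "fn.independent (x ` I)"
  proof
    assume "fn.dependent (x ` I)"
    then obtain c v where v: "v \<in> x ` I" "c v \<noteq> 0" and 0: "(\<Sum>v\<in>x ` I. fun_smul (c v) v) = 0"
      unfolding fn.dependent_finite[OF finite_imageI[OF fin]] by blast
    then obtain j where j: "j \<in> I" "v = x j" by blast
    have "(\<Sum>v\<in>x ` I. fun_smul (c v) v) = (\<Sum>i\<in>I. fun_smul (c (x i)) (x i))"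
      by (rule sum.reindex_cong[OF inj refl refl])
    then have z: "(\<Sum>i\<in>I. fun_smul (c (x i)) (x i)) = 0"
      using 0 by (rule trans[OF sym])
    have e1: "F j (\<Sum>i\<in>I. fun_smul (c (x i)) (x i)) = 0"
      unfolding z by (rule TK.linear_0[OF lin])
    have e2: "F j (\<Sum>i\<in>I. fun_smul (c (x i)) (x i)) = (\<Sum>i\<in>I. F j (fun_smul (c (x i)) (x i)))"
      by (rule TK.linear_sum[OF lin])
    have e3: "(\<Sum>i\<in>I. F j (fun_smul (c (x i)) (x i))) = (\<Sum>i\<in>I. if i = j then c (x i) else 0)"
    proof (rule sum.cong[OF refl])
      fix i assume "i \<in> I"
      show "F j (fun_smul (c (x i)) (x i)) = (if i = j then c (x i) else 0)"
        unfolding TK.linear_scale[OF lin] ev[OF \<open>i \<in> I\<close> j(1)] by simp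
    qed
    have e4: "(\<Sum>i\<in>I. if i = j then c (x i) else 0) = c v"
      unfolding sum.delta[OF fin] j(2) by (rule if_P[OF j(1)])
    have "c v = 0" by (rule e1[unfolded e2 e3 e4])
    then show False using v(2) by contradiction
  qed
qed

lemma linear_eval: "Vector_Spaces.linear fun_smul (*) (\<lambda>x :: ('v list \<Rightarrow> 'k) \<Rightarrow> 'k. x f)"
proof -
  interpret K: vector_space "(*) :: 'k \<Rightarrow> 'k \<Rightarrow> 'k"
    by unfold_locales (auto simp: algebra_simps)
  show ?thesis
    using K.vector_space_axioms fn.vector_space_axioms by (simp add: Vector_Spaces.linear_iff fun_smul_def)
qed

text \<open>Products of coordinate forms are multilinear, and evaluation at them is a family dual to
  the tensors of basis vectors.\<close>

lemma basis_tensors: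
  assumes B: "finite B" "B \<subseteq> vecs V" "independent B" "span B = vecs V"
  shows "inj_on pt (lists_over B n)" "fn.independent (pt ` lists_over B n)"
    "power_space n = fn.span (pt ` lists_over B n)"
proof -
  let ?L = "lists_over B n"
  define f where "f bs = (\<lambda>vs. \<Prod>i<n. representation B (vs ! i) (bs ! i))" for bs
  have mf: "multilinear_form V n (f bs)" for bs
    unfolding f_def by (rule multilinear_product_form) (simp_all add: B(3,4) representation_add representation_scale)
  have ev: "pt cs (f bs) = (if cs = bs then 1 else 0)" if cs: "cs \<in> ?L" and bs: "bs \<in> ?L" for cs bs
  proof -
    have len: "length cs = n" "length bs = n" using cs bs by (auto simp: lists_over_def)
    have 1: "pt cs (f bs) = (\<Prod>i<n. representation B (cs ! i) (bs ! i))"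
      unfolding pure_tensor_apply[OF len(1) mf] by (simp only: f_def)
    have 2: "representation B (cs ! i) (bs ! i) = (if bs ! i = cs ! i then 1 else 0)" if "i < n" for i
    proof -
      have "cs ! i \<in> B" using cs that by (auto simp: lists_over_def)
      then show ?thesis by (simp only: representation_basis[OF B(3)])
    qed
    show ?thesis
    proof (cases "cs = bs")
      case True
      then show ?thesis unfolding 1 using 2 by simp
    next
      case False
      then obtain i where i: "i < n" "bs ! i \<noteq> cs ! i" using len by (auto simp: list_eq_iff_nth_eq)
      have "(\<Prod>i<n. representation B (cs ! i) (bs ! i)) = 0"
        using i 2[OF i(1)] by (intro prod_zero bexI[of _ i]) auto
      then show ?thesis unfolding 1 using False by simp
    qed
  qed
  show "inj_on pt ?L" "fn.independent (pt ` ?L)"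
    using independent_pure_tensors[where I = ?L and x = pt and F = "\<lambda>bs x. x (f bs)",
        OF finite_lists_over[OF B(1)] ev linear_eval] by blast+
  have "pt ` lists_over (vecs V) n \<subseteq> fn.span (pt ` ?L)"
    using lists_over_span[OF B(2)] unfolding B(4) by blast
  moreover have "?L \<subseteq> lists_over (vecs V) n" using B(2) by (auto simp: lists_over_def)
  ultimately show "power_space n = fn.span (pt ` ?L)"
    unfolding power_space_eq by (intro subset_antisym fn.span_minimal fn.subspace_span fn.span_mono image_mono)
qed

lemma dim_power_space: "fn.dim (power_space n) = module_dim V ^ n"
proof -
  obtain B where B: "finite B" "B \<subseteq> vecs V" "independent B" "span B = vecs V" "card B = module_dim V"
    by (rule obtain_basis)
  note bt = basis_tensors[OF B(1-4)]
  show ?thesis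
    unfolding bt(3) fn.dim_span_eq_card_independent[OF bt(2)] card_image[OF bt(1)]
      card_lists_over[OF B(1)] B(5) ..
qed

text \<open>The image is spanned by pure tensors of vectors in g V, hence by tensors of vectors from
  a basis of g V.\<close>

lemma dim_image_power_space_le:
  assumes g: "g \<in> carrier M"
  shows "fn.dim (action (tensor_power V n) g ` power_space n) \<le> dim (action V g ` vecs V) ^ n"
proof -
  let ?X = "action V g ` vecs V"
  have XV: "?X \<subseteq> vecs V" using action_closed[OF g] by blast
  obtain E where E: "finite E" "span E = vecs V" using finite_dim by (auto simp: finite_dim_def)
  obtain R where R: "R \<subseteq> ?X" "independent R" "?X \<subseteq> span R" "card R = dim ?X" by (rule basis_exists)
  have RV: "R \<subseteq> vecs V" using R(1) XV by blast
  have "R \<subseteq> span E" using RV E(2) by simp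
  then have fR: "finite R" using independent_span_bound[OF E(1) R(2)] by simp
  have "action (tensor_power V n) g ` power_space n =
      fn.span (action (tensor_power V n) g ` pt ` lists_over (vecs V) n)"
    unfolding power_space_eq by (rule fn2.linear_span_image[OF linear_action_tensor_power, symmetric])
  also have "\<dots> \<subseteq> fn.span (pt ` lists_over R n)"
  proof (intro fn.span_minimal fn.subspace_span image_subsetI, clarify)
    fix vs assume vs: "vs \<in> lists_over (vecs V) n"
    then have "action (tensor_power V n) g (pt vs) = pt (map (action V g) vs)"
      by (intro action_pure_tensor[OF is_module g]) (simp add: lists_over_def)
    moreover have "map (action V g) vs \<in> lists_over (span R) n"
      using vs R(3) by (auto simp: lists_over_def)
    ultimately show "action (tensor_power V n) g (pt vs) \<in> fn.span (pt ` lists_over R n)"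
      using lists_over_span[OF RV] by simp
  qed
  finally have sub: "action (tensor_power V n) g ` power_space n \<subseteq> fn.span (pt ` lists_over R n)" .
  have fin: "finite (lists_over R n)" using fR by (rule finite_lists_over)
  then have "fn.dim (action (tensor_power V n) g ` power_space n) \<le> card (pt ` lists_over R n)"
    using sub by (intro fn.dim_le_card) auto
  also have "\<dots> \<le> card (lists_over R n)" using fin by (rule card_image_le)
  also have "\<dots> = card R ^ n" using fR by (rule card_lists_over)
  finally show ?thesis using R(4) by simp
qed

end

subsection \<open>Free submodules of tensor powers\<close>

locale power_module = monoid M + fd_module M V
  for M :: "('a, 'z) monoid_scheme" (structure)
    and V :: "('a, 'k::field, 'v::ab_group_add) monoid_module" +
  assumes finite_carrier: "finite (carrier M)"
begin

lemma action_zero: "g \<in> carrier M \<Longrightarrow> action V g 0 = 0"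
  using action_scale[of g 0 0] subspace_0[OF subspace_vecs] by simp

lemma map_action_lists: "g \<in> carrier M \<Longrightarrow> vs \<in> lists_over (vecs V) n \<Longrightarrow> map (action V g) vs \<in> lists_over (vecs V) n"
  using action_closed by (auto simp: lists_over_def)

lemma map_action_mult:
  assumes "g \<in> carrier M" "h \<in> carrier M" "vs \<in> lists_over (vecs V) n"
  shows "map (action V g) (map (action V h) vs) = map (action V (g \<otimes> h)) vs"
  using assms by (auto simp: lists_over_def action_mult)

lemma map_action_one: "vs \<in> lists_over (vecs V) n \<Longrightarrow> map (action V \<one>) vs = vs"
  by (auto simp: lists_over_def action_one intro!: map_idI)

lemma action_pt:
  "g \<in> carrier M \<Longrightarrow> vs \<in> lists_over (vecs V) n \<Longrightarrow> action (tensor_power V n) g (pt vs) = pt (map (action V g) vs)"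
  by (rule action_pure_tensor[OF is_module]) (auto simp: lists_over_def)

definition spanning :: "nat \<Rightarrow> 'v list set \<Rightarrow> bool" where
  "spanning n S \<longleftrightarrow> S \<subseteq> lists_over (vecs V) n \<and> pt ` lists_over (vecs V) n \<subseteq> fn.span (pt ` S)"

lemma spanningD: "spanning n S \<Longrightarrow> t \<in> lists_over (vecs V) n \<Longrightarrow> pt t \<in> fn.span (pt ` S)"
  by (auto simp: spanning_def)

lemma spanning_power_space: "spanning n S \<Longrightarrow> power_space n \<subseteq> fn.span (pt ` S)"
  unfolding power_space_eq spanning_def by (intro fn.span_minimal fn.subspace_span) simp

lemma spanning_translate:
  assumes S: "spanning n S" and g: "g \<in> Units M"
  shows "spanning n (map (action V g) ` S)"
  unfolding spanning_def
proof (intro conjI image_subsetI)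
  note gc = Units_closed[OF g] Units_closed[OF Units_inv_Units[OF g]]
  show "map (action V g) s \<in> lists_over (vecs V) n" if "s \<in> S" for s
    using S that by (intro map_action_lists gc) (auto simp: spanning_def)
  fix t assume t: "t \<in> lists_over (vecs V) n"
  let ?s = "map (action V (inv g)) t"
  have s: "?s \<in> lists_over (vecs V) n" using t by (intro map_action_lists gc)
  have "pt t = action (tensor_power V n) g (pt ?s)"
    using g by (simp only: action_pt[OF gc(1) s] map_action_mult[OF gc t] Units_r_inv map_action_one[OF t])
  also have "\<dots> \<in> action (tensor_power V n) g ` fn.span (pt ` S)"
    using spanningD[OF S s] by (rule imageI)
  also have "\<dots> = fn.span (action (tensor_power V n) g ` pt ` S)"
    by (rule fn2.linear_span_image[OF linear_action_tensor_power, symmetric])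
  also have "action (tensor_power V n) g ` pt ` S = pt ` map (action V g) ` S"
    unfolding image_image using S by (intro image_cong refl action_pt[OF gc(1)]) (auto simp: spanning_def)
  finally show "pt t \<in> fn.span (pt ` map (action V g) ` S)" .
qed

text \<open>A spanning family with at most as many members as the dimension is a basis. So the
  translates of \<open>J\<close> span a free module over the group algebra of the units, and
  \<open>Q\<close> spans a vector space complement. Lists are kept instead of tensors in order to
  concatenate them.\<close>

definition almost_free :: "nat \<Rightarrow> 'v list set \<Rightarrow> 'v list set \<Rightarrow> bool" where
  "almost_free n J Q \<longleftrightarrow> finite J \<and> finite Q \<and> J \<subseteq> lists_over (vecs V) n \<and>
     spanning n ((\<Union>g\<in>Units M. map (action V g) ` J) \<union> Q) \<and>
     card J * card (Units M) + card Q \<le> module_dim V ^ n"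

lemma obtain_basis_lists:
  obtains Y where "finite Y" "spanning n Y" "card Y = module_dim V ^ n"
proof -
  obtain B where B: "finite B" "B \<subseteq> vecs V" "independent B" "span B = vecs V" "card B = module_dim V"
    by (rule obtain_basis)
  have "lists_over B n \<subseteq> lists_over (vecs V) n" using B(2) by (auto simp: lists_over_def)
  moreover have "pt ` lists_over (vecs V) n \<subseteq> fn.span (pt ` lists_over B n)"
    using lists_over_span[OF B(2)] unfolding B(4) by blast
  ultimately show ?thesis
    using that[of "lists_over B n"] finite_lists_over[OF B(1)] card_lists_over[OF B(1)] B(5)
    by (simp add: spanning_def)
qed

lemma span_image_closed:
  assumes "pt u \<in> fn.span (pt ` A)" "\<And>s. s \<in> A \<Longrightarrow> pt s \<in> fn.span (pt ` T)"
  shows "pt u \<in> fn.span (pt ` T)"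
proof -
  have "pt ` A \<subseteq> fn.span (pt ` T)" using assms(2) by (rule image_subsetI)
  then have "fn.span (pt ` A) \<subseteq> fn.span (pt ` T)" by (rule fn.span_minimal) (rule fn.subspace_span)
  then show ?thesis using assms(1) by (rule subsetD)
qed

text \<open>
  If \<open>V\<^sup>\<otimes>\<^sup>K = kG \<oplus> R\<close> and \<open>V\<^sup>\<otimes>\<^sup>n = F \<oplus> Q\<close> with \<open>F\<close> free, then the only part of the tensor product that is
  not visibly free is \<open>R \<otimes> Q\<close>.
\<close>

lemma almost_free_step:
  assumes w: "w \<in> lists_over (vecs V) K" and R: "finite R"
    and spK: "spanning K ((\<lambda>g. map (action V g) w) ` Units M \<union> R)"
    and cK: "card (Units M) + card R \<le> module_dim V ^ K"
    and JQ: "almost_free n J Q"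
  shows "\<exists>J' Q'. almost_free (K + n) J' Q' \<and> card Q' \<le> card R * card Q"
proof -
  have J: "finite J" "finite Q" "J \<subseteq> lists_over (vecs V) n"
      and spJ: "spanning n ((\<Union>g\<in>Units M. map (action V g) ` J) \<union> Q)"
      and cJ: "card J * card (Units M) + card Q \<le> module_dim V ^ n"
    using JQ by (auto simp: almost_free_def)
  have RL: "R \<subseteq> lists_over (vecs V) K" and QL: "Q \<subseteq> lists_over (vecs V) n"
    using spK spJ by (auto simp: spanning_def)
  obtain Y where Y: "finite Y" "spanning n Y" "card Y = module_dim V ^ n" by (rule obtain_basis_lists)
  have YL: "Y \<subseteq> lists_over (vecs V) n" using Y(2) by (simp add: spanning_def)
  have app: "u @ t \<in> lists_over (vecs V) (K + n)"
    if "u \<in> lists_over (vecs V) K" "t \<in> lists_over (vecs V) n" for u t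
    using that by (auto simp: lists_over_def)
  \<comment> \<open>w \<otimes> y for a basis Y of the n-th power generates kG \<otimes> V^n freely,
    and r \<otimes> s with s in \<open>J\<close> generates R \<otimes> F freely. Only R \<otimes> Q
    is left over.\<close>
  define J' where "J' = (\<lambda>y. w @ y) ` Y \<union> (\<lambda>(r, s). r @ s) ` (R \<times> J)"
  define Q' where "Q' = (\<lambda>(r, s). r @ s) ` (R \<times> Q)"
  define T where "T = (\<Union>g\<in>Units M. map (action V g) ` J') \<union> Q'"
  have fin: "finite J'" "finite Q'" using Y(1) R J by (auto simp: J'_def Q'_def)
  have J'L: "J' \<subseteq> lists_over (vecs V) (K + n)" and Q'L: "Q' \<subseteq> lists_over (vecs V) (K + n)"
    unfolding J'_def Q'_def
    by (intro Un_least image_subsetI app[OF w] subsetD[OF YL], assumption)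
      (use RL J(3) QL in \<open>auto intro!: app\<close>)
  have TL: "T \<subseteq> lists_over (vecs V) (K + n)"
    unfolding T_def
    by (intro Un_least UN_least image_subsetI map_action_lists Units_closed Q'L subsetD[OF J'L])
  have base: "pt s \<in> fn.span (pt ` T)" if "s \<in> T" for s using that by (intro fn.span_base imageI)
  \<comment> \<open>Untwisting the diagonal action: g w \<otimes> t is reached from the translates g
    (w \<otimes> y), because the translates g y of a spanning set again span.\<close>
  have c1: "pt (map (action V g) w @ t) \<in> fn.span (pt ` T)"
    if g: "g \<in> Units M" and t: "t \<in> lists_over (vecs V) n" for g t
  proof -
    have gw: "map (action V g) w \<in> lists_over (vecs V) K" using map_action_lists[OF Units_closed[OF g] w] .
    note spY = spanning_translate[OF Y(2) g]
    have "pt (map (action V g) w @ t) \<in> fn.span (pt ` (\<lambda>s. map (action V g) w @ s) ` map (action V g) ` Y)"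
      by (rule concat_left_span[OF gw _ t spanningD[OF spY t]]) (use spY in \<open>simp add: spanning_def\<close>)
    then show ?thesis
    proof (rule span_image_closed)
      fix s assume "s \<in> (\<lambda>s. map (action V g) w @ s) ` map (action V g) ` Y"
      then obtain y where y: "y \<in> Y" "s = map (action V g) w @ map (action V g) y" by blast
      then have "w @ y \<in> J'" unfolding J'_def by (intro UnI1 imageI)
      then have "map (action V g) (w @ y) \<in> T" unfolding T_def by (rule UnI1[OF UN_I[OF g imageI]])
      then show "pt s \<in> fn.span (pt ` T)" unfolding y(2) map_append[symmetric] by (rule base)
    qed
  qed
  \<comment> \<open>u \<otimes> g s is g (u' \<otimes> s) with u' ranging over the whole K-th power,
    which is spanned by the orbit of \<open>w\<close> and by \<open>R\<close>; the orbit part is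
    covered by \<open>c1\<close>.\<close>
  have c2: "pt (u @ map (action V g) s) \<in> fn.span (pt ` T)"
    if g: "g \<in> Units M" and s: "s \<in> J" and u: "u \<in> lists_over (vecs V) K" for g s u
  proof -
    have gs: "map (action V g) s \<in> lists_over (vecs V) n" using map_action_lists[OF Units_closed[OF g]] s J(3) by blast
    let ?S = "(\<lambda>g. map (action V g) w) ` Units M \<union> R"
    note spS = spanning_translate[OF spK g]
    have "pt (u @ map (action V g) s) \<in> fn.span (pt ` (\<lambda>t. t @ map (action V g) s) ` map (action V g) ` ?S)"
      by (rule concat_right_span[OF gs _ u spanningD[OF spS u]]) (use spS in \<open>simp add: spanning_def\<close>)
    then show ?thesis
    proof (rule span_image_closed)
      fix t assume "t \<in> (\<lambda>t. t @ map (action V g) s) ` map (action V g) ` ?S"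
      then consider h where "h \<in> Units M" "t = map (action V g) (map (action V h) w) @ map (action V g) s"
        | r where "r \<in> R" "t = map (action V g) r @ map (action V g) s" by blast
      then show "pt t \<in> fn.span (pt ` T)"
      proof cases
        case 1
        have eq: "map (action V g) (map (action V h) w) = map (action V (g \<otimes> h)) w"
          by (rule map_action_mult[OF Units_closed[OF g] Units_closed[OF 1(1)] w])
        show ?thesis unfolding 1(2) eq by (rule c1[OF Units_m_closed[OF g 1(1)] gs])
      next
        case 2
        have "r @ s \<in> J'" unfolding J'_def using 2(1) s by (intro UnI2 image_eqI[of _ _ "(r, s)"]) auto
        then have "map (action V g) (r @ s) \<in> T" unfolding T_def by (rule UnI1[OF UN_I[OF g imageI]])
        then show ?thesis unfolding 2(2) map_append[symmetric] by (rule base)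
      qed
    qed
  qed
  have c3: "pt (u @ s) \<in> fn.span (pt ` T)" if s: "s \<in> Q" and u: "u \<in> lists_over (vecs V) K" for s u
  proof -
    have sL: "s \<in> lists_over (vecs V) n" using s QL by blast
    have "pt (u @ s) \<in> fn.span (pt ` (\<lambda>t. t @ s) ` ((\<lambda>g. map (action V g) w) ` Units M \<union> R))"
      by (rule concat_right_span[OF sL _ u spanningD[OF spK u]]) (use spK in \<open>simp add: spanning_def\<close>)
    then show ?thesis
    proof (rule span_image_closed)
      fix t assume "t \<in> (\<lambda>t. t @ s) ` ((\<lambda>g. map (action V g) w) ` Units M \<union> R)"
      then consider g where "g \<in> Units M" "t = map (action V g) w @ s" | r where "r \<in> R" "t = r @ s" by blast
      then show "pt t \<in> fn.span (pt ` T)"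
      proof cases
        case 1
        then show ?thesis using c1[OF 1(1) sL] by simp
      next
        case 2
        then have "t \<in> Q'" unfolding Q'_def using s by (intro image_eqI[of _ _ "(r, s)"]) auto
        then show ?thesis by (intro base) (simp add: T_def)
      qed
    qed
  qed
  have "pt vs \<in> fn.span (pt ` T)" if vs: "vs \<in> lists_over (vecs V) (K + n)" for vs
  proof -
    define u where "u = take K vs"
    define t where "t = drop K vs"
    have ut: "u \<in> lists_over (vecs V) K" "t \<in> lists_over (vecs V) n" "vs = u @ t"
      using vs by (auto simp: lists_over_def u_def t_def dest: in_set_takeD in_set_dropD)
    have "pt (u @ t) \<in> fn.span (pt ` (\<lambda>s. u @ s) ` ((\<Union>g\<in>Units M. map (action V g) ` J) \<union> Q))"
      by (rule concat_left_span[OF ut(1) _ ut(2) spanningD[OF spJ ut(2)]]) (use spJ in \<open>simp add: spanning_def\<close>)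
    then have "pt (u @ t) \<in> fn.span (pt ` T)"
    proof (rule span_image_closed)
      fix s assume "s \<in> (\<lambda>s. u @ s) ` ((\<Union>g\<in>Units M. map (action V g) ` J) \<union> Q)"
      then consider g j where "g \<in> Units M" "j \<in> J" "s = u @ map (action V g) j" | q where "q \<in> Q" "s = u @ q"
        by blast
      then show "pt s \<in> fn.span (pt ` T)"
        by cases (use c2 c3 ut(1) in simp_all)
    qed
    then show ?thesis using ut(3) by simp
  qed
  then have sp: "spanning (K + n) T" using TL by (auto simp: spanning_def)
  have "card ((\<lambda>(r, s). r @ s) ` (R \<times> J)) \<le> card R * card J"
    using card_image_le[of "R \<times> J"] R J(1) by (simp add: card_cartesian_product)
  moreover have "card ((\<lambda>y. w @ y) ` Y) \<le> module_dim V ^ n" using card_image_le[OF Y(1), of "\<lambda>y. w @ y"] Y(3) by simp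
  ultimately have cJ': "card J' \<le> module_dim V ^ n + card R * card J"
    unfolding J'_def by (intro order_trans[OF card_Un_le] add_mono)
  have cQ': "card Q' \<le> card R * card Q"
    unfolding Q'_def using card_image_le[of "R \<times> Q"] R J(2) by (simp add: card_cartesian_product)
  \<comment> \<open>Writing d for the dimension of \<open>V\<close>, the family has at most (|G| +
    |R|) d^n \<le> d^K d^n members, so it is again no larger than the dimension of the space it
    spans.\<close>
  have "card J' * card (Units M) + card Q' \<le>
      (module_dim V ^ n + card R * card J) * card (Units M) + card R * card Q"
    using cJ' cQ' by (intro add_mono mult_right_mono) auto
  also have "\<dots> = module_dim V ^ n * card (Units M) + card R * (card J * card (Units M) + card Q)"
    by (simp add: algebra_simps)
  also have "\<dots> \<le> module_dim V ^ n * card (Units M) + card R * module_dim V ^ n"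
    using cJ by (intro add_left_mono mult_left_mono) auto
  also have "\<dots> = (card (Units M) + card R) * module_dim V ^ n" by (simp add: algebra_simps)
  also have "\<dots> \<le> module_dim V ^ K * module_dim V ^ n" using cK by (rule mult_right_mono) simp
  finally have "card J' * card (Units M) + card Q' \<le> module_dim V ^ (K + n)" by (simp add: power_add)
  then have "almost_free (K + n) J' Q'"
    using fin J'L sp by (simp add: almost_free_def T_def)
  then show ?thesis using cQ' by blast
qed

text \<open>Each further block of K factors multiplies the remainder by at most
  \<open>card R\<close>, whereas the dimension is multiplied by the K-th power of dim V. The initial
  s factors are treated entirely as remainder.\<close>

lemma almost_free_iterate:
  assumes w: "w \<in> lists_over (vecs V) K" and R: "finite R"
    and spK: "spanning K ((\<lambda>g. map (action V g) w) ` Units M \<union> R)"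
    and cK: "card (Units M) + card R \<le> module_dim V ^ K"
  shows "\<exists>J Q. almost_free (K * q + s) J Q \<and> card Q \<le> card R ^ q * module_dim V ^ s"
proof (induction q)
  case 0
  obtain Y where Y: "finite Y" "spanning s Y" "card Y = module_dim V ^ s" by (rule obtain_basis_lists)
  then have "almost_free s {} Y" by (simp add: almost_free_def)
  then show ?case using Y(3) by (intro exI[of _ "{}"] exI[of _ Y]) simp
next
  case (Suc q)
  then obtain J Q where JQ: "almost_free (K * q + s) J Q" "card Q \<le> card R ^ q * module_dim V ^ s" by blast
  obtain J' Q' where J': "almost_free (K + (K * q + s)) J' Q'" "card Q' \<le> card R * card Q"
    using almost_free_step[OF w R spK cK JQ(1)] by blast
  have "card Q' \<le> card R * (card R ^ q * module_dim V ^ s)"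
    by (rule order_trans[OF J'(2) mult_le_mono2[OF JQ(2)]])
  then show ?case using J'(1) by (intro exI[of _ J'] exI[of _ Q']) (simp add: algebra_simps)
qed

text \<open>
  The tensor \<open>w\<close> of vectors \<open>v\<^sub>x\<close>, one for each \<open>x \<noteq> 1\<close> in the unit group, with \<open>v\<^sub>x\<close> and \<open>x v\<^sub>x\<close> independent:
  a product of linear forms separates \<open>w\<close> from all its translates.
\<close>

lemma free_pure_tensor:
  assumes nonscalar: "\<And>x. x \<in> Units M \<Longrightarrow> x \<noteq> \<one> \<Longrightarrow> \<exists>v\<in>vecs V. action V x v \<notin> span {v}"
  defines "K \<equiv> card (Units M) - 1"
  obtains w R where "w \<in> lists_over (vecs V) K" "finite R"
    "spanning K ((\<lambda>g. map (action V g) w) ` Units M \<union> R)" "card (Units M) + card R = module_dim V ^ K"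
proof -
  have finU: "finite (Units M)" using finite_carrier by (rule finite_subset[rotated]) auto
  interpret K: vector_space "(*) :: 'k \<Rightarrow> 'k \<Rightarrow> 'k"
    by unfold_locales (auto simp: algebra_simps)
  interpret VK: vector_space_pair "smul V" "(*) :: 'k \<Rightarrow> 'k \<Rightarrow> 'k" ..
  have "\<exists>v \<phi>. v \<in> vecs V \<and> Vector_Spaces.linear (smul V) (*) \<phi> \<and> \<phi> v = 1 \<and> \<phi> (action V x v) = (0 :: 'k)"
    if x: "x \<in> Units M" "x \<noteq> \<one>" for x
  proof -
    obtain v where v: "v \<in> vecs V" "action V x v \<notin> span {v}" using nonscalar[OF x] by blast
    have "v \<noteq> 0" using v(2) action_zero[OF Units_closed[OF x(1)]] span_zero by auto
    then have ind: "independent {action V x v, v}" using v(2) by (intro independent_insertI independent_empty) auto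
    have ne: "action V x v \<noteq> v" using v(2) by (auto intro: span_base)
    obtain \<phi> where "\<forall>z\<in>{action V x v, v}. \<phi> z = (if z = v then 1 else 0 :: 'k)"
        "Vector_Spaces.linear (smul V) (*) \<phi>"
      using VK.linear_independent_extend[OF ind, of "\<lambda>z. if z = v then 1 else 0"] by blast
    then show ?thesis using v(1) ne by (intro exI[of _ v] exI[of _ \<phi>]) auto
  qed
  then have "\<forall>x\<in>Units M - {\<one>}. \<exists>p. fst p \<in> vecs V \<and> Vector_Spaces.linear (smul V) (*) (snd p) \<and>
      snd p (fst p) = 1 \<and> snd p (action V x (fst p)) = (0 :: 'k)" by force
  from bchoice[OF this] obtain p where p: "\<And>x. x \<in> Units M - {\<one>} \<Longrightarrow> fst (p x) \<in> vecs V"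
      "\<And>x. x \<in> Units M - {\<one>} \<Longrightarrow> Vector_Spaces.linear (smul V) (*) (snd (p x))"
      "\<And>x. x \<in> Units M - {\<one>} \<Longrightarrow> snd (p x) (fst (p x)) = 1"
      "\<And>x. x \<in> Units M - {\<one>} \<Longrightarrow> snd (p x) (action V x (fst (p x))) = (0 :: 'k)" by blast
  obtain xs where xs: "set xs = Units M - {\<one>}" "distinct xs"
    using finite_distinct_list[of "Units M - {\<one>}"] finU by auto
  have len: "length xs = K"
    using distinct_card[OF xs(2)] xs(1) finU by (simp add: K_def)
  have xsi: "xs ! i \<in> Units M - {\<one>}" if "i < K" for i using that len xs(1) nth_mem by metis
  define w where "w = map (\<lambda>x. fst (p x)) xs"
  have w: "w \<in> lists_over (vecs V) K" using p(1) xs(1) len by (auto simp: w_def lists_over_def)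
  \<comment> \<open>The product of the forms vanishes on g w for g \<noteq> 1, because in the slot
    belonging to g the form kills g v_g; on \<open>w\<close> itself all factors are 1. The zero
    default only extends the family of forms to all indices.\<close>
  define f where "f = (\<lambda>vs. \<Prod>i<K. (if i < K then snd (p (xs ! i)) else (\<lambda>_. 0)) (vs ! i))"
  have mf: "multilinear_form V K f"
    unfolding f_def
    by (rule multilinear_product_form)
      (use xsi p(2) in \<open>auto simp: VK.linear_add VK.linear_scale simp del: Diff_iff\<close>)
  have fw: "f (map (action V g) w) = (if g = \<one> then 1 else 0)" if g: "g \<in> Units M" for g
  proof (cases "g = \<one>")
    case True
    have "f w = 1"
      unfolding f_def by (rule prod.neutral) (use xsi p(3) len in \<open>auto simp: w_def simp del: Diff_iff\<close>)
    then show ?thesis using True map_action_one[OF w] by simp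
  next
    case False
    then obtain i where i: "i < K" "xs ! i = g" using g xs(1) len by (metis Diff_iff empty_iff in_set_conv_nth insert_iff)
    have "snd (p (xs ! i)) (map (action V g) w ! i) = 0"
      using i p(4)[of g] False g len by (simp add: w_def)
    then have "f (map (action V g) w) = 0"
      unfolding f_def using i(1) by (intro prod_zero bexI[of _ i]) auto
    then show ?thesis using False by simp
  qed
  let ?A = "\<lambda>g. action (tensor_power V K) g" and ?x = "\<lambda>g. pt (map (action V g) w)"
  \<comment> \<open>Acting by the inverse of h before evaluating at \<open>f\<close> gives
    functionals dual to the translates of \<open>w\<close>.\<close>
  have ev: "?A (inv h) (?x g) f = (if g = h then 1 else 0)" if g: "g \<in> Units M" and h: "h \<in> Units M" for g h
  proof -
    note gc = Units_closed[OF g] and hc = Units_closed[OF Units_inv_Units[OF h]]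
    have "?A (inv h) (?x g) = pt (map (action V (inv h \<otimes> g)) w)"
      by (simp only: action_pt[OF hc map_action_lists[OF gc w]] map_action_mult[OF hc gc w])
    moreover have "pt (map (action V (inv h \<otimes> g)) w) f = f (map (action V (inv h \<otimes> g)) w)"
      using w by (intro pure_tensor_apply[OF _ mf]) (simp add: lists_over_def)
    moreover have "inv h \<otimes> g = \<one> \<longleftrightarrow> g = h"
    proof
      assume 1: "inv h \<otimes> g = \<one>"
      have "g = h \<otimes> (inv h \<otimes> g)" using g h gc Units_closed[OF h] by (simp add: m_assoc[symmetric])
      then show "g = h" using 1 Units_closed[OF h] by simp
    qed (use h in simp)
    ultimately show ?thesis using fw[OF Units_m_closed[OF Units_inv_Units[OF h] g]] by simp
  qed
  have "Vector_Spaces.linear fun_smul (*) (\<lambda>x. ?A (inv h) x f)" for h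
    using Vector_Spaces.linear_compose[OF linear_action_tensor_power linear_eval] by (simp add: comp_def)
  note ind = independent_pure_tensors[where I = "Units M" and x = ?x and F = "\<lambda>h x. ?A (inv h) x f",
      OF finU ev this]
  have SL: "?x ` Units M \<subseteq> pt ` lists_over (vecs V) K"
    using map_action_lists[OF Units_closed w] by blast
  \<comment> \<open>The translates are completed to a basis by pure tensors, so that the remainder
    can be represented by lists \<open>R\<close>.\<close>
  obtain B where B: "?x ` Units M \<subseteq> B" "B \<subseteq> pt ` lists_over (vecs V) K" "fn.independent B"
      "pt ` lists_over (vecs V) K \<subseteq> fn.span B"
    by (rule fn.maximal_independent_subset_extend[OF SL ind(2)])
  have "power_space K = fn.span B"
    unfolding power_space_eq using B(2,4)
    by (intro subset_antisym fn.span_minimal fn.subspace_span fn.span_mono)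
  then have cB: "card B = module_dim V ^ K"
    using dim_power_space[of K] fn.dim_span_eq_card_independent[OF B(3)] by simp
  obtain E where E: "finite E" "fn.span E = power_space K"
    using finite_dim_tensor_power[OF vector_space_axioms finite_dim, of K]
    unfolding finite_dim_def by auto
  have "B \<subseteq> fn.span E" unfolding E(2) power_space_eq using B(2) fn.span_superset by blast
  then have fB: "finite B" using fn.independent_span_bound[OF E(1) B(3)] by blast
  obtain R where R: "R \<subseteq> lists_over (vecs V) K" "inj_on pt R" "B - ?x ` Units M = pt ` R"
    using B(2) subset_image_inj[of "B - ?x ` Units M" pt "lists_over (vecs V) K"] by blast
  have fR: "finite R" using R(2,3) fB by (metis finite_Diff finite_imageD)
  have "card R = card (B - ?x ` Units M)" unfolding R(3) card_image[OF R(2)] ..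
  also have "\<dots> = card B - card (Units M)"
    using finU B(1) by (subst card_Diff_subset) (simp_all add: card_image[OF ind(1)])
  finally have "card (Units M) + card R = module_dim V ^ K"
    using card_mono[OF fB B(1)] cB card_image[OF ind(1)] by simp
  moreover have "pt ` ((\<lambda>g. map (action V g) w) ` Units M \<union> R) = B"
    unfolding image_Un image_image R(3)[symmetric] using B(1) by blast
  then have "spanning K ((\<lambda>g. map (action V g) w) ` Units M \<union> R)"
    unfolding spanning_def using B(4) R(1) map_action_lists[OF Units_closed w] by auto
  ultimately show ?thesis using that w fR by blast
qed

end

subsection \<open>Lengths of tensor powers over the unit group\<close>

context linear_module
begin

text \<open>A basis of common eigenvectors splits the module into invariant lines.\<close>

lemma dim_le_height_eigenvectors:
  assumes L: "L \<subseteq> vecs V" "vecs V \<subseteq> span L"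
    and eig: "\<And>g w. g \<in> carrier M \<Longrightarrow> w \<in> L \<Longrightarrow> action V g w \<in> span {w}"
  shows "dim (vecs V) \<le> height (vecs V)"
proof -
  obtain B where B: "B \<subseteq> L" "independent B" "L \<subseteq> span B" by (rule maximal_independent_subset)
  have sp: "vecs V \<subseteq> span B" using L(2) span_minimal[OF B(3) subspace_span] by blast
  obtain E where E: "finite E" "span E = vecs V" using finite_dim by (auto simp: finite_dim_def)
  have "finite B" using independent_span_bound[OF E(1) B(2)] B(1) L(1) E(2) by auto
  then obtain f where f: "bij_betw f {..<card B} B"
    using ex_bij_betw_nat_finite[of B] by (auto simp: atLeast0LessThan)
  have "card B \<le> height (vecs V)"
  proof (rule height_ge_filtration)
    fix i assume i: "i < card B"
    have fB: "f j \<in> B" if "j < card B" for j using bij_betwE[OF f] that by blast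
    show "submodule M V (span {f i})"
      using fB[OF i] B(1) L(1) eig by (intro submodule_span) auto
    have "f j \<in> B - {f i}" if "j < i" for j
      using fB[of j] inj_onD[OF bij_betw_imp_inj_on[OF f], of j i] that i by auto
    then have "span {f j} \<subseteq> span (B - {f i})" if "j < i" for j
      using that by (intro span_mono) simp
    then have "(\<Union>j<i. span {f j}) \<subseteq> span (B - {f i})" by blast
    then have "span (\<Union>j<i. span {f j}) \<subseteq> span (B - {f i})" by (rule span_minimal) simp
    moreover have "f i \<notin> span (B - {f i})" using B(2) fB[OF i] unfolding dependent_def by blast
    ultimately show "\<not> span {f i} \<subseteq> span (\<Union>j<i. span {f j})"
      using span_base[of "f i" "{f i}"] by blast
  qed
  moreover have "card B = dim (vecs V)" using B(1) L(1) sp B(2) by (intro basis_card_eq_dim) auto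
  ultimately show ?thesis by simp
qed

end

lemma (in finite_group) trivial_idempotent_system:
  "idempotent_system (carrier G) {delta \<one> :: 'a \<Rightarrow> 'k::field}"
proof -
  have "delta \<one> \<noteq> (0 :: 'a \<Rightarrow> 'k)" by (auto simp: delta_def fun_eq_iff)
  then show ?thesis
    unfolding idempotent_system_def using one_conv[OF delta_supported[OF one_closed]]
    by (simp add: delta_supported del: zero_fun_def)
qed

context power_module
begin

lemma unit_maschke_tensor_power:
  assumes "of_nat (card (Units M)) \<noteq> (0::'k)"
  shows "unit_maschke_module M (tensor_power V n)"
proof (intro unit_maschke_module.intro linear_module.intro unit_maschke_module_axioms.intro)
  show "monoid M" by (rule monoid_axioms)
  show "is_module M (tensor_power V n)" using monoid_axioms is_module by (rule is_module_tensor_power)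
  show "Defs.finite_dim (tensor_power V n)" using vector_space_axioms finite_dim by (rule finite_dim_tensor_power)
qed (use finite_carrier assms linear_action_tensor_power in auto)

text \<open>This is h(n), the length of the n-th tensor power over the group of units.\<close>

definition unit_height :: "nat \<Rightarrow> nat" where
  "unit_height n = linear_module.height (units_of M) (tensor_power V n) (power_space n)"

text \<open>If x acted surjectively, so would all its powers. Finiteness gives x^i = x^j with i < j,
  so x^(j-i) acts as the identity on the image of x^i, which is everything. By faithfulness x^(j-i)
  = 1, and x is a unit.\<close>

lemma dim_image_nonunit:
  assumes faithful: "\<And>g. g \<in> carrier M \<Longrightarrow> (\<And>v. v \<in> vecs V \<Longrightarrow> action V g v = v) \<Longrightarrow> g = \<one>"
    and x: "x \<in> carrier M - Units M"
  shows "dim (action V x ` vecs V) < module_dim V"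
proof -
  have xc: "x \<in> carrier M" using x by simp
  \<comment> \<open>Over the trivial monoid submodules are just subspaces, so the strict
    monotonicity of the dimension of submodules applies to subspaces.\<close>
  let ?T = "M\<lparr>carrier := {\<one>}\<rparr>"
  have T: "is_module ?T V" using is_module by (simp add: is_module_def)
  have sub: "submodule ?T V W" if "W \<subseteq> vecs V" "subspace W" for W
    using that action_one by (auto simp: submodule_def)
  have XV: "action V x ` vecs V \<subseteq> vecs V" using action_closed[OF xc] by blast
  have "subspace (action V x ` vecs V)"
    unfolding subspace_def
  proof (intro conjI ballI allI)
    show "0 \<in> action V x ` vecs V"
      using action_zero[OF xc] subspace_0[OF subspace_vecs] by (metis imageI)
    fix a b assume "a \<in> action V x ` vecs V" "b \<in> action V x ` vecs V"
    then obtain u w where "u \<in> vecs V" "w \<in> vecs V" "a = action V x u" "b = action V x w" by blast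
    then show "a + b \<in> action V x ` vecs V"
      using action_add[OF xc, symmetric] subspace_add[OF subspace_vecs] by simp
  next
    fix c a assume "a \<in> action V x ` vecs V"
    then obtain u where "u \<in> vecs V" "a = action V x u" by blast
    then show "smul V c a \<in> action V x ` vecs V"
      using action_scale[OF xc, symmetric] subspace_scale[OF subspace_vecs] by simp
  qed
  moreover have "action V x ` vecs V \<noteq> vecs V"
  proof
    assume surj: "action V x ` vecs V = vecs V"
    have pc: "x [^] (n::nat) \<in> carrier M" for n using xc by simp
    have surjn: "action V (x [^] (n::nat)) ` vecs V = vecs V" for n
    proof (induction n)
      case 0
      then show ?case using action_one by simp
    next
      case (Suc n)
      have "action V (x [^] Suc n) ` vecs V = action V (x [^] n) ` action V x ` vecs V"
        unfolding image_image using pc xc by (intro image_cong refl) (simp add: action_mult)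
      then show ?case using Suc surj by simp
    qed
    have "\<not> inj (\<lambda>n::nat. x [^] n)"
      using finite_carrier pc by (meson finite_subset image_subsetI infinite_UNIV_nat finite_imageD)
    then obtain i j :: nat where ij: "i < j" "x [^] i = x [^] j"
      unfolding inj_def by (metis linorder_neqE_nat)
    have "x [^] (j - i) = \<one>"
    proof (rule faithful[OF pc])
      fix v assume "v \<in> vecs V"
      then obtain w where w: "w \<in> vecs V" "v = action V (x [^] i) w" using surjn[of i] by blast
      have "action V (x [^] (j - i)) v = action V (x [^] (j - i) \<otimes> x [^] i) w"
        unfolding w(2) by (rule action_mult[OF pc pc w(1), symmetric])
      also have "x [^] (j - i) \<otimes> x [^] i = x [^] j" using ij(1) xc by (simp add: nat_pow_mult)
      finally show "action V (x [^] (j - i)) v = v" using w(2) ij(2) by simp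
    qed
    moreover have "x [^] (j - i) = x \<otimes> x [^] (j - i - 1)"
      using ij(1) xc by (metis Suc_diff_1 nat_pow_Suc2 zero_less_diff)
    ultimately have "x \<otimes> x [^] (j - i - 1) \<in> Units M" by simp
    then show False using Units_factor_finite(1)[OF finite_carrier xc pc] x by blast
  qed
  ultimately show ?thesis
    using submodule_dim_less[OF T finite_dim sub[OF XV] sub[OF order_refl subspace_vecs]] XV
    by (auto simp: module_dim_def)
qed

text \<open>A nonunit has rank at most dim V - 1 on \<open>V\<close>, hence at most (dim V - 1)^n on
  the n-th tensor power, and there are at most |M| nonunits. The factor 2 comes from
  \<open>num_summands_bounds\<close>.\<close>

lemma summands_length_sandwich:
  assumes nz: "of_nat (card (Units M)) \<noteq> (0::'k)"
    and faithful: "\<And>g. g \<in> carrier M \<Longrightarrow> (\<And>v. v \<in> vecs V \<Longrightarrow> action V g v = v) \<Longrightarrow> g = \<one>"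
    and b: "num_indecomposable_summands M (tensor_power V n) r"
    and l: "module_length M (tensor_power V n) l"
  shows "r \<le> l" "l \<le> unit_height n" "unit_height n \<le> module_dim V ^ n"
    "unit_height n \<le> r + 2 * card (carrier M) * (module_dim V - 1) ^ n"
proof -
  interpret W: unit_maschke_module M "tensor_power V n" using nz by (rule unit_maschke_tensor_power)
  have h: "unit_height n = W.G.height (power_space n)" by (simp add: unit_height_def)
  show "r \<le> l" using W.num_summands_bounds(1)[OF b] W.module_length_eq_height[OF l] by simp
  show "l \<le> unit_height n" using W.module_length_le[OF l] h by simp
  show "unit_height n \<le> module_dim V ^ n"
    using W.G.height_le_dim[OF submodule_self[OF W.G.is_module]] h dim_power_space[of n] by simp
  have "(\<Sum>x\<in>W.nonunits. W.dim (action (tensor_power V n) x ` power_space n)) \<le>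
      (\<Sum>x\<in>W.nonunits. (module_dim V - 1) ^ n)"
  proof (rule sum_mono)
    fix x assume "x \<in> W.nonunits"
    then have x: "x \<in> carrier M - Units M" by (simp add: W.nonunits_def)
    have "W.dim (action (tensor_power V n) x ` power_space n) \<le> dim (action V x ` vecs V) ^ n"
      using dim_image_power_space_le[of x n] x by simp
    also have "\<dots> \<le> (module_dim V - 1) ^ n"
      using dim_image_nonunit[OF faithful x] by (intro power_mono) auto
    finally show "W.dim (action (tensor_power V n) x ` power_space n) \<le> (module_dim V - 1) ^ n" .
  qed
  also have "\<dots> = card W.nonunits * (module_dim V - 1) ^ n" by simp
  also have "\<dots> \<le> card (carrier M) * (module_dim V - 1) ^ n"
    using finite_carrier by (intro mult_right_mono card_mono) (auto simp: W.nonunits_def)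
  finally show "unit_height n \<le> r + 2 * card (carrier M) * (module_dim V - 1) ^ n"
    using W.num_summands_bounds(2)[OF b] h by simp
qed

text \<open>With r = |E| both inequalities say that |G| h(n) differs from r (dim V)^n by at most a
  multiple of |Q|. Multiplying through by |G| and placing the error on the larger side avoids
  division and subtraction of naturals.\<close>

lemma unit_height_almost_free:
  fixes E :: "('a \<Rightarrow> 'k) set"
  assumes nz: "of_nat (card (Units M)) \<noteq> (0::'k)"
    and E: "finite_group.idempotent_system (units_of M) (Units M) E"
      "\<And>e. e \<in> E \<Longrightarrow> finite_group.primitive (units_of M) (Units M) e"
    and JQ: "almost_free n J Q"
  shows "card E * module_dim V ^ n \<le> card (Units M) * unit_height n + card E * card Q"
    "card (Units M) * unit_height n \<le> card E * module_dim V ^ n + card (Units M) * card Q"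
proof -
  interpret W: unit_maschke_module M "tensor_power V n" using nz by (rule unit_maschke_tensor_power)
  have h: "unit_height n = W.G.height (power_space n)" by (simp add: unit_height_def)
  have J: "finite J" "finite Q" "J \<subseteq> lists_over (vecs V) n"
      and sp: "spanning n ((\<Union>g\<in>Units M. map (action V g) ` J) \<union> Q)"
      and c: "card J * card (Units M) + card Q \<le> module_dim V ^ n"
    using JQ by (auto simp: almost_free_def)
  have ptV: "pt ` S \<subseteq> power_space n" if "S \<subseteq> lists_over (vecs V) n" for S
    unfolding power_space_eq using that fn.span_superset by blast
  let ?J = "pt ` J" and ?Q = "pt ` Q"
  have QL: "Q \<subseteq> lists_over (vecs V) n" using sp by (auto simp: spanning_def)
  have orbit: "pt ` ((\<Union>g\<in>Units M. map (action V g) ` J) \<union> Q) \<subseteq>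
      (\<Union>w\<in>?J. (\<lambda>g. action (tensor_power V n) g w) ` Units M) \<union> ?Q"
  proof (intro image_subsetI)
    fix t assume "t \<in> (\<Union>g\<in>Units M. map (action V g) ` J) \<union> Q"
    then consider g s where "g \<in> Units M" "s \<in> J" "t = map (action V g) s" | "t \<in> Q" by blast
    then show "pt t \<in> (\<Union>w\<in>?J. (\<lambda>g. action (tensor_power V n) g w) ` Units M) \<union> ?Q"
    proof cases
      case 1
      have "s \<in> lists_over (vecs V) n" using 1(2) J(3) by blast
      then have "pt t = action (tensor_power V n) g (pt s)"
        unfolding 1(3) by (rule action_pt[OF Units_closed[OF 1(1)], symmetric])
      then show ?thesis using 1 by blast
    qed blast
  qed
  have sp': "power_space n \<subseteq> fn.span ((\<Union>w\<in>?J. (\<lambda>g. action (tensor_power V n) g w) ` Units M) \<union> ?Q)"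
    using spanning_power_space[OF sp] fn.span_mono[OF orbit] by blast
  have cJ: "card ?J \<le> card J" and cQ: "card ?Q \<le> card Q" using J by (auto intro: card_image_le)
  have cc: "card ?J * card (Units M) + card ?Q \<le> module_dim V ^ n"
    using add_mono[OF mult_right_mono[OF cJ, of "card (Units M)"] cQ] c by simp
  note hf' = W.G.height_almost_free[unfolded units_of_carrier smul_tensor_power, OF E(1) E(2) finite_imageI[OF J(1)] ptV[OF J(3)]
      finite_imageI[OF J(2)] ptV[OF QL] sp', unfolded dim_power_space, OF _ cc]
  have hf: "card ?J * card E \<le> W.G.height (power_space n)" "W.G.height (power_space n) \<le> card ?J * card E + card ?Q"
    by (rule hf'(1), assumption) (rule hf'(2), assumption)
  \<comment> \<open>\<open>pt\<close> may identify lists, so the images could be smaller than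
    \<open>J\<close> and \<open>Q\<close>. The spanning property bounds their size from below;
    together with \<open>cc\<close> it gives equality.\<close>
  have "module_dim V ^ n \<le> card ((\<Union>w\<in>?J. (\<lambda>g. action (tensor_power V n) g w) ` Units M) \<union> ?Q)"
    unfolding dim_power_space[symmetric]
    using J W.G.finite_carrier by (intro fn.dim_le_card[OF sp']) (auto simp: units_of_carrier)
  also have "\<dots> \<le> card (\<Union>w\<in>?J. (\<lambda>g. action (tensor_power V n) g w) ` Units M) + card ?Q"
    by (rule card_Un_le)
  also have "card (\<Union>w\<in>?J. (\<lambda>g. action (tensor_power V n) g w) ` Units M) \<le>
      (\<Sum>w\<in>?J. card ((\<lambda>g. action (tensor_power V n) g w) ` Units M))"
    using J by (intro card_UN_le) auto
  also have "\<dots> \<le> (\<Sum>w\<in>?J. card (Units M))"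
    using W.G.finite_carrier by (intro sum_mono card_image_le) (simp add: units_of_carrier)
  finally have d: "module_dim V ^ n \<le> card ?J * card (Units M) + card ?Q" by simp
  have "card E * module_dim V ^ n \<le> card E * (card ?J * card (Units M) + card ?Q)"
    using d by (rule mult_left_mono) simp
  also have "\<dots> = card (Units M) * (card ?J * card E) + card E * card ?Q" by (simp add: algebra_simps)
  also have "\<dots> \<le> card (Units M) * unit_height n + card E * card Q"
    using hf(1) cQ h by (intro add_mono mult_left_mono) auto
  finally show "card E * module_dim V ^ n \<le> card (Units M) * unit_height n + card E * card Q" .
  have "card (Units M) * unit_height n \<le> card (Units M) * (card ?J * card E + card ?Q)"
    using hf(2) h by (intro mult_left_mono) auto
  also have "\<dots> = card E * (card ?J * card (Units M)) + card (Units M) * card ?Q" by (simp add: algebra_simps)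
  also have "\<dots> \<le> card E * module_dim V ^ n + card (Units M) * card Q"
    using cc cQ by (intro add_mono mult_left_mono) auto
  finally show "card (Units M) * unit_height n \<le> card E * module_dim V ^ n + card (Units M) * card Q" .
qed

text \<open>If \<sigma> is the unit other than 1, then w is half the sum of w + \<sigma> w and w -
  \<sigma> w, which are eigenvectors of \<sigma>. The number 2 is invertible as the order of the
  group of units.\<close>

lemma unit_height_small:
  assumes nz: "of_nat (card (Units M)) \<noteq> (0::'k)" and small: "card (Units M) \<le> 2"
  shows "unit_height n = module_dim V ^ n"
proof (rule antisym)
  interpret W: unit_maschke_module M "tensor_power V n" using nz by (rule unit_maschke_tensor_power)
  have h: "unit_height n = W.G.height (power_space n)" by (simp add: unit_height_def)
  show "unit_height n \<le> module_dim V ^ n"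
    using W.G.height_le_dim[OF submodule_self[OF W.G.is_module]] h dim_power_space[of n] by simp
  let ?A = "action (tensor_power V n)"
  let ?L = "{w \<in> power_space n. \<forall>g\<in>Units M. ?A g w \<in> fn.span {w}}"
  have one: "?A \<one> w \<in> fn.span {w}" if "w \<in> power_space n" for w
    using W.action_one[OF that] by (simp add: fn.span_base)
  have "power_space n \<subseteq> fn.span ?L"
  proof
    fix w assume w: "w \<in> power_space n"
    show "w \<in> fn.span ?L"
    proof (cases "Units M = {\<one>}")
      case True
      then show ?thesis using w one by (intro fn.span_base) auto
    next
      case False
      then obtain \<sigma> where \<sigma>: "\<sigma> \<in> Units M" "\<sigma> \<noteq> \<one>" using Units_one_closed by blast
      have finU: "finite (Units M)" using W.G.finite_carrier by (simp add: units_of_carrier)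
      have "card {\<one>, \<sigma>} = 2" using \<sigma>(2) by simp
      moreover have "{\<one>, \<sigma>} \<subseteq> Units M" using \<sigma>(1) by simp
      ultimately have U: "Units M = {\<one>, \<sigma>}" using card_seteq[OF finU, of "{\<one>, \<sigma>}"] small by simp
      then have two: "(2::'k) \<noteq> 0" using nz \<sigma>(2) by (simp add: eq_commute)
      have sc: "\<sigma> \<in> carrier M" using \<sigma>(1) by (rule Units_closed)
      have "\<sigma> \<otimes> \<sigma> \<noteq> \<sigma>"
      proof
        assume "\<sigma> \<otimes> \<sigma> = \<sigma>"
        then have "inv \<sigma> \<otimes> (\<sigma> \<otimes> \<sigma>) = inv \<sigma> \<otimes> \<sigma>" by simp
        then show False using \<sigma> sc by (simp add: m_assoc[symmetric] Units_closed)
      qed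
      then have ss: "\<sigma> \<otimes> \<sigma> = \<one>" using Units_m_closed[OF \<sigma>(1) \<sigma>(1)] U by blast
      have AA: "?A \<sigma> (?A \<sigma> w) = w"
        using W.action_mult[OF sc sc w] W.action_one[OF w] ss by simp
      have Aw: "?A \<sigma> w \<in> power_space n" by (rule W.action_closed[OF sc w])
      let ?p = "w + ?A \<sigma> w" and ?m = "w - ?A \<sigma> w"
      have pm: "?p \<in> power_space n" "?m \<in> power_space n"
        using fn.subspace_add[OF W.subspace_vecs[unfolded smul_tensor_power] w Aw]
          fn.subspace_diff[OF W.subspace_vecs[unfolded smul_tensor_power] w Aw] by auto
      have "?A \<sigma> ?p = ?p" by (simp only: W.action_add[OF sc] AA add.commute)
      then have "?p \<in> ?L" using pm(1) one[OF pm(1)] U by (simp add: fn.span_base)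
      moreover have "?A \<sigma> ?m = - ?m" by (simp only: W.action_diff[OF sc] AA minus_diff_eq)
      then have "?m \<in> ?L" using pm(2) one[OF pm(2)] U by (simp only: mem_Collect_eq ball_simps simp_thms) (intro fn.span_neg fn.span_base, simp)
      ultimately have "fun_smul (1/2) (?p + ?m) \<in> fn.span ?L"
        by (intro fn.span_scale fn.span_add[OF fn.span_base fn.span_base])
      moreover have "fun_smul (1/2) (?p + ?m) = w"
        using two by (auto simp: fun_smul_def fun_eq_iff field_simps)
      ultimately show ?thesis by (simp only:)
    qed
  qed
  then have "W.dim (power_space n) \<le> W.G.height (power_space n)"
    by (intro W.G.dim_le_height_eigenvectors[of ?L]) (auto simp: units_of_carrier)
  then show "module_dim V ^ n \<le> unit_height n" using h dim_power_space[of n] by simp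
qed

end

section \<open>The symmetric group\<close>

text \<open>On each cycle, \<open>h\<close> is the reflection fixing a base point, which is \<open>a\<close> on the cycle of \<open>a\<close>.\<close>

lemma permutes_reversed:
  assumes p: "p permutes S" and S: "finite S" and a: "a \<in> S"
  shows "\<exists>h. h permutes (S - {a}) \<and> h \<circ> h = id \<and> h \<circ> p \<circ> h \<circ> p = id"
proof -
  have "permutation p" using p S by (auto simp: permutation_permutes)
  then obtain N where N: "p ^^ N = id" "N > 0" by (rule permutation_is_nilpotent)
  \<comment> \<open>With p^N = 1 the power p^u is the inverse of p, so p^(u n) stands for the power
    of p with exponent -n and all exponents remain natural numbers.\<close>
  define u where "u = N - 1"
  have pu: "(p ^^ (u * n)) ((p ^^ n) x) = x" for n x
  proof -
    have "(p ^^ (u * n)) ((p ^^ n) x) = (p ^^ (u * n + n)) x" by (simp add: funpow_add)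
    also have "u * n + n = N * n" using N(2) by (cases N) (auto simp: u_def)
    also have "(p ^^ (N * n)) x = x" by (simp add: funpow_mult[symmetric] N(1))
    finally show ?thesis .
  qed
  have comm: "(p ^^ i) ((p ^^ j) x) = (p ^^ j) ((p ^^ i) x)" for i j x
    by (metis add.commute comp_apply funpow_add)
  define orb where "orb x = {(p ^^ n) x | n. True}" for x
  \<comment> \<open>The base point depends on the orbit alone; on the orbit of \<open>a\<close> it
    is \<open>a\<close> itself, which makes \<open>h\<close> fix \<open>a\<close>.\<close>
  define rep where "rep A = (if a \<in> A then a else (SOME y. y \<in> A))" for A
  have orb_self: "x \<in> orb x" for x unfolding orb_def by (rule CollectI, rule exI[of _ 0]) simp
  have orb_trans: "orb ((p ^^ n) x) \<subseteq> orb x" for n x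
  proof
    fix y assume "y \<in> orb ((p ^^ n) x)"
    then obtain k where "y = (p ^^ k) ((p ^^ n) x)" unfolding orb_def by blast
    then have "y = (p ^^ (k + n)) x" by (simp add: funpow_add)
    then show "y \<in> orb x" unfolding orb_def by blast
  qed
  have orb_eq: "orb ((p ^^ n) x) = orb x" for n x
    using orb_trans[of n x] orb_trans[of "u * n" "(p ^^ n) x"] by (simp add: pu)
  have rep_in: "rep (orb x) \<in> orb x" for x
    unfolding rep_def using orb_self[of x] by (auto intro: someI)
  have ex: "\<exists>n. x = (p ^^ n) (rep (orb x))" for x
  proof -
    obtain n where "rep (orb x) = (p ^^ n) x" using rep_in[of x] unfolding orb_def by blast
    then have "(p ^^ (u * n)) (rep (orb x)) = x" by (simp add: pu)
    then show ?thesis by metis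
  qed
  define ix where "ix x = (SOME n. x = (p ^^ n) (rep (orb x)))" for x
  define h where "h x = (p ^^ (u * ix x)) (rep (orb x))" for x
  have ix: "x = (p ^^ ix x) (rep (orb x))" for x unfolding ix_def by (rule someI_ex[OF ex])
  \<comment> \<open>The reflection sends p^n c to p^(-n) c; this does not depend on the choice of
    n.\<close>
  have wd: "(p ^^ (u * n)) c = (p ^^ (u * k)) c" if "(p ^^ n) c = (p ^^ k) c" for n k c
  proof -
    have "(p ^^ (u * n)) c = (p ^^ (u * n)) ((p ^^ (u * k)) ((p ^^ k) c))" by (simp only: pu)
    also have "\<dots> = (p ^^ (u * k)) ((p ^^ (u * n)) ((p ^^ n) c))" by (simp only: that comm[of "u * n"])
    finally show ?thesis by (simp only: pu)
  qed
  have h: "h ((p ^^ n) (rep (orb x))) = (p ^^ (u * n)) (rep (orb x))" for n x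
  proof -
    let ?y = "(p ^^ n) (rep (orb x))"
    have "x = (p ^^ ix x) (rep (orb x))" by (rule ix)
    then have "orb x = orb (rep (orb x))" by (metis orb_eq)
    then have oy: "orb ?y = orb x" by (simp only: orb_eq)
    have "(p ^^ ix ?y) (rep (orb x)) = (p ^^ n) (rep (orb x))" using ix[of ?y] unfolding oy by (rule sym)
    then show ?thesis unfolding h_def oy by (rule wd)
  qed
  have hh: "h (h x) = x" for x
  proof -
    let ?c = "rep (orb x)" and ?n = "ix x"
    have "h (h x) = (p ^^ (u * (u * ?n))) ?c" unfolding h_def[of x] by (rule h)
    also have "\<dots> = (p ^^ (u * (u * ?n))) ((p ^^ (u * ?n)) ((p ^^ ?n) ?c))" by (simp only: pu)
    also have "\<dots> = (p ^^ ?n) ?c" by (rule pu)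
    finally show ?thesis using ix[of x] by simp
  qed
  have hp: "h (p x) = (p ^^ u) (h x)" for x
  proof -
    let ?c = "rep (orb x)" and ?n = "ix x"
    have "p x = (p ^^ Suc ?n) ?c" using ix[of x] by simp
    then have "h (p x) = (p ^^ (u * Suc ?n)) ?c" using h[of "Suc ?n" x] by simp
    then show ?thesis by (simp add: h_def funpow_add)
  qed
  have "h (p (h (p x))) = x" for x
  proof -
    have "h (p (h (p x))) = h (p ((p ^^ u) (h x)))" by (simp only: hp)
    also have "p ((p ^^ u) (h x)) = h x" using pu[of 1 "h x"] by (simp add: funpow_swap1)
    finally show ?thesis by (simp add: hh)
  qed
  moreover have "h permutes (S - {a})"
    unfolding permutes_def
  proof (intro conjI allI impI)
    fix x assume "x \<notin> S - {a}"
    then consider "x = a" | "x \<notin> S" by blast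
    then show "h x = x"
    proof cases
      case 1
      then have c: "rep (orb x) = x" unfolding rep_def using orb_self[of x] by simp
      show ?thesis using h[of 0 x] c by simp
    next
      case 2
      then have "p x = x" using p by (simp add: permutes_def)
      then have px: "(p ^^ n) x = x" for n by (induction n) auto
      then have "orb x = {x}" unfolding orb_def by auto
      then have "rep (orb x) = x" using rep_in[of x] by auto
      then show ?thesis unfolding h_def by (simp add: px)
    qed
  next
    show "\<exists>!x. h x = y" for y using hh by metis
  qed
  ultimately show ?thesis using hh by (intro exI[of _ h]) (auto simp: fun_eq_iff)
qed

section \<open>Counting involutions\<close>

fun involution_count :: "nat \<Rightarrow> nat" where
  "involution_count 0 = 1"
| "involution_count (Suc 0) = 1"
| "involution_count (Suc (Suc n)) = involution_count (Suc n) + Suc n * involution_count n"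

text \<open>A self-inverse permutation either fixes \<open>a\<close> and restricts to the remaining
  letters, or it interchanges \<open>a\<close> with some b; composing with that transposition leaves
  a self-inverse permutation of the letters other than a and b.\<close>

lemma card_involutions:
  assumes "finite S"
  shows "card {p. p permutes S \<and> p \<circ> p = id} = involution_count (card S)"
  using assms
proof (induction "card S" arbitrary: S rule: less_induct)
  case less
  let ?I = "\<lambda>S. {p. p permutes S \<and> p \<circ> p = id}"
  show ?case
  proof (cases "S = {}")
    case True
    then have "?I S = {id}" by auto
    then show ?thesis using True by simp
  next
    case False
    then obtain a where a: "a \<in> S" by blast
    define T where "T = S - {a}"
    have T: "S = insert a T" "a \<notin> T" "finite T" using a less.prems by (auto simp: T_def)
    have cS: "card S = Suc (card T)" using T by simp
    have split: "?I S = ?I T \<union> (\<Union>b\<in>T. {p \<in> ?I S. p a = b})"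
    proof (intro subset_antisym subsetI)
      fix p assume p: "p \<in> ?I S"
      show "p \<in> ?I T \<union> (\<Union>b\<in>T. {p \<in> ?I S. p a = b})"
      proof (cases "p a = a")
        case True
        then have "p permutes T" using p permutes_superset[of p S T] T by auto
        then show ?thesis using p by simp
      next
        case False
        then have "p a \<in> T" using p a permutes_in_image[of p S a] T by auto
        then show ?thesis using p by blast
      qed
    next
      fix p assume "p \<in> ?I T \<union> (\<Union>b\<in>T. {p \<in> ?I S. p a = b})"
      then show "p \<in> ?I S" using permutes_subset[of p T S] T(1) by auto
    qed
    have part: "bij_betw (\<lambda>q. transpose a b \<circ> q) (?I (T - {b})) {p \<in> ?I S. p a = b}" if b: "b \<in> T" for b
    proof (rule bij_betwI[where g = "\<lambda>p. transpose a b \<circ> p"])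
      have ab: "a \<noteq> b" "a \<in> S" "b \<in> S" using b T by auto
      have tp: "transpose a b permutes S" using ab by (intro permutes_swap_id) auto
      show "(\<lambda>q. transpose a b \<circ> q) \<in> ?I (T - {b}) \<rightarrow> {p \<in> ?I S. p a = b}"
      proof (intro Pi_I CollectI conjI)
        fix q assume q: "q \<in> ?I (T - {b})"
        have qa: "q a = a" "q b = b" using q T(2) by (auto simp: permutes_def)
        have "q permutes S" using q T by (auto intro: permutes_subset)
        then show "(transpose a b \<circ> q) permutes S" using tp by (intro permutes_compose)
        show "(transpose a b \<circ> q) a = b" using qa by simp
        have inj: "inj q" using q by (auto intro: permutes_inj)
        have qn: "q x = a \<longleftrightarrow> x = a" "q x = b \<longleftrightarrow> x = b" for x
          using inj_eq[OF inj, of x a] inj_eq[OF inj, of x b] qa by auto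
        have qq: "q (q x) = x" for x using q by (simp add: fun_eq_iff)
        show "(transpose a b \<circ> q) \<circ> (transpose a b \<circ> q) = id"
        proof
          fix x
          show "((transpose a b \<circ> q) \<circ> (transpose a b \<circ> q)) x = id x"
            using qn[of x] qn[of "q x"] qa qq ab(1) by (auto simp: transpose_def)
        qed
      qed
      show "(\<lambda>p. transpose a b \<circ> p) \<in> {p \<in> ?I S. p a = b} \<rightarrow> ?I (T - {b})"
      proof (intro Pi_I CollectI conjI)
        fix p assume p: "p \<in> {p \<in> ?I S. p a = b}"
        have pp: "p (p x) = x" for x using p by (simp add: fun_eq_iff)
        have pab: "p a = b" "p b = a" using p pp[of a] by auto
        have inj: "inj p" using p by (auto intro: permutes_inj)
        have pn: "p x = a \<longleftrightarrow> x = b" "p x = b \<longleftrightarrow> x = a" for x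
          using inj_eq[OF inj, of x b] inj_eq[OF inj, of x a] pab by auto
        have "(transpose a b \<circ> p) permutes S" using p tp by (intro permutes_compose) auto
        then show "(transpose a b \<circ> p) permutes (T - {b})"
          by (rule permutes_superset) (use pab T in auto)
        show "(transpose a b \<circ> p) \<circ> (transpose a b \<circ> p) = id"
        proof
          fix x
          show "((transpose a b \<circ> p) \<circ> (transpose a b \<circ> p)) x = id x"
            using pn[of x] pn[of "p x"] pab pp ab(1) by (auto simp: transpose_def)
        qed
      qed
    qed (simp_all add: comp_assoc[symmetric])
    have fin: "finite (?I A)" if "finite A" for A
      using finite_permutations[OF that] by (rule finite_subset[rotated]) auto
    have cpart: "card {p \<in> ?I S. p a = b} = involution_count (card T - 1)" if b: "b \<in> T" for b
    proof -
      have "card (T - {b}) < card S" using cS card_Diff1_le[of T b] by simp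
      then have "card (?I (T - {b})) = involution_count (card (T - {b}))"
        using less.hyps[of "T - {b}"] T(3) by simp
      then show ?thesis using bij_betw_same_card[OF part[OF b]] b T(3) by simp
    qed
    have "card (?I S) = card (?I T) + card (\<Union>b\<in>T. {p \<in> ?I S. p a = b})"
    proof (subst split, rule card_Un_disjoint)
      show "finite (?I T)" using fin T(3) .
      show "finite (\<Union>b\<in>T. {p \<in> ?I S. p a = b})"
        using fin[OF less.prems] by (rule finite_subset[rotated]) auto
      show "?I T \<inter> (\<Union>b\<in>T. {p \<in> ?I S. p a = b}) = {}"
        using T(2) by (auto simp: permutes_def)
    qed
    also have "card (\<Union>b\<in>T. {p \<in> ?I S. p a = b}) = (\<Sum>b\<in>T. card {p \<in> ?I S. p a = b})"
      using T(3) by (intro card_UN_disjoint ballI finite_subset[OF _ fin[OF less.prems]]) auto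
    also have "\<dots> = card T * involution_count (card T - 1)" using cpart by simp
    also have "card (?I T) = involution_count (card T)" using less.hyps[of T] cS T(3) by simp
    also have "involution_count (card T) + card T * involution_count (card T - 1) = involution_count (Suc (card T))"
      by (cases "card T") simp_all
    finally show ?thesis unfolding cS .
  qed
qed

text \<open>The recursion holds termwise after division by factorials: in (n + 2) g(n + 2, z) write
  n + 2 = (n + 2 - 2z) + 2z. The first part cancels into g(n + 1, z), the second into g(n, z -
  1).\<close>

lemma involution_count_formula:
  "real (involution_count m) = fact m * (\<Sum>z = 0..m div 2. 1 / (fact (m - 2 * z) * fact z * 2 ^ z))"
proof -
  \<comment> \<open>The value 0 beyond the range of z lets the sums for n, n + 1 and n + 2 run over
    one common range.\<close>
  define g where "g n z = (if 2 * z \<le> n then 1 / (fact (n - 2 * z) * fact z * 2 ^ z) else 0 :: real)" for n z :: nat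
  have gs: "(\<Sum>z = 0..m div 2. 1 / (fact (m - 2 * z) * fact z * 2 ^ z)) = (\<Sum>z\<le>N. g m z)" if "m \<le> N" for m N
    unfolding g_def using that
    by (intro sum.mono_neutral_cong_left) auto
  have rec: "real (n + 2) * g (n + 2) z = g (n + 1) z + (if z = 0 then 0 else g n (z - 1))" for n z
  proof -
    consider "2 * z \<le> n + 1" | "2 * z = n + 2" | "2 * z > n + 2" by linarith
    then show ?thesis
    proof cases
      case 1
      define k where "k = n + 1 - 2 * z"
      have k: "n + 2 - 2 * z = Suc k" "n + 1 - 2 * z = k" "n + 2 = Suc k + 2 * z" using 1 by (auto simp: k_def)
      have g2: "g (n + 2) z = 1 / (fact (Suc k) * fact z * 2 ^ z)" and g1: "g (n + 1) z = 1 / (fact k * fact z * 2 ^ z)"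
        using 1 k by (simp_all add: g_def)
      show ?thesis
      proof (cases z)
        case 0
        then show ?thesis using k unfolding g1 g2 by (simp add: field_simps del: of_nat_Suc)
      next
        case (Suc y)
        have "n - 2 * y = Suc k" using k Suc by simp
        then have g0: "g n (z - 1) = 1 / (fact (Suc k) * fact y * 2 ^ y)" using 1 Suc by (simp add: g_def)
        have "real (n + 2) = real (Suc k) + 2 * real z" using k(3) by simp
        then show ?thesis unfolding g0 g1 g2 using Suc
          by (simp add: divide_simps algebra_simps del: of_nat_Suc)
      qed
    next
      case 2
      then obtain y where y: "z = Suc y" "n = 2 * y" by (cases z) auto
      have gs: "g (2 * y + 2) (Suc y) = 1 / (fact (Suc y) * 2 ^ Suc y)" "g (2 * y + 1) (Suc y) = 0"
          "g (2 * y) y = 1 / (fact y * 2 ^ y)"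
        by (simp_all add: g_def)
      have "fact (Suc y) * 2 ^ Suc y = real (2 * y + 2) * (fact y * 2 ^ y)" by (simp add: algebra_simps)
      then have "real (2 * y + 2) * (1 / (fact (Suc y) * 2 ^ Suc y)) = 1 / (fact y * 2 ^ y)"
        by (simp only: times_divide_eq_right mult_1_right) (rule nonzero_divide_mult_cancel_left, simp)
      then show ?thesis unfolding y gs by (simp only: gs diff_Suc_1 nat.simps if_False add_0_left)
    next
      case 3
      then show ?thesis by (auto simp: g_def)
    qed
  qed
  have main: "real (involution_count m) = fact m * (\<Sum>z\<le>N. g m z)" if "m \<le> N" for m N
    using that
  proof (induction m rule: involution_count.induct)
    case 1
    have "(\<Sum>z\<le>N. g 0 z) = g 0 0"
      by (subst sum.remove[of _ 0]) (auto simp: g_def intro!: sum.neutral)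
    then show ?case by (simp add: g_def)
  next
    case 2
    have "(\<Sum>z\<le>N. g (Suc 0) z) = g (Suc 0) 0"
      by (subst sum.remove[of _ 0]) (auto simp: g_def intro!: sum.neutral)
    then show ?case by (simp add: g_def)
  next
    case (3 n)
    then obtain N' where N': "N = Suc N'" by (cases N) auto
    have "real (n + 2) * (\<Sum>z\<le>N. g (n + 2) z) = (\<Sum>z\<le>N. g (n + 1) z) + (\<Sum>z\<le>N. if z = 0 then 0 else g n (z - 1))"
      by (simp only: sum_distrib_left rec sum.distrib)
    also have "(\<Sum>z\<le>N. if z = 0 then 0 else g n (z - 1)) = (\<Sum>z\<le>N'. g n z)"
      unfolding N' by (subst sum.atMost_Suc_shift) simp
    also have "\<dots> = (\<Sum>z\<le>N. g n z)" unfolding N' using 3(3) N' by (simp add: g_def)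
    finally have r: "real (n + 2) * (\<Sum>z\<le>N. g (n + 2) z) = (\<Sum>z\<le>N. g (n + 1) z) + (\<Sum>z\<le>N. g n z)" .
    have "fact (n + 2) * (\<Sum>z\<le>N. g (n + 2) z) = fact (n + 1) * (real (n + 2) * (\<Sum>z\<le>N. g (n + 2) z))"
      by (simp add: algebra_simps)
    also have "\<dots> = fact (n + 1) * (\<Sum>z\<le>N. g (n + 1) z) + real (n + 1) * (fact n * (\<Sum>z\<le>N. g n z))"
      unfolding r by (simp add: algebra_simps)
    also have "\<dots> = real (involution_count (Suc (Suc n)))"
      using 3 by (simp add: algebra_simps)
    finally show ?case by simp
  qed
  show ?thesis using main[OF order_refl] gs[OF order_refl] by simp
qed



section \<open>Full transformation monoids and symmetric inverse monoids\<close>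

definition perm_map :: "nat \<Rightarrow> (nat \<Rightarrow> nat) \<Rightarrow> nat \<rightharpoonup> nat" where
  "perm_map m p = (\<lambda>i. if i < m then Some (p i) else None)"

lemma perm_map_comp:
  assumes "q permutes {..<m}"
  shows "perm_map m p \<circ>\<^sub>m perm_map m q = perm_map m (p \<circ> q)"
proof
  fix i
  have "q i < m" if "i < m" using permutes_in_image[OF assms, of i] that by simp
  then show "(perm_map m p \<circ>\<^sub>m perm_map m q) i = perm_map m (p \<circ> q) i"
    by (simp add: perm_map_def map_comp_def)
qed

lemma perm_map_eq_iff:
  assumes "p permutes {..<m}" "q permutes {..<m}"
  shows "perm_map m p = perm_map m q \<longleftrightarrow> p = q"
proof
  assume eq: "perm_map m p = perm_map m q"
  show "p = q"
  proof
    fix i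
    show "p i = q i"
    proof (cases "i < m")
      case True
      then show ?thesis using fun_cong[OF eq, of i] by (simp add: perm_map_def)
    next
      case False
      then show ?thesis using assms by (simp add: permutes_def)
    qed
  qed
qed simp

lemma perm_map_id: "perm_map m id = Some |` {..<m}"
  by (auto simp: perm_map_def restrict_map_def)

text \<open>The common features of the full transformation monoid and the symmetric inverse monoid:
  partial maps under composition, among them all permutations.\<close>

locale permutation_units = monoid M for M :: "(nat \<rightharpoonup> nat) monoid" (structure) and m :: nat +
  assumes mult_eq: "monoid.mult M = (\<circ>\<^sub>m)" and one_eq: "\<one> = Some |` {..<m}"
    and carrier_sub: "carrier M \<subseteq> {f. dom f \<subseteq> {..<m} \<and> ran f \<subseteq> {..<m}}"
    and perm_map_carrier: "\<And>p. p permutes {..<m} \<Longrightarrow> perm_map m p \<in> carrier M"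
begin

lemma finite_carrier: "finite (carrier M)"
proof -
  have "carrier M \<subseteq> (\<Union>A\<in>Pow {..<m}. {f. dom f = A \<and> ran f \<subseteq> {..<m}})" using carrier_sub by auto
  moreover have "finite (\<Union>A\<in>Pow {..<m}. {f :: nat \<rightharpoonup> nat. dom f = A \<and> ran f \<subseteq> {..<m}})"
    by (intro finite_UN_I finite_set_of_finite_maps finite_Pow_iff[THEN iffD2] finite_lessThan)
      (simp add: finite_subset)
  ultimately show ?thesis by (rule finite_subset)
qed

text \<open>A left inverse makes a partial map total and injective, and on a finite set such a map
  is a permutation.\<close>

lemma Units_eq: "Units M = perm_map m ` {p. p permutes {..<m}}"
proof (intro subset_antisym subsetI)
  fix u assume "u \<in> Units M"
  then obtain v where u: "u \<in> carrier M" and v: "v \<circ>\<^sub>m u = Some |` {..<m}"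
    unfolding Units_def mult_eq one_eq by blast
  have du: "dom u \<subseteq> {..<m}" "ran u \<subseteq> {..<m}" using u carrier_sub by auto
  have ex: "\<exists>j. u i = Some j \<and> v j = Some i" if "i < m" for i
  proof (cases "u i")
    case None
    then have "(v \<circ>\<^sub>m u) i = None" by (simp add: map_comp_def)
    then show ?thesis using that unfolding v by simp
  next
    case (Some j)
    then have "(v \<circ>\<^sub>m u) i = v j" by (simp add: map_comp_def)
    then have "v j = Some i" using that unfolding v by simp
    then show ?thesis using Some by blast
  qed
  define p where "p i = (if i < m then the (u i) else i)" for i
  have up: "u i = Some (p i)" "v (p i) = Some i" if im: "i < m" for i
  proof -
    obtain j where j: "u i = Some j" "v j = Some i" using ex[OF im] by blast
    then have "p i = j" using im by (simp add: p_def)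
    then show "u i = Some (p i)" "v (p i) = Some i" using j by simp_all
  qed
  have "inj_on p {..<m}"
  proof (rule inj_onI)
    fix i j assume ij: "i \<in> {..<m}" "j \<in> {..<m}" "p i = p j"
    have "v (p i) = Some i" "v (p j) = Some j" using ij(1,2) by (simp_all only: lessThan_iff up(2))
    then show "i = j" unfolding ij(3) by simp
  qed
  moreover have "p ` {..<m} \<subseteq> {..<m}"
  proof (rule image_subsetI)
    fix i assume "i \<in> {..<m}"
    then have "i < m" by simp
    from up(1)[OF this] have "p i \<in> ran u" by (rule ranI)
    then show "p i \<in> {..<m}" using du(2) by (rule subsetD[rotated])
  qed
  ultimately have "bij_betw p {..<m} {..<m}"
    unfolding bij_betw_def using endo_inj_surj[OF finite_lessThan] by blast
  then have "p permutes {..<m}" by (rule bij_imp_permutes) (simp add: p_def)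
  moreover have "u = perm_map m p"
  proof
    fix i
    show "u i = perm_map m p i"
    proof (cases "i < m")
      case True
      then show ?thesis using up(1)[OF True] by (simp add: perm_map_def)
    next
      case False
      then have "i \<notin> dom u" using du(1) lessThan_iff by blast
      then show ?thesis using False by (simp add: perm_map_def domIff)
    qed
  qed
  ultimately show "u \<in> perm_map m ` {p. p permutes {..<m}}" by blast
next
  fix u assume "u \<in> perm_map m ` {p. p permutes {..<m}}"
  then obtain p where p: "p permutes {..<m}" "u = perm_map m p" by blast
  note ip = permutes_inv[OF p(1)]
  have "perm_map m (Hilbert_Choice.inv p) \<otimes> u = \<one>" "u \<otimes> perm_map m (Hilbert_Choice.inv p) = \<one>"
    by (simp_all only: mult_eq one_eq p(2) perm_map_comp[OF p(1)] perm_map_comp[OF ip] permutes_inv_o[OF p(1)]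
      perm_map_id)
  then show "u \<in> Units M"
    unfolding Units_def p(2) using perm_map_carrier[OF p(1)] perm_map_carrier[OF ip] by blast
qed

sublocale U: finite_group "units_of M"
  using finite_carrier by (rule finite_group_units_of)

lemma perm_map_unit: "p permutes {..<m} \<Longrightarrow> perm_map m p \<in> carrier (units_of M)"
  by (auto simp: units_of_carrier Units_eq)

lemma perm_map_mult: "q permutes {..<m} \<Longrightarrow> perm_map m p \<otimes>\<^bsub>units_of M\<^esub> perm_map m q = perm_map m (p \<circ> q)"
  by (simp add: units_of_mult mult_eq perm_map_comp)

lemma units_one: "\<one>\<^bsub>units_of M\<^esub> = perm_map m id"
  by (simp add: units_of_one one_eq perm_map_id)

lemma perm_map_inverse:
  assumes "p permutes {..<m}" "q permutes {..<m}" "q \<circ> p = id"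
  shows "inv\<^bsub>units_of M\<^esub> perm_map m p = perm_map m q"
  using assms by (intro U.inv_equality perm_map_unit) (simp_all add: perm_map_mult units_one)

text \<open>The symmetric group on the first i letters inside the group of units; these groups form
  the chain along which the idempotents are built.\<close>

definition stage :: "nat \<Rightarrow> (nat \<rightharpoonup> nat) set" where
  "stage i = perm_map m ` {p. p permutes {..<i}}"

lemma permutes_stage: "i \<le> m \<Longrightarrow> p permutes {..<i} \<Longrightarrow> p permutes {..<m}"
  by (erule permutes_subset) auto

lemma stage_subgroup: "i \<le> m \<Longrightarrow> subgroup (stage i) (units_of M)"
proof (rule U.subgroupI)
  assume i: "i \<le> m"
  show "stage i \<subseteq> carrier (units_of M)" using permutes_stage[OF i] perm_map_unit by (auto simp: stage_def)
  have "perm_map m id \<in> stage i" unfolding stage_def by (intro imageI CollectI permutes_id)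
  then show "stage i \<noteq> {}" by blast
  fix a assume "a \<in> stage i"
  then obtain p where p: "p permutes {..<i}" "a = perm_map m p" by (auto simp: stage_def)
  have "inv\<^bsub>units_of M\<^esub> a = perm_map m (Hilbert_Choice.inv p)"
    unfolding p(2) using p(1) i
    by (intro perm_map_inverse permutes_stage permutes_inv permutes_inv_o(2))
  then show "inv\<^bsub>units_of M\<^esub> a \<in> stage i" using permutes_inv[OF p(1)] by (auto simp: stage_def)
  fix b assume "b \<in> stage i"
  then obtain q where q: "q permutes {..<i}" "b = perm_map m q" by (auto simp: stage_def)
  have "a \<otimes>\<^bsub>units_of M\<^esub> b = perm_map m (p \<circ> q)"
    unfolding p(2) q(2) using permutes_stage[OF i q(1)] by (rule perm_map_mult)
  then show "a \<otimes>\<^bsub>units_of M\<^esub> b \<in> stage i" using permutes_compose[OF q(1) p(1)] by (auto simp: stage_def)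
qed

lemma inj_perm_map: "inj_on (perm_map m) {p. p permutes {..<m}}"
  by (rule inj_onI) (simp add: perm_map_eq_iff)

lemma card_stage: "i \<le> m \<Longrightarrow> card (stage i) = fact i"
  unfolding stage_def
  using permutes_stage by (subst card_image) (auto intro!: inj_on_subset[OF inj_perm_map] simp: card_permutations)

lemma stage_m: "stage m = Units M"
  by (simp add: stage_def Units_eq)

lemma card_Units: "card (Units M) = fact m"
  using card_stage[of m] stage_m by simp

text \<open>With the last letter i as base point, the reflection of \<open>permutes_reversed\<close>
  fixes i and so belongs to the preceding stage.\<close>

lemma stage_reversed:
  assumes i: "i < m" and g: "g \<in> stage (Suc i)"
  shows "\<exists>h\<in>stage i. h \<otimes>\<^bsub>units_of M\<^esub> g \<otimes>\<^bsub>units_of M\<^esub> inv\<^bsub>units_of M\<^esub> h = inv\<^bsub>units_of M\<^esub> g"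
proof -
  obtain p where p: "p permutes {..<Suc i}" "g = perm_map m p" using g by (auto simp: stage_def)
  obtain h where h: "h permutes {..<Suc i} - {i}" "h \<circ> h = id" "h \<circ> p \<circ> h \<circ> p = id"
    using permutes_reversed[OF p(1) finite_lessThan, of i] lessThan_iff[of i "Suc i"] lessI[of i] by blast
  have "{..<Suc i} - {i} = {..<i}" by auto
  then have h': "h permutes {..<i}" using h(1) by simp
  have hm: "h permutes {..<m}" and pm: "p permutes {..<m}"
    using permutes_stage[OF _ h'] permutes_stage[OF _ p(1)] i by simp_all
  have hph: "h \<circ> p \<circ> h permutes {..<m}" using hm pm by (intro permutes_compose)
  have ih: "inv\<^bsub>units_of M\<^esub> perm_map m h = perm_map m h"
    using hm h(2) by (intro perm_map_inverse)
  have ig: "inv\<^bsub>units_of M\<^esub> perm_map m p = perm_map m (h \<circ> p \<circ> h)"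
    using pm hph h(3) by (rule perm_map_inverse)
  have "perm_map m h \<otimes>\<^bsub>units_of M\<^esub> perm_map m p \<otimes>\<^bsub>units_of M\<^esub> perm_map m h = perm_map m (h \<circ> p \<circ> h)"
    unfolding perm_map_mult[OF pm] perm_map_mult[OF hm] ..
  then show ?thesis using h' unfolding p(2) ig by (intro bexI[of _ "perm_map m h"]) (auto simp: ih stage_def)
qed

lemma card_unit_involutions:
  "card {g \<in> carrier (units_of M). g \<otimes>\<^bsub>units_of M\<^esub> g = \<one>\<^bsub>units_of M\<^esub>} = involution_count m"
proof -
  have "{g \<in> carrier (units_of M). g \<otimes>\<^bsub>units_of M\<^esub> g = \<one>\<^bsub>units_of M\<^esub>} =
      perm_map m ` {p. p permutes {..<m} \<and> p \<circ> p = id}"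
  proof (intro subset_antisym subsetI)
    fix g assume g: "g \<in> {g \<in> carrier (units_of M). g \<otimes>\<^bsub>units_of M\<^esub> g = \<one>\<^bsub>units_of M\<^esub>}"
    then obtain p where p: "p permutes {..<m}" "g = perm_map m p" by (auto simp: units_of_carrier Units_eq)
    then have "perm_map m (p \<circ> p) = perm_map m id" using g by (simp add: perm_map_mult units_one)
    then have "p \<circ> p = id"
      using perm_map_eq_iff[OF permutes_compose[OF p(1) p(1)] permutes_id] by simp
    then show "g \<in> perm_map m ` {p. p permutes {..<m} \<and> p \<circ> p = id}" using p by blast
  next
    fix g assume "g \<in> perm_map m ` {p. p permutes {..<m} \<and> p \<circ> p = id}"
    then obtain p where "p permutes {..<m}" "p \<circ> p = id" "g = perm_map m p" by blast
    then show "g \<in> {g \<in> carrier (units_of M). g \<otimes>\<^bsub>units_of M\<^esub> g = \<one>\<^bsub>units_of M\<^esub>}"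
      by (simp add: perm_map_unit perm_map_mult units_one)
  qed
  moreover have "inj_on (perm_map m) {p. p permutes {..<m} \<and> p \<circ> p = id}"
    using inj_perm_map by (rule inj_on_subset) auto
  ultimately show ?thesis using card_involutions[of "{..<m}"] by (simp add: card_image)
qed

text \<open>A primitive refinement of the system consisting of 1 is split by the hypothesis on the
  field. The orders i! of the stages divide m!, so they are invertible as well.\<close>

lemma primitive_system_exists:
  assumes nz: "of_nat (fact m) \<noteq> (0::'k::field)" and split: "splitting_field TYPE('k::field) M"
  obtains E :: "((nat \<rightharpoonup> nat) \<Rightarrow> 'k::field) set" where "U.idempotent_system (Units M) E"
    "\<forall>e\<in>E. U.primitive (Units M) e" "card E = involution_count m"
proof -
  obtain E :: "((nat \<rightharpoonup> nat) \<Rightarrow> 'k) set" where E: "U.idempotent_system (carrier (units_of M)) E"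
      "\<And>e. e \<in> E \<Longrightarrow> U.primitive (carrier (units_of M)) e"
    using U.primitive_refinement_exists[OF U.trivial_idempotent_system order_refl] by blast
  have nzU: "of_nat (card (Units M)) \<noteq> (0::'k)" using nz by (simp add: card_Units)
  have "card E = card {g \<in> carrier (units_of M). g \<otimes>\<^bsub>units_of M\<^esub> g = \<one>\<^bsub>units_of M\<^esub>}"
  proof (rule U.card_split_system[of m stage, OF _ _ _ _ _ _ E(1)])
    show "subgroup (stage i) (units_of M)" if "i \<le> m" for i using that by (rule stage_subgroup)
    show "stage 0 = {\<one>\<^bsub>units_of M\<^esub>}" by (simp add: stage_def units_one)
    show "stage i \<subseteq> stage (Suc i)" for i
      unfolding stage_def by (intro image_mono Collect_mono impI) (erule permutes_subset, auto)
    show "stage m = carrier (units_of M)" by (simp add: stage_m units_of_carrier)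
    show "of_nat (card (stage i)) \<noteq> (0::'k)" if "i \<le> m" for i
      using nz fact_dvd[OF that, where 'a=nat] dvd_trans unfolding card_stage[OF that] of_nat_eq_0_iff_char_dvd by blast
    show "\<exists>h\<in>stage i. h \<otimes>\<^bsub>units_of M\<^esub> g \<otimes>\<^bsub>units_of M\<^esub> inv\<^bsub>units_of M\<^esub> h = inv\<^bsub>units_of M\<^esub> g"
      if "i < m" "g \<in> stage (Suc i)" for i g using that by (rule stage_reversed)
    show "U.split_idempotent (carrier (units_of M)) e" if "e \<in> E" for e
      using splitting_field_imp_split_idempotent[OF finite_carrier split nzU, of e] E(2)[OF that]
      by (simp add: units_of_carrier)
  qed
  also note card_unit_involutions
  finally have "card E = involution_count m" .
  then show ?thesis using that[of E] E unfolding units_of_carrier by blast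
qed

text \<open>By faithfulness a scalar unit is central, but the symmetric group has trivial centre for \<open>m \<ge> 3\<close>.\<close>

lemma units_nonscalar:
  fixes V :: "(nat \<rightharpoonup> nat, 'k::field, 'v::ab_group_add) monoid_module"
  assumes m: "m \<ge> 3" and V: "power_module M V"
    and faithful: "\<And>g. g \<in> carrier M \<Longrightarrow> (\<And>v. v \<in> vecs V \<Longrightarrow> action V g v = v) \<Longrightarrow> g = \<one>"
    and x: "x \<in> Units M" "x \<noteq> \<one>"
  shows "\<exists>v\<in>vecs V. action V x v \<notin> module.span (smul V) {v}"
proof (rule ccontr)
  interpret V: power_module M V by fact
  note xc = Units_closed[OF x(1)]
  assume "\<not> ?thesis"
  then have ev: "\<exists>c. action V x v = smul V c v" if "v \<in> vecs V" for v
    using that by (auto simp: V.span_singleton)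
  obtain v0 where v0: "v0 \<in> vecs V" "v0 \<noteq> 0"
    using faithful[OF xc] x(2) V.action_zero[OF xc] by metis
  obtain c where c: "action V x v0 = smul V c v0" using ev[OF v0(1)] by blast
  \<comment> \<open>If every vector is an eigenvector, all eigenvalues agree: compare
    \<open>v0\<close>, v and their sum.\<close>
  have scalar: "action V x v = smul V c v" if v: "v \<in> vecs V" for v
  proof (cases "v \<in> V.span {v0}")
    case True
    then obtain a where a: "v = smul V a v0" by (auto simp: V.span_singleton)
    show ?thesis unfolding a V.action_scale[OF xc v0(1)] c by (simp add: mult.commute)
  next
    case False
    obtain a where a: "action V x v = smul V a v" using ev[OF v] by blast
    obtain e where e: "action V x (v0 + v) = smul V e (v0 + v)"
      using ev[OF V.subspace_add[OF V.subspace_vecs v0(1) v]] by blast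
    have "smul V e v0 + smul V e v = smul V c v0 + smul V a v"
      using e unfolding V.action_add[OF xc v0(1) v] c a by (simp add: V.scale_right_distrib)
    then have eq: "smul V (e - a) v = smul V (c - e) v0"
      by (simp add: V.scale_left_diff_distrib algebra_simps)
    have ea: "e = a"
    proof (rule ccontr)
      assume "e \<noteq> a"
      then have "v = smul V (1 / (e - a)) (smul V (e - a) v)" by simp
      also have "\<dots> \<in> V.span {v0}" unfolding eq by (intro V.span_scale V.span_base) simp
      finally show False using False by simp
    qed
    then have "smul V (c - e) v0 = 0" using eq by simp
    then have "c = e" using v0(2) by simp
    then show ?thesis using a ea by simp
  qed
  have comm: "g \<otimes> x = x \<otimes> g" if g: "g \<in> Units M" for g
  proof -
    note gc = Units_closed[OF g] and ig = Units_closed[OF Units_inv_Units[OF g]]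
      and ix = Units_closed[OF Units_inv_Units[OF x(1)]]
    \<comment> \<open>This commutator acts as the identity because the scalars cancel; by
      faithfulness it is 1.\<close>
    let ?y = "inv x \<otimes> (inv g \<otimes> (x \<otimes> g))"
    have "action V ?y v = v" if v: "v \<in> vecs V" for v
    proof -
      have gv: "action V g v \<in> vecs V" by (rule V.action_closed[OF gc v])
      have "action V ?y v = action V (inv x) (action V (inv g) (action V x (action V g v)))"
        using xc gc ig ix v by (simp add: V.action_mult V.action_closed)
      also have "action V x (action V g v) = smul V c (action V g v)" by (rule scalar[OF gv])
      also have "action V (inv g) (smul V c (action V g v)) = smul V c (action V (inv g) (action V g v))"
        by (rule V.action_scale[OF ig gv])
      also have "action V (inv g) (action V g v) = v"
        using g v by (simp add: V.action_mult[OF ig gc v, symmetric] V.action_one)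
      also have "smul V c v = action V x v" by (rule scalar[OF v, symmetric])
      also have "action V (inv x) (action V x v) = v"
        using x(1) v by (simp add: V.action_mult[OF ix xc v, symmetric] V.action_one)
      finally show ?thesis .
    qed
    then have y: "?y = \<one>" using xc gc ig ix by (intro faithful) auto
    have "g \<otimes> (x \<otimes> ?y) = x \<otimes> g"
      using x(1) g xc gc ig ix by (simp add: m_assoc[symmetric])
    then show ?thesis unfolding y using xc by simp
  qed
  obtain p where p: "p permutes {..<m}" "x = perm_map m p" using x(1) by (auto simp: Units_eq)
  have "p \<noteq> id" using x(2) p(2) by (auto simp: one_eq perm_map_id)
  then obtain i where i: "p i \<noteq> i" by (auto simp: fun_eq_iff)
  then have im: "i < m" using p(1) by (auto simp: permutes_def)
  then have pim: "p i < m" using permutes_in_image[OF p(1), of i] by simp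
  have "\<not> {..<m} \<subseteq> {i, p i}"
  proof
    assume "{..<m} \<subseteq> {i, p i}"
    then have "card {..<m} \<le> card {i, p i}" by (rule card_mono[rotated]) simp
    also have "\<dots> \<le> 2" by (simp add: card_insert_if)
    finally show False using m by simp
  qed
  \<comment> \<open>The transposition of p i and k does not commute with p: following p by it sends
    i to k, while preceding p by it sends i to p i. A third letter exists since m \<ge> 3.\<close>
  then obtain k where k: "k < m" "k \<noteq> i" "k \<noteq> p i" by blast
  let ?q = "transpose (p i) k"
  have q: "?q permutes {..<m}" using pim k by (intro permutes_swap_id) auto
  have "perm_map m ?q \<otimes> perm_map m p = perm_map m p \<otimes> perm_map m ?q"
    using comm[of "perm_map m ?q"] q p(2) by (auto simp: Units_eq)
  then have "perm_map m (?q \<circ> p) = perm_map m (p \<circ> ?q)"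
    unfolding mult_eq perm_map_comp[OF p(1)] perm_map_comp[OF q] .
  then have "(?q \<circ> p) i = (p \<circ> ?q) i"
    using perm_map_eq_iff[OF permutes_compose[OF p(1) q] permutes_compose[OF q p(1)]] by (metis)
  then show False using i k by (simp add: transpose_def split: if_splits)
qed

end

lemma permutation_units_full_transformation: "permutation_units (full_transformation_monoid m) m"
proof (intro permutation_units.intro permutation_units_axioms.intro monoid_full_transformation_monoid)
  fix p assume p: "p permutes {..<m}"
  have "p i < m" if "i < m" for i using permutes_in_image[OF p, of i] that by simp
  then show "perm_map m p \<in> carrier (full_transformation_monoid m)"
    by (auto simp: full_transformation_monoid_def perm_map_def ran_def dom_def split: if_splits)
qed (auto simp: full_transformation_monoid_def)

lemma permutation_units_symmetric_inverse: "permutation_units (symmetric_inverse_monoid m) m"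
proof (intro permutation_units.intro permutation_units_axioms.intro monoid_symmetric_inverse_monoid)
  fix p assume p: "p permutes {..<m}"
  have "p i < m" if "i < m" for i using permutes_in_image[OF p, of i] that by simp
  moreover have "inj p" using p by (rule permutes_inj)
  ultimately show "perm_map m p \<in> carrier (symmetric_inverse_monoid m)"
    by (auto simp: symmetric_inverse_monoid_def perm_map_def ran_def dom_def inj_on_def inj_def split: if_splits)
qed (auto simp: symmetric_inverse_monoid_def)

section \<open>Asymptotics\<close>

text \<open>After division by d^n the defect N (d - 1)^n tends to 0, so the lower and upper bounds
  have the same limit.\<close>

lemma asymp_equiv_sandwich:
  fixes b l h :: "nat \<Rightarrow> nat" and C :: real
  assumes C: "C > 0" and d: "d > 0"
    and le: "\<And>n. b n \<le> l n" "\<And>n. l n \<le> h n" "\<And>n. h n \<le> b n + N * (d - 1) ^ n"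
    and lim: "(\<lambda>n. real (h n) / real d ^ n) \<longlonglongrightarrow> C"
  shows "(\<lambda>n. real (b n)) \<sim>[at_top] (\<lambda>n. C * real d ^ n) \<and> (\<lambda>n. C * real d ^ n) \<sim>[at_top] (\<lambda>n. real (l n))"
proof -
  have dp: "0 < real d ^ n" for n using d by simp
  have pz: "(\<lambda>n. (real (d - 1) / real d) ^ n) \<longlonglongrightarrow> 0"
  proof (rule LIMSEQ_power_zero)
    have "real (d - 1) / real d < 1" using d by (subst divide_less_eq_1_pos) auto
    moreover have "0 \<le> real (d - 1) / real d" by (intro divide_nonneg_nonneg of_nat_0_le_iff)
    ultimately show "norm (real (d - 1) / real d) < 1" unfolding real_norm_def by (simp only: abs_of_nonneg)
  qed
  have "(\<lambda>n. real (h n) / real d ^ n - real N * (real (d - 1) / real d) ^ n) \<longlonglongrightarrow> C - real N * 0"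
    by (intro tendsto_diff tendsto_mult tendsto_const lim pz)
  then have low: "(\<lambda>n. real (h n) / real d ^ n - real N * (real (d - 1) / real d) ^ n) \<longlonglongrightarrow> C" by simp
  have lb: "real (h n) / real d ^ n - real N * (real (d - 1) / real d) ^ n \<le> real (b n) / real d ^ n" for n
  proof -
    have "real (h n) \<le> real (b n) + real N * real (d - 1) ^ n"
      using le(3)[of n] by (metis of_nat_add of_nat_le_iff of_nat_mult of_nat_power)
    then have "real (h n) / real d ^ n \<le> (real (b n) + real N * real (d - 1) ^ n) / real d ^ n"
      using dp[of n] by (intro divide_right_mono) auto
    then show ?thesis by (simp add: add_divide_distrib power_divide)
  qed
  have bl: "real (b n) / real d ^ n \<le> real (l n) / real d ^ n" "real (l n) / real d ^ n \<le> real (h n) / real d ^ n" for n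
    using le(1,2)[of n] dp[of n] by (auto intro!: divide_right_mono)
  have "(\<lambda>n. real (b n) / real d ^ n) \<longlonglongrightarrow> C"
    by (rule tendsto_sandwich[OF always_eventually always_eventually low lim])
      (rule allI, rule lb, rule allI, rule order_trans[OF bl])
  moreover have "(\<lambda>n. real (l n) / real d ^ n) \<longlonglongrightarrow> C"
    by (rule tendsto_sandwich[OF always_eventually always_eventually low lim])
      (rule allI, rule order_trans[OF lb bl(1)], rule allI, rule bl(2))
  ultimately show ?thesis
    using C by (auto intro!: asymp_equivI'_const asymp_equiv_symI[OF asymp_equivI'_const])
qed

lemma (in permutation_units) unit_height_asymptotics:
  fixes V :: "(nat \<rightharpoonup> nat, 'k::field, 'v::ab_group_add) monoid_module"
  assumes m: "m \<ge> 1" and V: "power_module M V"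
    and nz: "of_nat (fact m) \<noteq> (0::'k)" and split: "splitting_field TYPE('k) M"
    and faithful: "\<And>g. g \<in> carrier M \<Longrightarrow> (\<And>v. v \<in> vecs V \<Longrightarrow> action V g v = v) \<Longrightarrow> g = \<one>"
    and d: "module_dim V > 0"
  shows "(\<lambda>n. real (power_module.unit_height M V n) / real (module_dim V) ^ n)
    \<longlonglongrightarrow> (\<Sum>z = 0..m div 2. 1 / (fact (m - 2 * z) * fact z * 2 ^ z))"
proof -
  interpret V: power_module M V by fact
  have nzU: "of_nat (card (Units M)) \<noteq> (0::'k)" using nz by (simp add: card_Units)
  let ?C = "\<Sum>z = 0..m div 2. 1 / (fact (m - 2 * z) * fact z * 2 ^ z) :: real"
  define d where "d = module_dim V"
  have dp: "0 < real d ^ n" for n using \<open>module_dim V > 0\<close> by (simp add: d_def)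
  show ?thesis
  proof (cases "m \<le> 2")
    case True
    then consider "m = 1" | "m = 2" using m by linarith
    then have C: "?C = 1" and small: "card (Units M) \<le> 2" by (cases; simp add: card_Units)+
    have one: "real (module_dim V ^ n) / real (module_dim V) ^ n = 1" for n using dp[of n] by (simp add: d_def)
    show ?thesis
      unfolding C V.unit_height_small[OF nzU small] one by (rule tendsto_const)
  next
    case False
    then have m3: "m \<ge> 3" by simp
    define N where "N = card (Units M)"
    have N: "N = fact m" by (simp add: N_def card_Units)
    have "(fact 2 :: nat) \<le> fact m" using m3 by (intro fact_mono) simp
    then have N2: "N \<ge> 2" by (simp add: N)
    define K where "K = N - 1"
    have K: "K > 0" using N2 by (simp add: K_def)
    obtain w R where w: "w \<in> V.lists_over (vecs V) K" "finite R"
        "V.spanning K ((\<lambda>g. map (action V g) w) ` Units M \<union> R)" "N + card R = d ^ K"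
      using V.free_pure_tensor[OF units_nonscalar[OF m3 V faithful]] unfolding K_def N_def d_def by blast
    obtain E :: "((nat \<rightharpoonup> nat) \<Rightarrow> 'k) set" where E: "U.idempotent_system (Units M) E"
        "\<forall>e\<in>E. U.primitive (Units M) e" "card E = involution_count m"
      using nz split by (rule primitive_system_exists)
    \<comment> \<open>The share of the nonfree part in the K-th tensor power; it is less than 1
      because a nonempty free part is present.\<close>
    define \<rho> where "\<rho> = real (card R) / real (d ^ K)"
    have "card R < d ^ K" using w(4) N2 by simp
    then have \<rho>: "0 \<le> \<rho>" "\<rho> < 1" using dp[of K] by (auto simp: \<rho>_def divide_simps)
    define r where "r = real (involution_count m)"
    have C: "?C = r / real N" using involution_count_formula[of m] by (simp add: r_def N)
    \<comment> \<open>n is split into q full blocks of length K and s < K further factors. The s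
      factors enter numerator and denominator alike, so the relative size of the remainder is at
      most \<rho>^q.\<close>
    have bound: "\<bar>real (V.unit_height n) / real d ^ n - r / real N\<bar> \<le> (r + 1) * \<rho> ^ (n div K)" for n
    proof -
      define q s where "q = n div K" and "s = n mod K"
      have n: "n = K * q + s" by (simp add: q_def s_def)
      obtain J Q where JQ: "V.almost_free n J Q" "card Q \<le> card R ^ q * d ^ s"
        using V.almost_free_iterate[OF w(1-3), of q s] w(4) unfolding n N_def d_def by auto
      have "card E * module_dim V ^ n \<le> card (Units M) * V.unit_height n + card E * card Q"
        "card (Units M) * V.unit_height n \<le> card E * module_dim V ^ n + card (Units M) * card Q"
        by (rule V.unit_height_almost_free[OF nzU E(1) _ JQ(1)], rule bspec[OF E(2)], assumption)+
      note bd = this[unfolded E(3), folded d_def N_def]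
      define H where "H = real (V.unit_height n)"
      define D where "D = real d ^ n"
      define c where "c = real (card Q)"
      have D0: "D > 0" and N0: "real N > 0" using dp[of n] N2 by (auto simp: D_def)
      have c0: "c \<ge> 0" "r \<ge> 0" by (auto simp: c_def r_def)
      have 1: "r * D \<le> real N * H + r * c"
        using bd(1) unfolding r_def D_def H_def c_def by (metis of_nat_add of_nat_le_iff of_nat_mult of_nat_power)
      have 2: "real N * H \<le> r * D + real N * c"
        using bd(2) unfolding r_def D_def H_def c_def by (metis of_nat_add of_nat_le_iff of_nat_mult of_nat_power)
      have "\<rho> ^ q * D = real (card R) ^ q * real d ^ s"
        using dp[of 1] by (simp add: \<rho>_def D_def n power_add power_mult power_divide)
      then have "c \<le> \<rho> ^ q * D"
        using JQ(2) unfolding c_def by (metis of_nat_le_iff of_nat_mult of_nat_power)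
      then have cD: "c / D \<le> \<rho> ^ q" using D0 by (simp add: divide_simps)
      have "H / D - r / real N = (real N * H - r * D) / (real N * D)" using D0 N0 by (simp add: field_simps)
      then have eq: "\<bar>H / D - r / real N\<bar> = \<bar>real N * H - r * D\<bar> / (real N * D)"
        using D0 N0 by (simp add: abs_mult)
      have "\<bar>real N * H - r * D\<bar> \<le> (r + 1) * (real N * c)"
      proof -
        have "r * c \<le> r * (real N * c)" using c0 N2 by (intro mult_left_mono mult_le_cancel_right1[THEN iffD2]) auto
        moreover have "0 \<le> r * (real N * c)" "0 \<le> real N * c" using c0 by auto
        ultimately show ?thesis using 1 2 by (auto simp: abs_le_iff algebra_simps)
      qed
      then have "\<bar>H / D - r / real N\<bar> \<le> (r + 1) * (real N * c) / (real N * D)"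
        unfolding eq using D0 N0 by (intro divide_right_mono) auto
      also have "\<dots> = (r + 1) * (c / D)" using N0 by simp
      also have "\<dots> \<le> (r + 1) * \<rho> ^ q" using cD c0 by (intro mult_left_mono) auto
      finally show ?thesis by (simp add: H_def D_def q_def)
    qed
    have "filterlim (\<lambda>n. n div K) at_top at_top" using K by (rule filterlim_at_top_div_const_nat)
    moreover have "(\<lambda>q. \<rho> ^ q) \<longlonglongrightarrow> 0" using \<rho> by (intro LIMSEQ_power_zero) simp
    ultimately have "(\<lambda>n. \<rho> ^ (n div K)) \<longlonglongrightarrow> 0" by (rule filterlim_compose[rotated])
    then have "(\<lambda>n. (r + 1) * \<rho> ^ (n div K)) \<longlonglongrightarrow> 0" by (rule tendsto_mult_right_zero)
    then have "(\<lambda>n. \<bar>real (V.unit_height n) / real d ^ n - r / real N\<bar>) \<longlonglongrightarrow> 0"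
      by (rule tendsto_sandwich[OF always_eventually always_eventually tendsto_const, rotated 2])
        (rule allI, rule abs_ge_zero, rule allI, rule bound)
    then have "(\<lambda>n. real (V.unit_height n) / real d ^ n - r / real N) \<longlonglongrightarrow> 0"
      by (rule tendsto_rabs_zero_cancel)
    then show ?thesis unfolding C d_def by (rule LIM_zero_cancel)
  qed
qed

theorem proposition2:
  fixes m :: nat
    and M :: "(nat \<rightharpoonup> nat) monoid"
    and V :: "(nat \<rightharpoonup> nat, 'k::field, 'v::ab_group_add) monoid_module"
    and b l :: "nat \<Rightarrow> nat"
  assumes "m \<ge> 1"
    and "splitting_field TYPE('k) M"
    and "CHAR('k) = 0 \<and> M = full_transformation_monoid m \<or>
         \<not> CHAR('k) dvd (fact m :: nat) \<and> M = symmetric_inverse_monoid m"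
    and "is_module M V" and "finite_dim V"
    and "\<forall>g\<in>carrier M. (\<forall>v\<in>vecs V. action V g v = v) \<longrightarrow> g = \<one>\<^bsub>M\<^esub>"
    and "\<forall>n. num_indecomposable_summands M (tensor_power V n) (b n)"
    and "\<forall>n. module_length M (tensor_power V n) (l n)"
  shows "(\<lambda>n. real (b n)) \<sim>[at_top]
           (\<lambda>n. (\<Sum>z = 0..m div 2. 1 / (fact (m - 2 * z) * fact z * 2 ^ z)) * real (module_dim V) ^ n) \<and>
         (\<lambda>n. (\<Sum>z = 0..m div 2. 1 / (fact (m - 2 * z) * fact z * 2 ^ z)) * real (module_dim V) ^ n)
           \<sim>[at_top] (\<lambda>n. real (l n))"
proof -
  have "permutation_units M m"
    using assms(3) permutation_units_full_transformation permutation_units_symmetric_inverse by blast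
  then interpret M: permutation_units M m .
  \<comment> \<open>In characteristic 0 this holds because 0 divides only 0.\<close>
  have "\<not> CHAR('k) dvd (fact m :: nat)" using assms(3) by auto
  then have nz: "of_nat (fact m) \<noteq> (0::'k)" by (simp only: of_nat_eq_0_iff_char_dvd not_False_eq_True)
  have nzU: "of_nat (card (Units M)) \<noteq> (0::'k)" using nz by (simp only: M.card_Units not_False_eq_True)
  have V: "power_module M V"
    using M.monoid_axioms assms(4,5) M.finite_carrier
    by (intro power_module.intro fd_module.intro power_module_axioms.intro)
  interpret V: power_module M V by fact
  have faithful: "g = \<one>\<^bsub>M\<^esub>" if "g \<in> carrier M" "\<And>v. v \<in> vecs V \<Longrightarrow> action V g v = v" for g
    using assms(6) that by blast
  have sw: "b n \<le> l n" "l n \<le> V.unit_height n" "V.unit_height n \<le> module_dim V ^ n"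
    "V.unit_height n \<le> b n + 2 * card (carrier M) * (module_dim V - 1) ^ n" for n
    using V.summands_length_sandwich[OF nzU faithful assms(7)[rule_format, of n] assms(8)[rule_format, of n]]
    by blast+
  let ?C = "\<Sum>z = 0..m div 2. 1 / (fact (m - 2 * z) * fact z * 2 ^ z) :: real"
  have C: "?C > 0" by (intro sum_pos) auto
  show ?thesis
  proof (cases "module_dim V = 0")
    case True
    have zero: "b n = 0 \<and> l n = 0" if "n > 0" for n
      using sw(1-3)[of n] True that by (simp add: zero_power)
    have "\<forall>\<^sub>F n in at_top. real (b n) = ?C * real (module_dim V) ^ n"
      "\<forall>\<^sub>F n in at_top. ?C * real (module_dim V) ^ n = real (l n)"
      using zero True by (auto intro!: eventually_mono[OF eventually_gt_at_top[of 0]])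
    then show ?thesis by (auto intro: asymp_equiv_refl_ev)
  next
    case False
    then have d: "module_dim V > 0" by simp
    show ?thesis
      by (rule asymp_equiv_sandwich[OF C d sw(1,2,4)])
        (rule M.unit_height_asymptotics[OF assms(1) V nz assms(2) _ d], rule faithful, assumption, blast)
  qed
qed

end
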